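(* Let $M$ be a countable structure in a countable language (with no function symbols). Then $M$ is cellular if and only if $M$ is mutually algebraic and $\omega$-categorical.
   Context: Convention: languages have only relation and constant symbols. For a structure $M$, an $n$-ary relation $R\subseteq M^n$ is mutually algebraic if there is a constant $K$ such that for each $m\in M$ the number of tuples $\bar b\in M^n$ with $\bar b\in R$ and $m$ occurring in $\bar b$ is at most $K$; a formula is mutually algebraic if the relation it defines in $M$ is. $M$ is mutually algebraic if every $\mathcal{L}_M$-formula (where $\mathcal{L}_M$ is $\mathcal L$ expanded by constants for all elements of $M$) is equivalent in $M$ to a boolean combination of mutually algebraic $\mathcal{L}_M$-formulas. A structure $M$ is cellular if for some integers $n$ and $k_1,\dots,k_n$ it admits a partition $\{K\}\cup\{\bar c_{i,j}: i\in[n], j\in\omega\}$ (the tuples' entries together with $K$ partition $M$) such that: (1) $K$ is finite and $\bar c_{i,j}$ has length $k_i$; (2) for fixed $i$, the tuples $\bar c_{i,j}$ ($j\in\omega$) are pairwise isomorphic over $K$, and we write $\bar c_{i,j}=(c^1_{i,j},\dots,c^{k_i}_{i,j})$; (3) for every $i\in[n]$ and every permutation $\sigma$ of $\omega$ there is an automorphism of $M$ sending $c^\ell_{i,j}$ to $c^\ell_{i,\sigma(j)}$ for all $j$ and $1\le\ell\le k_i$, and fixing $M\setminus\bigcup_j\bar c_{i,j}$ pointwise. *)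

theory Defs
  imports Main "HOL-Library.Countable_Set" "HOL-Library.Disjoint_Sets"
begin

section \<open>Relational languages with constants, and their structures\<close>

text \<open>The symbols of a language are given by sets rather than by whole types, so that a language
  may have no relation symbols or no constant symbols.\<close>

record ('r, 'c) lang =
  Rels :: "'r set"
  arity :: "'r \<Rightarrow> nat"
  Consts :: "'c set"

record ('r, 'c, 'a) fostruct =
  univ :: "'a set"
  rel :: "'r \<Rightarrow> 'a list set"
  cst :: "'c \<Rightarrow> 'a"

definition tuples :: "'a set \<Rightarrow> nat \<Rightarrow> 'a list set" where
  "tuples A n = {xs. length xs = n \<and> set xs \<subseteq> A}"

definition is_struct :: "('r, 'c) lang \<Rightarrow> ('r, 'c, 'a) fostruct \<Rightarrow> bool" where
  "is_struct L M \<longleftrightarrow>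
     univ M \<noteq> {} \<and>
     (\<forall>r\<in>Rels L. rel M r \<subseteq> tuples (univ M) (arity L r)) \<and>
     (\<forall>c\<in>Consts L. cst M c \<in> univ M)"

definition is_iso ::
  "('r, 'c) lang \<Rightarrow> ('r, 'c, 'a) fostruct \<Rightarrow> ('r, 'c, 'b) fostruct \<Rightarrow> ('a \<Rightarrow> 'b) \<Rightarrow> bool" where
  "is_iso L M N f \<longleftrightarrow>
     bij_betw f (univ M) (univ N) \<and>
     (\<forall>r\<in>Rels L. \<forall>xs\<in>tuples (univ M) (arity L r). xs \<in> rel M r \<longleftrightarrow> map f xs \<in> rel N r) \<and>
     (\<forall>c\<in>Consts L. f (cst M c) = cst N c)"

definition isomorphic ::
  "('r, 'c) lang \<Rightarrow> ('r, 'c, 'a) fostruct \<Rightarrow> ('r, 'c, 'b) fostruct \<Rightarrow> bool" where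
  "isomorphic L M N \<longleftrightarrow> (\<exists>f. is_iso L M N f)"

definition is_aut :: "('r, 'c) lang \<Rightarrow> ('r, 'c, 'a) fostruct \<Rightarrow> ('a \<Rightarrow> 'a) \<Rightarrow> bool" where
  "is_aut L M f \<longleftrightarrow> is_iso L M M f"

text \<open>As there are no function symbols, the substructure generated by a set is obtained by
  adjoining the interpretations of the constant symbols.\<close>

definition gen_substruct ::
  "('r, 'c) lang \<Rightarrow> ('r, 'c, 'a) fostruct \<Rightarrow> 'a set \<Rightarrow> ('r, 'c, 'a) fostruct" where
  "gen_substruct L M A =
     (let B = A \<union> cst M ` Consts L
      in \<lparr>univ = B, rel = (\<lambda>r. rel M r \<inter> lists B), cst = cst M\<rparr>)"


section \<open>First-order formulas\<close>

datatype 'c trm = Var nat | Cst 'c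

datatype ('r, 'c) fm =
    Eq "'c trm" "'c trm"
  | Rel 'r "'c trm list"
  | Neg "('r, 'c) fm"
  | Conj "('r, 'c) fm" "('r, 'c) fm"
  | Ex nat "('r, 'c) fm"

fun fv_trm :: "'c trm \<Rightarrow> nat set" where
  "fv_trm (Var x) = {x}"
| "fv_trm (Cst c) = {}"

fun fv :: "('r, 'c) fm \<Rightarrow> nat set" where
  "fv (Eq s t) = fv_trm s \<union> fv_trm t"
| "fv (Rel r ts) = (\<Union>t\<in>set ts. fv_trm t)"
| "fv (Neg p) = fv p"
| "fv (Conj p q) = fv p \<union> fv q"
| "fv (Ex x p) = fv p - {x}"

fun trm_of :: "('r, 'c) lang \<Rightarrow> 'c trm \<Rightarrow> bool" where
  "trm_of L (Var x) \<longleftrightarrow> True"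
| "trm_of L (Cst c) \<longleftrightarrow> c \<in> Consts L"

fun fm_of :: "('r, 'c) lang \<Rightarrow> ('r, 'c) fm \<Rightarrow> bool" where
  "fm_of L (Eq s t) \<longleftrightarrow> trm_of L s \<and> trm_of L t"
| "fm_of L (Rel r ts) \<longleftrightarrow> r \<in> Rels L \<and> length ts = arity L r \<and> (\<forall>t\<in>set ts. trm_of L t)"
| "fm_of L (Neg p) \<longleftrightarrow> fm_of L p"
| "fm_of L (Conj p q) \<longleftrightarrow> fm_of L p \<and> fm_of L q"
| "fm_of L (Ex x p) \<longleftrightarrow> fm_of L p"

fun trm_val :: "('r, 'c, 'a) fostruct \<Rightarrow> (nat \<Rightarrow> 'a) \<Rightarrow> 'c trm \<Rightarrow> 'a" where
  "trm_val M v (Var x) = v x"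
| "trm_val M v (Cst c) = cst M c"

fun sat :: "('r, 'c, 'a) fostruct \<Rightarrow> (nat \<Rightarrow> 'a) \<Rightarrow> ('r, 'c) fm \<Rightarrow> bool" where
  "sat M v (Eq s t) \<longleftrightarrow> trm_val M v s = trm_val M v t"
| "sat M v (Rel r ts) \<longleftrightarrow> map (trm_val M v) ts \<in> rel M r"
| "sat M v (Neg p) \<longleftrightarrow> \<not> sat M v p"
| "sat M v (Conj p q) \<longleftrightarrow> sat M v p \<and> sat M v q"
| "sat M v (Ex x p) \<longleftrightarrow> (\<exists>a\<in>univ M. sat M (v(x := a)) p)"

definition assignments :: "('r, 'c, 'a) fostruct \<Rightarrow> (nat \<Rightarrow> 'a) set" where
  "assignments M = {v. range v \<subseteq> univ M}"

definition equivalent_in :: "('r, 'c, 'a) fostruct \<Rightarrow> ('r, 'c) fm \<Rightarrow> ('r, 'c) fm \<Rightarrow> bool" where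
  "equivalent_in M p q \<longleftrightarrow> (\<forall>v\<in>assignments M. sat M v p \<longleftrightarrow> sat M v q)"

text \<open>The relation defined by a formula in its free variables, listed in increasing order.  Free
  variables are understood syntactically; a dummy variable \<open>y\<close> is included by conjoining
  \<open>y = y\<close>.\<close>

definition defined_rel :: "('r, 'c, 'a) fostruct \<Rightarrow> ('r, 'c) fm \<Rightarrow> 'a list set" where
  "defined_rel M p = {map v (sorted_list_of_set (fv p)) | v. v \<in> assignments M \<and> sat M v p}"

text \<open>The expansion of a language and of a structure by a constant for every element.\<close>

definition lang_expand :: "('r, 'c) lang \<Rightarrow> 'a set \<Rightarrow> ('r, 'c + 'a) lang" where
  "lang_expand L A = \<lparr>Rels = Rels L, arity = arity L, Consts = Consts L <+> A\<rparr>"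

definition struct_expand :: "('r, 'c, 'a) fostruct \<Rightarrow> ('r, 'c + 'a, 'a) fostruct" where
  "struct_expand M = \<lparr>univ = univ M, rel = rel M, cst = case_sum (cst M) (\<lambda>a. a)\<rparr>"


section \<open>Mutual algebraicity\<close>

definition mutually_algebraic_rel :: "'a set \<Rightarrow> 'a list set \<Rightarrow> bool" where
  "mutually_algebraic_rel A R \<longleftrightarrow>
     (\<exists>K::nat. \<forall>m\<in>A. finite {b \<in> R. m \<in> set b} \<and> card {b \<in> R. m \<in> set b} \<le> K)"

definition mutually_algebraic_fm :: "('r, 'c, 'a) fostruct \<Rightarrow> ('r, 'c) fm \<Rightarrow> bool" where
  "mutually_algebraic_fm M p \<longleftrightarrow> mutually_algebraic_rel (univ M) (defined_rel M p)"

inductive_set bool_combs :: "('r, 'c) fm set \<Rightarrow> ('r, 'c) fm set" for S where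
  base: "p \<in> S \<Longrightarrow> p \<in> bool_combs S"
| neg: "p \<in> bool_combs S \<Longrightarrow> Neg p \<in> bool_combs S"
| conj: "p \<in> bool_combs S \<Longrightarrow> q \<in> bool_combs S \<Longrightarrow> Conj p q \<in> bool_combs S"

definition mutually_algebraic :: "('r, 'c) lang \<Rightarrow> ('r, 'c, 'a) fostruct \<Rightarrow> bool" where
  "mutually_algebraic L M \<longleftrightarrow>
     (let LM = lang_expand L (univ M); MM = struct_expand M
      in \<forall>p. fm_of LM p \<longrightarrow>
           (\<exists>q\<in>bool_combs {s. fm_of LM s \<and> mutually_algebraic_fm MM s}. equivalent_in MM p q))"


section \<open>Cellularity\<close>

text \<open>Two tuples are isomorphic over \<open>K\<close> if some isomorphism of the substructures they generate
  together with \<open>K\<close> fixes \<open>K\<close> pointwise and maps the first tuple to the second.\<close>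

definition isomorphic_over ::
  "('r, 'c) lang \<Rightarrow> ('r, 'c, 'a) fostruct \<Rightarrow> 'a set \<Rightarrow> 'a list \<Rightarrow> 'a list \<Rightarrow> bool" where
  "isomorphic_over L M K a b \<longleftrightarrow>
     (\<exists>f. is_iso L (gen_substruct L M (K \<union> set a)) (gen_substruct L M (K \<union> set b)) f \<and>
          (\<forall>x\<in>K. f x = x) \<and> map f a = b)"

text \<open>Indices \<open>i\<close> start at 0.  Both \<open>K = {}\<close> and \<open>n = 0\<close> are allowed; every finite structure is
  cellular with \<open>n = 0\<close>.\<close>

definition cellular :: "('r, 'c) lang \<Rightarrow> ('r, 'c, 'a) fostruct \<Rightarrow> bool" where
  "cellular L M \<longleftrightarrow>
     (\<exists>(n::nat) (k :: nat \<Rightarrow> nat) K (c :: nat \<Rightarrow> nat \<Rightarrow> 'a list).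
        finite K \<and>
        (\<forall>i<n. 0 < k i) \<and>
        (\<forall>i<n. \<forall>j. length (c i j) = k i \<and> distinct (c i j)) \<and>
        univ M = K \<union> (\<Union>i<n. \<Union>j. set (c i j)) \<and>
        (\<forall>i<n. \<forall>j. K \<inter> set (c i j) = {}) \<and>
        disjoint_family_on (\<lambda>(i, j). set (c i j)) ({..<n} \<times> UNIV) \<and>
        (\<forall>i<n. \<forall>j j'. isomorphic_over L M K (c i j) (c i j')) \<and>
        (\<forall>i<n. \<forall>\<sigma> :: nat \<Rightarrow> nat. bij \<sigma> \<longrightarrow>
           (\<exists>f. is_aut L M f \<and>
                (\<forall>j. map f (c i j) = c i (\<sigma> j)) \<and>
                (\<forall>x\<in>univ M - (\<Union>j. set (c i j)). f x = x))))"


section \<open>Countable categoricity\<close>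

definition theory_of :: "('r, 'c) lang \<Rightarrow> ('r, 'c, 'a) fostruct \<Rightarrow> ('r, 'c) fm set" where
  "theory_of L M = {p. fm_of L p \<and> fv p = {} \<and> (\<forall>v\<in>assignments M. sat M v p)}"

definition is_model :: "('r, 'c) lang \<Rightarrow> ('r, 'c) fm set \<Rightarrow> ('r, 'c, 'a) fostruct \<Rightarrow> bool" where
  "is_model L T N \<longleftrightarrow> is_struct L N \<and> (\<forall>p\<in>T. \<forall>v\<in>assignments N. sat N v p)"

text \<open>Any two countable (finite or countably infinite) models are isomorphic.  Every countable
  structure has an isomorphic copy whose universe is a set of natural numbers, so it suffices to
  let the two models range over such structures.\<close>

definition omega_categorical_theory :: "('r, 'c) lang \<Rightarrow> ('r, 'c) fm set \<Rightarrow> bool" where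
  "omega_categorical_theory L T \<longleftrightarrow>
     (\<forall>(N :: ('r, 'c, nat) fostruct) (N' :: ('r, 'c, nat) fostruct).
        is_model L T N \<and> is_model L T N' \<longrightarrow> isomorphic L N N')"

definition omega_categorical :: "('r, 'c) lang \<Rightarrow> ('r, 'c, 'a) fostruct \<Rightarrow> bool" where
  "omega_categorical L M \<longleftrightarrow> omega_categorical_theory L (theory_of L M)"

end

theory Submission
  imports Defs "HOL-Library.FuncSet"
begin

text \<open>Both sides are compared with two properties of the group \<open>G = Aut M\<close>: finitely many
  orbits on \<open>n\<close>-tuples, and separation, which says that up to finitely many patterns a tuple \<open>c\<close>
  sees another tuple \<open>d\<close> only through a link relation of finite degree.  A cellular structure has both
  properties by inspection.  For a mutually algebraic \<open>\<omega>\<close>-categorical structure the first one is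
  Ryll-Nardzewski's theorem (omitting types, then back and forth), and the links are read off the
  mutually algebraic formulas that define the types.

  Conversely, the two properties force algebraic closure to be trivial, so that the elements outside
  \<open>acl \<emptyset>\<close> fall into finite cells \<open>acl {x} - acl \<emptyset>\<close>.  Call two enumerated cells \<open>c\<close>, \<open>c'\<close> of the
  same colour if \<open>d @ c\<close> and \<open>d @ c'\<close> are conjugate for all \<open>d\<close> off a finite set; separation makes
  the number of colours finite, and Neumann's lemma extends the conjugacy to every \<open>d\<close> disjoint from
  the two cells.  After naming one cell of each colour, cells of the same colour can be permuted
  freely, which gives cellularity, and every definable relation is a boolean combination of the
  relations ``lies in a cell of a given colour at given places'', which gives mutual algebraicity.\<close>

section \<open>Formulas and elementary maps\<close>

text \<open>Separation has a slot e besides c and d because colours are compared over the finite set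
  \<open>acl {}\<close>, whose enumeration fills that slot. Colours must tolerate a finite
  exceptional set, since separation says nothing about linked tuples. They also ask about tuples d
  of every length, whereas separation bounds the number of classes for one length at a time.
  Finiteness is rescued by invariance: for each length the relation between k-tuples is a union of
  orbits of pairs, so only finitely many different relations occur as the length varies. A
  permutation respects equality of colours but may still move one colour to another; fixing one cell
  of each colour pointwise prevents this, and as the colours are finite in number the base K remains
  finite. Conjugacy of cells is available for finite lists of cells only. An arbitrary permutation
  of the cells of one colour is nevertheless an automorphism, because relations have finite arity
  and each instance meets finitely many cells.\<close>

lemma finite_fv_trm [simp]: "finite (fv_trm t)"
  by (cases t) auto

lemma finite_fv [simp]: "finite (fv p)"
  by (induction p) auto

lemma trm_val_cong: "(\<And>x. x \<in> fv_trm t \<Longrightarrow> v x = w x) \<Longrightarrow> trm_val M v t = trm_val M w t"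
  by (cases t) auto

lemma sat_cong: "(\<And>x. x \<in> fv p \<Longrightarrow> v x = w x) \<Longrightarrow> sat M v p \<longleftrightarrow> sat M w p"
proof (induction p arbitrary: v w)
  case (Eq s t)
  then show ?case using trm_val_cong[of s v w M] trm_val_cong[of t v w M] by auto
next
  case (Rel r ts)
  then have "map (trm_val M v) ts = map (trm_val M w) ts"
    by (auto intro!: trm_val_cong)
  then show ?case by (simp only: sat.simps)
next
  case (Conj p q)
  have "sat M v p \<longleftrightarrow> sat M w p" by (rule Conj.IH(1)) (simp add: Conj.prems)
  moreover have "sat M v q \<longleftrightarrow> sat M w q" by (rule Conj.IH(2)) (simp add: Conj.prems)
  ultimately show ?case by simp
next
  case (Neg p)
  have "sat M v p \<longleftrightarrow> sat M w p" by (rule Neg.IH) (simp add: Neg.prems)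
  then show ?case by simp
next
  case (Ex x p)
  have "sat M (v(x := a)) p = sat M (w(x := a)) p" for a
    by (rule Ex.IH) (use Ex.prems in auto)
  then show ?case by simp
qed

lemma trm_val_in: "is_struct L M \<Longrightarrow> v \<in> assignments M \<Longrightarrow> trm_of L t \<Longrightarrow> trm_val M v t \<in> univ M"
  by (cases t) (auto simp: is_struct_def assignments_def)

lemma assignments_upd: "v \<in> assignments M \<Longrightarrow> a \<in> univ M \<Longrightarrow> v(x := a) \<in> assignments M"
  by (auto simp: assignments_def)

lemma iso_trm_val: "is_iso L M N f \<Longrightarrow> trm_of L t \<Longrightarrow> trm_val N (f \<circ> v) t = f (trm_val M v t)"
  by (cases t) (auto simp: is_iso_def)

lemma iso_sat:
  assumes M: "is_struct L M" and f: "is_iso L M N f"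
  shows "fm_of L p \<Longrightarrow> v \<in> assignments M \<Longrightarrow> sat N (f \<circ> v) p \<longleftrightarrow> sat M v p"
proof (induction p arbitrary: v)
  case (Eq s t)
  have "inj_on f (univ M)" using f by (auto simp: is_iso_def bij_betw_def)
  moreover have st: "trm_of L s" "trm_of L t" using Eq by auto
  ultimately show ?case using trm_val_in[OF M Eq(2)]
    by (simp add: iso_trm_val[OF f, unfolded comp_def] comp_def inj_on_eq_iff)
next
  case (Rel r ts)
  have "map (trm_val M v) ts \<in> tuples (univ M) (arity L r)"
    using Rel trm_val_in[OF M Rel(2)] by (auto simp: tuples_def)
  moreover have "map (trm_val N (f \<circ> v)) ts = map f (map (trm_val M v) ts)"
    using Rel by (auto simp: iso_trm_val[OF f])
  ultimately show ?case using f Rel by (simp only: is_iso_def sat.simps fm_of.simps)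
next
  case (Ex x p)
  have "f ` univ M = univ N" using f by (auto simp: is_iso_def bij_betw_def)
  then have "sat N (f \<circ> v) (Ex x p) \<longleftrightarrow> (\<exists>a\<in>univ M. sat N ((f \<circ> v)(x := f a)) p)"
    by (metis (no_types, lifting) image_iff sat.simps(5))
  also have "\<dots> \<longleftrightarrow> (\<exists>a\<in>univ M. sat N (f \<circ> v(x := a)) p)"
    by (simp add: fun_upd_comp)
  also have "\<dots> \<longleftrightarrow> sat M v (Ex x p)"
    using Ex.IH[OF _ assignments_upd[OF Ex.prems(2)]] Ex.prems(1)
    by (simp only: sat.simps fm_of.simps cong: bex_cong)
  finally show ?case .
qed auto

section \<open>Simultaneous substitution and renaming\<close>

fun subst_trm :: "(nat \<Rightarrow> 'd trm) \<Rightarrow> ('c \<Rightarrow> 'd) \<Rightarrow> 'c trm \<Rightarrow> 'd trm" where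
  "subst_trm \<tau> \<kappa> (Var x) = \<tau> x"
| "subst_trm \<tau> \<kappa> (Cst c) = Cst (\<kappa> c)"

definition fresh :: "nat set \<Rightarrow> nat" where
  "fresh A = (SOME y. y \<notin> A)"

lemma fresh: "finite A \<Longrightarrow> fresh A \<notin> A"
  unfolding fresh_def by (rule someI_ex) (rule ex_new_if_finite[OF infinite_UNIV_nat])

text \<open>The map \<open>\<kappa>\<close> on constant symbols lets the target language differ from
  the source: it is the identity for renaming variables and \<open>Inl\<close> for passing to the
  language with named elements. The new bound variable avoids all terms substituted for the
  remaining free variables, so nothing is captured.\<close>

primrec subst :: "('c \<Rightarrow> 'd) \<Rightarrow> ('r, 'c) fm \<Rightarrow> (nat \<Rightarrow> 'd trm) \<Rightarrow> ('r, 'd) fm" where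
  "subst \<kappa> (Eq s t) \<tau> = Eq (subst_trm \<tau> \<kappa> s) (subst_trm \<tau> \<kappa> t)"
| "subst \<kappa> (Rel r ts) \<tau> = Rel r (map (subst_trm \<tau> \<kappa>) ts)"
| "subst \<kappa> (Neg p) \<tau> = Neg (subst \<kappa> p \<tau>)"
| "subst \<kappa> (Conj p q) \<tau> = Conj (subst \<kappa> p \<tau>) (subst \<kappa> q \<tau>)"
| "subst \<kappa> (Ex x p) \<tau> =
     (let y = fresh (\<Union>z\<in>fv p - {x}. fv_trm (\<tau> z)) in Ex y (subst \<kappa> p (\<tau>(x := Var y))))"

lemma fv_subst_trm: "fv_trm (subst_trm \<tau> \<kappa> t) = (\<Union>x\<in>fv_trm t. fv_trm (\<tau> x))"
  by (cases t) auto

lemma fv_subst: "fv (subst \<kappa> p \<tau>) = (\<Union>x\<in>fv p. fv_trm (\<tau> x))"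
proof (induction p arbitrary: \<tau>)
  case (Ex x p)
  let ?y = "fresh (\<Union>z\<in>fv p - {x}. fv_trm (\<tau> z))"
  have y: "?y \<notin> (\<Union>z\<in>fv p - {x}. fv_trm (\<tau> z))" by (rule fresh) simp
  have "fv (subst \<kappa> (Ex x p) \<tau>) = (\<Union>z\<in>fv p. fv_trm ((\<tau>(x := Var ?y)) z)) - {?y}"
    by (simp add: Ex Let_def)
  also have "\<dots> = (\<Union>z\<in>fv p - {x}. fv_trm (\<tau> z))"
    using y by (auto split: if_splits)
  finally show ?case by simp
qed (auto simp: fv_subst_trm)

lemma fm_of_subst:
  assumes "Rels L \<subseteq> Rels L'" "\<And>r. r \<in> Rels L \<Longrightarrow> arity L' r = arity L r" "\<kappa> ` Consts L \<subseteq> Consts L'"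
  shows "fm_of L p \<Longrightarrow> (\<And>x. x \<in> fv p \<Longrightarrow> trm_of L' (\<tau> x)) \<Longrightarrow> fm_of L' (subst \<kappa> p \<tau>)"
proof (induction p arbitrary: \<tau>)
  case (Eq s t)
  then show ?case using assms(3) by (cases s; cases t) auto
next
  case (Rel r ts)
  have "trm_of L' (subst_trm \<tau> \<kappa> t)" if "t \<in> set ts" for t
    using Rel that assms(3) by (cases t) force+
  then show ?case using Rel assms by auto
qed (auto simp: Let_def)

lemma subst_trm_val:
  assumes "\<And>c. cst M' (\<kappa> c) = cst M c"
  shows "trm_val M' v (subst_trm \<tau> \<kappa> t) = trm_val M (\<lambda>x. trm_val M' v (\<tau> x)) t"
  using assms by (cases t) auto

lemma sat_subst:
  assumes "univ M' = univ M" "rel M' = rel M" "\<And>c. cst M' (\<kappa> c) = cst M c"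
  shows "sat M' v (subst \<kappa> p \<tau>) \<longleftrightarrow> sat M (\<lambda>x. trm_val M' v (\<tau> x)) p"
proof (induction p arbitrary: v \<tau>)
  case (Rel r ts)
  then show ?case by (simp add: subst_trm_val[OF assms(3)] assms(2) comp_def)
next
  case (Ex x p)
  let ?y = "fresh (\<Union>z\<in>fv p - {x}. fv_trm (\<tau> z))"
  have y: "?y \<notin> (\<Union>z\<in>fv p - {x}. fv_trm (\<tau> z))" by (rule fresh) simp
  have "sat M (\<lambda>z. trm_val M' (v(?y := a)) ((\<tau>(x := Var ?y)) z)) p \<longleftrightarrow>
        sat M ((\<lambda>z. trm_val M' v (\<tau> z))(x := a)) p" for a
    by (rule sat_cong) (use y in \<open>auto intro!: trm_val_cong\<close>)
  then show ?case by (simp only: subst.simps Let_def sat.simps Ex.IH assms(1))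
qed (simp_all add: subst_trm_val[OF assms(3)])

definition rename :: "(nat \<Rightarrow> nat) \<Rightarrow> ('r, 'c) fm \<Rightarrow> ('r, 'c) fm" where
  "rename u p = subst (\<lambda>c. c) p (\<lambda>x. Var (u x))"

lemma fv_rename [simp]: "fv (rename u p) = u ` fv p"
  by (auto simp: rename_def fv_subst)

lemma fm_of_rename: "fm_of L p \<Longrightarrow> fm_of L (rename u p)"
  unfolding rename_def by (rule fm_of_subst) auto

lemma sat_rename [simp]: "sat M v (rename u p) \<longleftrightarrow> sat M (v \<circ> u) p"
  by (simp add: rename_def sat_subst comp_def)

section \<open>Quantifier blocks, finite conjunctions and universal closure\<close>

definition Exs :: "nat list \<Rightarrow> ('r, 'c) fm \<Rightarrow> ('r, 'c) fm" where
  "Exs ys p = foldr Ex ys p"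

lemma fv_Exs [simp]: "fv (Exs ys p) = fv p - set ys"
  by (induction ys) (auto simp: Exs_def)

lemma fm_of_Exs [simp]: "fm_of L (Exs ys p) \<longleftrightarrow> fm_of L p"
  by (induction ys) (auto simp: Exs_def)

lemma sat_Exs:
  "sat M v (Exs ys p) \<longleftrightarrow>
     (\<exists>w. (\<forall>y\<in>set ys. w y \<in> univ M) \<and> (\<forall>y. y \<notin> set ys \<longrightarrow> w y = v y) \<and> sat M w p)"
proof (induction ys arbitrary: v)
  case Nil
  have "w = v" if "\<forall>y. w y = v y" for w using that by auto
  then show ?case by (auto simp: Exs_def)
next
  case (Cons x ys)
  have "sat M v (Exs (x # ys) p) \<longleftrightarrow> (\<exists>a\<in>univ M. sat M (v(x := a)) (Exs ys p))"
    by (simp add: Exs_def)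
  also have "\<dots> \<longleftrightarrow> (\<exists>w. (\<forall>y\<in>set (x # ys). w y \<in> univ M) \<and> (\<forall>y. y \<notin> set (x # ys) \<longrightarrow> w y = v y) \<and> sat M w p)"
    (is "?l \<longleftrightarrow> ?r")
  proof
    assume ?l
    then obtain a w where "a \<in> univ M" "\<forall>y\<in>set ys. w y \<in> univ M"
      "\<forall>y. y \<notin> set ys \<longrightarrow> w y = (v(x := a)) y" "sat M w p" unfolding Cons.IH by blast
    then show ?r by (intro exI[of _ w]) (auto split: if_splits)
  next
    assume ?r
    then obtain w where w: "\<forall>y\<in>set (x # ys). w y \<in> univ M"
      "\<forall>y. y \<notin> set (x # ys) \<longrightarrow> w y = v y" "sat M w p" by blast
    then show ?l unfolding Cons.IH by (intro bexI[of _ "w x"] exI[of _ w]) auto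
  qed
  finally show ?case .
qed

text \<open>The empty conjunction has to be a formula without free variables, in a language that may
  have no constant symbols; this one is true in every nonempty structure.\<close>

definition Conjs :: "('r, 'c) fm list \<Rightarrow> ('r, 'c) fm" where
  "Conjs ps = foldr Conj ps (Ex 0 (Eq (Var 0) (Var 0)))"

lemma fv_Conjs [simp]: "fv (Conjs ps) = (\<Union>p\<in>set ps. fv p)"
  by (induction ps) (auto simp: Conjs_def)

lemma fm_of_Conjs [simp]: "fm_of L (Conjs ps) \<longleftrightarrow> (\<forall>p\<in>set ps. fm_of L p)"
  by (induction ps) (auto simp: Conjs_def)

lemma sat_Conjs: "univ M \<noteq> {} \<Longrightarrow> sat M v (Conjs ps) \<longleftrightarrow> (\<forall>p\<in>set ps. sat M v p)"
  by (induction ps) (auto simp: Conjs_def)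

definition Disjs :: "('r, 'c) fm list \<Rightarrow> ('r, 'c) fm" where
  "Disjs ps = Neg (Conjs (map Neg ps))"

lemma fv_Disjs [simp]: "fv (Disjs ps) = (\<Union>p\<in>set ps. fv p)"
  by (auto simp: Disjs_def)

lemma fm_of_Disjs [simp]: "fm_of L (Disjs ps) \<longleftrightarrow> (\<forall>p\<in>set ps. fm_of L p)"
  by (auto simp: Disjs_def)

lemma sat_Disjs: "univ M \<noteq> {} \<Longrightarrow> sat M v (Disjs ps) \<longleftrightarrow> (\<exists>p\<in>set ps. sat M v p)"
  by (auto simp: Disjs_def sat_Conjs)

definition All_closure :: "('r, 'c) fm \<Rightarrow> ('r, 'c) fm" where
  "All_closure p = Neg (Exs (sorted_list_of_set (fv p)) (Neg p))"

lemma fv_All_closure [simp]: "fv (All_closure p) = {}"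
  by (simp add: All_closure_def)

lemma fm_of_All_closure [simp]: "fm_of L (All_closure p) \<longleftrightarrow> fm_of L p"
  by (simp add: All_closure_def)

lemma sat_All_closure:
  assumes "v \<in> assignments M"
  shows "sat M v (All_closure p) \<longleftrightarrow> (\<forall>w\<in>assignments M. sat M w p)"
proof
  assume l: "sat M v (All_closure p)"
  show "\<forall>w\<in>assignments M. sat M w p"
  proof
    fix w assume w: "w \<in> assignments M"
    let ?w = "\<lambda>x. if x \<in> fv p then w x else v x"
    have "sat M ?w p"
      using l w by (auto simp: All_closure_def sat_Exs assignments_def image_subset_iff dest!: spec[of _ ?w])
    then show "sat M w p" by (subst sat_cong[of _ w ?w]) auto
  qed
next
  assume r: "\<forall>w\<in>assignments M. sat M w p"
  have "w \<in> assignments M" if "\<forall>y\<in>fv p. w y \<in> univ M" "\<forall>y. y \<notin> fv p \<longrightarrow> w y = v y" for w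
    using that assms by (force simp: assignments_def image_subset_iff)
  with r have "sat M w p" if "\<forall>y\<in>fv p. w y \<in> univ M" "\<forall>y. y \<notin> fv p \<longrightarrow> w y = v y" for w
    using that by blast
  then show "sat M v (All_closure p)" by (simp add: All_closure_def sat_Exs) blast
qed

section \<open>Completeness of theories, elementary maps and isolated types\<close>

lemma assignments_nonempty: "is_struct L M \<Longrightarrow> \<exists>v. v \<in> assignments M"
proof -
  assume "is_struct L M"
  then obtain a where "a \<in> univ M" by (auto simp: is_struct_def)
  then have "(\<lambda>_. a) \<in> assignments M" by (auto simp: assignments_def)
  then show ?thesis by blast
qed

lemma sat_sentence: "fv p = {} \<Longrightarrow> sat M v p \<longleftrightarrow> sat M w p"
  by (rule sat_cong) simp

text \<open>The universal closure of p is a sentence, so it or its negation belongs to the theory of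
  M. The version for open formulas transfers statements such as "p implies q" directly.\<close>

lemma theory_complete:
  assumes M: "is_struct L M" and N: "is_model L (theory_of L M) N" and p: "fm_of L p"
  shows "(\<forall>v\<in>assignments N. sat N v p) \<longleftrightarrow> (\<forall>v\<in>assignments M. sat M v p)"
proof -
  obtain v where v: "v \<in> assignments M" using assignments_nonempty M by blast
  have "is_struct L N" using N by (simp add: is_model_def)
  then obtain w where w: "w \<in> assignments N" using assignments_nonempty by blast
  let ?q = "All_closure p"
  have "sat N w ?q \<longleftrightarrow> sat M v ?q"
  proof (cases "sat M v ?q")
    case True
    then have "sat M u ?q" for u using sat_sentence[OF fv_All_closure] by blast
    then have "?q \<in> theory_of L M" using p by (simp add: theory_of_def)
    then show ?thesis using N w True by (simp add: is_model_def)
  next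
    case False
    then have "\<not> sat M u ?q" for u using sat_sentence[OF fv_All_closure] by blast
    then have "Neg ?q \<in> theory_of L M" using p by (simp add: theory_of_def)
    then have "sat N w (Neg ?q)" using N w unfolding is_model_def by blast
    then show ?thesis using False by simp
  qed
  then show ?thesis by (simp add: sat_All_closure[OF v] sat_All_closure[OF w])
qed

text \<open>A partial elementary map, kept as a set of pairs so that converses and unions are
  immediate. Preservation of \<open>Eq\<close> already makes it single-valued and injective.\<close>

definition elem_rel ::
  "('r, 'c) lang \<Rightarrow> ('r, 'c, 'a) fostruct \<Rightarrow> ('r, 'c, 'b) fostruct \<Rightarrow> ('a \<times> 'b) set \<Rightarrow> bool" where
  "elem_rel L M N P \<longleftrightarrow> P \<subseteq> univ M \<times> univ N \<and>
     (\<forall>p v w. fm_of L p \<longrightarrow> v \<in> assignments M \<longrightarrow> w \<in> assignments N \<longrightarrow>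
        (\<forall>x\<in>fv p. (v x, w x) \<in> P) \<longrightarrow> (sat M v p \<longleftrightarrow> sat N w p))"

lemma elem_relD:
  "elem_rel L M N P \<Longrightarrow> fm_of L p \<Longrightarrow> v \<in> assignments M \<Longrightarrow> w \<in> assignments N \<Longrightarrow>
   (\<And>x. x \<in> fv p \<Longrightarrow> (v x, w x) \<in> P) \<Longrightarrow> sat M v p \<longleftrightarrow> sat N w p"
  unfolding elem_rel_def by blast

lemma elem_rel_subset: "elem_rel L M N P \<Longrightarrow> P \<subseteq> univ M \<times> univ N"
  unfolding elem_rel_def by blast

lemma elem_rel_converse: "elem_rel L M N P \<Longrightarrow> elem_rel L N M (P\<inverse>)"
  unfolding elem_rel_def by (intro conjI allI impI) (blast, simp)

text \<open>An isolating formula of an n-type over the theory of M. A formula satisfied nowhere also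
  qualifies, hence it is always used together with a satisfying assignment.\<close>

definition complete_fm :: "('r, 'c) lang \<Rightarrow> ('r, 'c, 'a) fostruct \<Rightarrow> nat \<Rightarrow> ('r, 'c) fm \<Rightarrow> bool" where
  "complete_fm L M n p \<longleftrightarrow> fm_of L p \<and> fv p \<subseteq> {..<n} \<and>
     (\<forall>q. fm_of L q \<longrightarrow> fv q \<subseteq> {..<n} \<longrightarrow>
        (\<forall>v\<in>assignments M. sat M v p \<longrightarrow> sat M v q) \<or> (\<forall>v\<in>assignments M. sat M v p \<longrightarrow> \<not> sat M v q))"

definition atomic_struct :: "('r, 'c) lang \<Rightarrow> ('r, 'c, 'a) fostruct \<Rightarrow> bool" where
  "atomic_struct L M \<longleftrightarrow> (\<forall>n. \<forall>v\<in>assignments M. \<exists>p. complete_fm L M n p \<and> sat M v p)"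

text \<open>The Ryll-Nardzewski condition: for each n, finitely many n-types, all of them
  isolated.\<close>

definition finite_types :: "('r, 'c) lang \<Rightarrow> ('r, 'c, 'a) fostruct \<Rightarrow> bool" where
  "finite_types L M \<longleftrightarrow> (\<forall>n. \<exists>\<Phi>. finite \<Phi> \<and> (\<forall>p\<in>\<Phi>. complete_fm L M n p) \<and>
     (\<forall>v\<in>assignments M. \<exists>p\<in>\<Phi>. sat M v p))"

lemma finite_typesD:
  "finite_types L M \<Longrightarrow> \<exists>\<Phi>. finite \<Phi> \<and> (\<forall>p\<in>\<Phi>. complete_fm L M n p) \<and>
     (\<forall>v\<in>assignments M. \<exists>p\<in>\<Phi>. sat M v p)"
  unfolding finite_types_def by (rule spec)

lemma finite_types_atomic: "finite_types L M \<Longrightarrow> atomic_struct L M"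
  unfolding atomic_struct_def using finite_typesD by fast

lemma complete_fm_sat:
  assumes p: "complete_fm L M n p" and "fm_of L q" "fv q \<subseteq> {..<n}"
    and "v \<in> assignments M" "sat M v p" "sat M v q" "w \<in> assignments M" "sat M w p"
  shows "sat M w q"
  using assms unfolding complete_fm_def by blast

text \<open>Let p isolate the type of the enumerated domain of P followed by a. The formula
  \<open>Ex n p\<close> passes to N, and any witness there has the right type because p implies each
  formula of that type. Atomicity is therefore asked of the side on which the new point is
  given.\<close>

lemma elem_rel_forth:
  assumes M: "is_struct L M" "atomic_struct L M" and N: "is_struct L N"
    and P: "elem_rel L M N P" "finite P" and a: "a \<in> univ M"
  shows "\<exists>b\<in>univ N. elem_rel L M N (insert (a, b) P)"
proof -
  obtain ps where ps: "set ps = P" using P(2) finite_list by blast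
  obtain b0 where b0: "b0 \<in> univ N" using N by (auto simp: is_struct_def)
  define n where "n = length ps"
  \<comment> \<open>The default value a makes \<open>v n = a\<close> hold from the start; the
    default of w is a placeholder, overwritten at n by the witness found below.\<close>
  define v where "v i = (if i < n then fst (ps ! i) else a)" for i
  define w where "w i = (if i < n then snd (ps ! i) else b0)" for i
  have psP: "ps ! i \<in> P" if "i < n" for i using that ps n_def by auto
  have v: "v \<in> assignments M" "v n = a"
    using a subsetD[OF elem_rel_subset[OF P(1)] psP] by (auto simp: assignments_def v_def mem_Times_iff)
  have w: "w \<in> assignments N"
    using b0 subsetD[OF elem_rel_subset[OF P(1)] psP] by (auto simp: assignments_def w_def mem_Times_iff)
  obtain p where p: "complete_fm L M (Suc n) p" "sat M v p"
    using M(2) v(1) unfolding atomic_struct_def by blast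
  have pf: "fm_of L p" "fv p \<subseteq> {..<Suc n}" using p by (auto simp: complete_fm_def)
  have vw: "(v x, w x) \<in> P" if "x < n" for x
    using psP[OF that] that by (simp add: v_def w_def)
  have "v(n := a) = v" using v(2) by auto
  then have "sat M v (Ex n p)" using p(2) a by (auto intro!: bexI[of _ a])
  moreover have "sat M v (Ex n p) \<longleftrightarrow> sat N w (Ex n p)"
  proof (rule elem_relD[OF P(1)])
    show "(v x, w x) \<in> P" if "x \<in> fv (Ex n p)" for x
      using vw that pf(2) by (auto simp: less_Suc_eq)
  qed (use pf v w in auto)
  ultimately obtain b where b: "b \<in> univ N" "sat N (w(n := b)) p" by auto
  let ?w = "w(n := b)"
  have w': "?w \<in> assignments N" by (rule assignments_upd[OF w b(1)])
  have idx: "\<exists>i<Suc n. v i = fst c \<and> ?w i = snd c" if c: "c \<in> insert (a, b) P" for c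
  proof (cases "c = (a, b)")
    case True
    then show ?thesis using v(2) by (auto intro!: exI[of _ n])
  next
    case False
    then obtain i where "i < n" "ps ! i = c" using c ps n_def by (metis in_set_conv_nth insert_iff)
    then show ?thesis by (auto intro!: exI[of _ i] simp: v_def w_def)
  qed
  have "sat M v1 q \<longleftrightarrow> sat N w1 q"
    if q: "fm_of L q" and v1: "v1 \<in> assignments M" and w1: "w1 \<in> assignments N"
      and xs: "\<forall>x\<in>fv q. (v1 x, w1 x) \<in> insert (a, b) P" for q v1 w1
  proof -
    \<comment> \<open>Sending each free variable of q to a position in the enumeration reduces an
      arbitrary formula to one in the variables up to n.\<close>
    define u where "u x = (SOME i. i < Suc n \<and> v i = v1 x \<and> ?w i = w1 x)" for x
    have u: "u x < Suc n \<and> v (u x) = v1 x \<and> ?w (u x) = w1 x" if "x \<in> fv q" for x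
      unfolding u_def by (rule someI_ex) (use idx[of "(v1 x, w1 x)"] xs that in auto)
    let ?q = "rename u q"
    have q': "fm_of L ?q" "fv ?q \<subseteq> {..<Suc n}" using q u fm_of_rename by auto
    have M_eq: "sat M v ?q \<longleftrightarrow> sat M v1 q" unfolding sat_rename by (rule sat_cong) (use u in auto)
    have N_eq: "sat N ?w ?q \<longleftrightarrow> sat N w1 q" unfolding sat_rename by (rule sat_cong) (use u in auto)
    have transfer: "sat N ?w r" if r: "fm_of L r" "fv r \<subseteq> {..<Suc n}" "sat M v r" for r
    proof -
      \<comment> \<open>The closure of "p implies r" is a sentence, so P transfers it although it
        says nothing about the new pair.\<close>
      let ?s = "All_closure (Neg (Conj p (Neg r)))"
      have "\<forall>x\<in>assignments M. sat M x (Neg (Conj p (Neg r)))"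
        using complete_fm_sat[OF p(1) r(1,2) v(1) p(2) r(3)] by auto
      then have "sat M v ?s" by (simp add: sat_All_closure[OF v(1)])
      moreover have "sat M v ?s \<longleftrightarrow> sat N ?w ?s"
        by (rule elem_relD[OF P(1)]) (use pf r v w' in auto)
      ultimately show ?thesis using b(2) w' by (simp add: sat_All_closure[OF w'])
    qed
    show ?thesis
    proof (cases "sat M v ?q")
      case True
      then show ?thesis using transfer[OF q'] M_eq N_eq by blast
    next
      case False
      then have "sat N ?w (Neg ?q)" using transfer[of "Neg ?q"] q' by auto
      then show ?thesis using False M_eq N_eq by simp
    qed
  qed
  then have "elem_rel L M N (insert (a, b) P)"
    using a b(1) elem_rel_subset[OF P(1)] unfolding elem_rel_def by blast
  then show ?thesis using b(1) by blast
qed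

lemma elem_rel_back:
  assumes "is_struct L M" "is_struct L N" "atomic_struct L N"
    and "elem_rel L M N P" "finite P" and "b \<in> univ N"
  shows "\<exists>a\<in>univ M. elem_rel L M N (insert (a, b) P)"
proof -
  obtain a where a: "a \<in> univ M" "elem_rel L N M (insert (b, a) (P\<inverse>))"
    using elem_rel_forth[OF assms(2,3,1) elem_rel_converse[OF assms(4)] _ assms(6)] assms(5) by auto
  have "(insert (b, a) (P\<inverse>))\<inverse> = insert (a, b) P" by auto
  then show ?thesis using a elem_rel_converse[OF a(2)] by auto
qed

lemma elem_rel_iso:
  assumes M: "is_struct L M" and N: "is_struct L N" and R: "elem_rel L M N R"
    and dom: "univ M \<subseteq> Domain R" and ran: "univ N \<subseteq> Range R"
  shows "\<exists>f. is_iso L M N f \<and> (\<forall>(a, b)\<in>R. f a = b)"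
proof -
  note sub = elem_rel_subset[OF R]
  have inj: "a = a' \<longleftrightarrow> b = b'" if "(a, b) \<in> R" "(a', b') \<in> R" for a b a' b'
  proof -
    let ?v = "\<lambda>i::nat. if i = 0 then a else a'" and ?w = "\<lambda>i::nat. if i = 0 then b else b'"
    have "sat M ?v (Eq (Var 0) (Var 1)) \<longleftrightarrow> sat N ?w (Eq (Var 0) (Var 1))"
      by (rule elem_relD[OF R]) (use that sub in \<open>auto simp: assignments_def\<close>)
    then show ?thesis by simp
  qed
  define f where "f a = (SOME b. (a, b) \<in> R)" for a
  have fR: "(a, f a) \<in> R" if "a \<in> univ M" for a
    unfolding f_def by (rule someI_ex) (use that dom in blast)
  have f_eq: "f a = b" if "(a, b) \<in> R" for a b
    using inj[OF that fR[of a]] sub that by auto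
  obtain a0 where a0: "a0 \<in> univ M" using M by (auto simp: is_struct_def)
  have "bij_betw f (univ M) (univ N)"
  proof (rule bij_betw_imageI)
    show "inj_on f (univ M)" using inj fR by (metis inj_onI)
    show "f ` univ M = univ N" using fR f_eq ran sub by (auto simp: image_iff) blast+
  qed
  moreover have "xs \<in> rel M r \<longleftrightarrow> map f xs \<in> rel N r"
    if r: "r \<in> Rels L" "xs \<in> tuples (univ M) (arity L r)" for r xs
  proof -
    let ?v = "\<lambda>i. if i < length xs then xs ! i else a0"
    let ?p = "Rel r (map Var [0..<length xs]) :: ('a, 'b) fm"
    have v: "?v i \<in> univ M" for i using r(2) a0 by (auto simp: tuples_def)
    have fv: "(?v x, (f \<circ> ?v) x) \<in> R" for x using fR[OF v[of x]] by simp
    have "sat M ?v ?p \<longleftrightarrow> sat N (f \<circ> ?v) ?p"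
    proof (rule elem_relD[OF R _ _ _ fv])
      show "fm_of L ?p" using r by (auto simp: tuples_def)
      show "?v \<in> assignments M" using v unfolding assignments_def by blast
      show "f \<circ> ?v \<in> assignments N" using fv sub by (auto simp: assignments_def)
    qed
    moreover have "map (trm_val M ?v \<circ> Var) [0..<length xs] = xs"
      by (rule nth_equalityI) auto
    moreover have "map (trm_val N (f \<circ> ?v) \<circ> Var) [0..<length xs] = map f xs"
      by (rule nth_equalityI) auto
    ultimately show ?thesis by simp
  qed
  moreover have "f (cst M c) = cst N c" if c: "c \<in> Consts L" for c
  proof -
    have cM: "cst M c \<in> univ M" using M c by (auto simp: is_struct_def)
    let ?p = "Eq (Var 0) (Cst c) :: ('a, 'b) fm"
    have "sat M (\<lambda>_. cst M c) ?p \<longleftrightarrow> sat N (\<lambda>_. f (cst M c)) ?p"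
      by (rule elem_relD[OF R]) (use c cM fR sub in \<open>auto simp: assignments_def\<close>)
    then show ?thesis by simp
  qed
  ultimately show ?thesis using f_eq unfolding is_iso_def by blast
qed

theorem back_and_forth:
  assumes M: "is_struct L M" "countable (univ M)" "atomic_struct L M"
    and N: "is_struct L N" "countable (univ N)" "atomic_struct L N"
    and P0: "elem_rel L M N P0" "finite P0"
  shows "\<exists>f. is_iso L M N f \<and> (\<forall>(a, b)\<in>P0. f a = b)"
proof -
  have neM: "univ M \<noteq> {}" and neN: "univ N \<noteq> {}" using M N by (auto simp: is_struct_def)
  let ?a = "from_nat_into (univ M)" and ?b = "from_nat_into (univ N)"
  have step: "\<exists>P'. (elem_rel L M N P' \<and> finite P') \<and> P \<subseteq> P' \<and> ?a k \<in> Domain P' \<and> ?b k \<in> Range P'"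
    if P: "elem_rel L M N P \<and> finite P" for P k
  proof -
    obtain b where b: "elem_rel L M N (insert (?a k, b) P)"
      using elem_rel_forth[OF M(1,3) N(1)] P from_nat_into[OF neM] by blast
    then obtain a where "elem_rel L M N (insert (a, ?b k) (insert (?a k, b) P))"
      using elem_rel_back[OF M(1) N(1,3)] P from_nat_into[OF neN] by (meson finite_insert)
    then show ?thesis using P by (intro exI[of _ "insert (a, ?b k) (insert (?a k, b) P)"]) auto
  qed
  obtain P where P: "P 0 = P0" "\<And>k. elem_rel L M N (P k) \<and> finite (P k)"
    "\<And>k. P k \<subseteq> P (Suc k) \<and> ?a k \<in> Domain (P (Suc k)) \<and> ?b k \<in> Range (P (Suc k))"
    using dependent_nat_choice[of "\<lambda>k P. (elem_rel L M N P \<and> finite P) \<and> (k = 0 \<longrightarrow> P = P0)"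
      "\<lambda>k P P'. P \<subseteq> P' \<and> ?a k \<in> Domain P' \<and> ?b k \<in> Range P'"] P0 step
    by (smt (verit) nat.simps(3))
  have mono: "P k \<subseteq> P l" if "k \<le> l" for k l
    using lift_Suc_mono_le[of P] P(3) that by blast
  let ?R = "\<Union>k. P k"
  have "elem_rel L M N ?R"
    unfolding elem_rel_def
  proof (intro conjI allI impI)
    show "?R \<subseteq> univ M \<times> univ N" using P(2) elem_rel_subset by blast
  next
    fix p v w assume p: "fm_of L p" "v \<in> assignments M" "w \<in> assignments N"
      and "\<forall>x\<in>fv p. (v x, w x) \<in> ?R"
    then have "\<forall>x\<in>fv p. \<exists>k. (v x, w x) \<in> P k" by blast
    then obtain k where k: "\<forall>x\<in>fv p. (v x, w x) \<in> P (k x)" by metis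
    have "(v x, w x) \<in> P (Max (k ` fv p))" if "x \<in> fv p" for x
      using k that mono[of "k x" "Max (k ` fv p)"] by auto
    then show "sat M v p \<longleftrightarrow> sat N w p" using elem_relD P(2) p by blast
  qed
  moreover have "univ M \<subseteq> Domain ?R"
  proof
    fix a assume "a \<in> univ M"
    then obtain k where "?a k = a" using from_nat_into_surj[OF M(2)] by blast
    then show "a \<in> Domain ?R" using P(3)[of k] by blast
  qed
  moreover have "univ N \<subseteq> Range ?R"
  proof
    fix b assume "b \<in> univ N"
    then obtain k where "?b k = b" using from_nat_into_surj[OF N(2)] by blast
    then show "b \<in> Range ?R" using P(3)[of k] by blast
  qed
  ultimately obtain f where "is_iso L M N f" "\<forall>(a, b)\<in>?R. f a = b"
    using elem_rel_iso[OF M(1) N(1)] by blast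
  moreover have "P0 \<subseteq> ?R" using P(1) by (metis UN_upper UNIV_I)
  ultimately show ?thesis by (meson subsetD)
qed

text \<open>The finite map between two realisations of an isolating formula is elementary, and back
  and forth extends it to an automorphism: countable atomic structures are homogeneous.\<close>

lemma complete_fm_conj:
  assumes M: "is_struct L M" "countable (univ M)" "atomic_struct L M"
    and p: "complete_fm L M n p" and v: "v \<in> assignments M" "sat M v p"
    and w: "w \<in> assignments M" "sat M w p"
  shows "\<exists>f. is_iso L M M f \<and> (\<forall>i<n. f (v i) = w i)"
proof -
  let ?P = "(\<lambda>i. (v i, w i)) ` {..<n}"
  have "elem_rel L M M ?P"
    unfolding elem_rel_def
  proof (intro conjI allI impI)
    show "?P \<subseteq> univ M \<times> univ M" using v w by (auto simp: assignments_def)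
  next
    fix q v1 w1 assume q: "fm_of L q" and v1: "v1 \<in> assignments M" "w1 \<in> assignments M"
      and xs: "\<forall>x\<in>fv q. (v1 x, w1 x) \<in> ?P"
    then have "\<forall>x\<in>fv q. \<exists>i<n. v i = v1 x \<and> w i = w1 x" by force
    then obtain u where u: "\<forall>x\<in>fv q. u x < n \<and> v (u x) = v1 x \<and> w (u x) = w1 x" by metis
    let ?q = "rename u q"
    have q': "fm_of L ?q" "fv ?q \<subseteq> {..<n}" using q u fm_of_rename by auto
    have "sat M v ?q \<longleftrightarrow> sat M w ?q"
      using complete_fm_sat[OF p q' v _ w] complete_fm_sat[OF p q' w _ v] by blast
    moreover have "sat M v ?q \<longleftrightarrow> sat M v1 q" unfolding sat_rename by (rule sat_cong) (use u in auto)
    moreover have "sat M w ?q \<longleftrightarrow> sat M w1 q" unfolding sat_rename by (rule sat_cong) (use u in auto)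
    ultimately show "sat M v1 q \<longleftrightarrow> sat M w1 q" by simp
  qed
  then obtain f where "is_iso L M M f" "\<forall>(a, b)\<in>?P. f a = b"
    using back_and_forth[OF M M] by blast
  then show ?thesis by (intro exI[of _ f]) auto
qed

text \<open>That the disjunction of the isolating formulas holds everywhere, and that each of them
  decides a given q, are validities of M, so they hold in every model of its theory.\<close>

lemma finite_types_transfer:
  assumes M: "is_struct L M" and N: "is_model L (theory_of L M) N" and fin: "finite_types L M"
  shows "atomic_struct L N"
  unfolding atomic_struct_def
proof (intro allI ballI)
  fix n v assume v: "v \<in> assignments N"
  note tr = theory_complete[OF M N]
  have neM: "univ M \<noteq> {}" and neN: "univ N \<noteq> {}"
    using M N by (auto simp: is_struct_def is_model_def)
  obtain \<Phi> where \<Phi>: "finite \<Phi>" "\<forall>p\<in>\<Phi>. complete_fm L M n p" "\<forall>v\<in>assignments M. \<exists>p\<in>\<Phi>. sat M v p"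
    using finite_typesD[OF fin, of n] by (elim exE conjE)
  obtain ps where ps: "set ps = \<Phi>" using \<Phi>(1) finite_list by blast
  have "fm_of L (Disjs ps)" using \<Phi>(2) ps by (auto simp: complete_fm_def)
  then have "sat N v (Disjs ps)"
    using tr[of "Disjs ps"] \<Phi>(3) v by (auto simp: sat_Disjs[OF neM] ps)
  then obtain p where p: "p \<in> \<Phi>" "sat N v p" by (auto simp: sat_Disjs[OF neN] ps)
  then have pc: "complete_fm L M n p" using \<Phi>(2) by blast
  have "complete_fm L N n p"
    unfolding complete_fm_def
  proof (intro conjI allI impI)
    show "fm_of L p" "fv p \<subseteq> {..<n}" using pc by (auto simp: complete_fm_def)
    fix q assume q: "fm_of L q" "fv q \<subseteq> {..<n}"
    have "(\<forall>v\<in>assignments M. sat M v (Neg (Conj p (Neg q)))) \<or> (\<forall>v\<in>assignments M. sat M v (Neg (Conj p q)))"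
      using pc q by (auto simp: complete_fm_def)
    moreover have "fm_of L (Neg (Conj p (Neg q)))" "fm_of L (Neg (Conj p q))"
      using q pc by (auto simp: complete_fm_def)
    ultimately have "(\<forall>v\<in>assignments N. sat N v (Neg (Conj p (Neg q)))) \<or> (\<forall>v\<in>assignments N. sat N v (Neg (Conj p q)))"
      using tr by blast
    then show "(\<forall>v\<in>assignments N. sat N v p \<longrightarrow> sat N v q) \<or> (\<forall>v\<in>assignments N. sat N v p \<longrightarrow> \<not> sat N v q)"
      by auto
  qed
  then show "\<exists>p. complete_fm L N n p \<and> sat N v p" using p(2) by blast
qed

theorem finite_types_omega_categorical:
  assumes M: "is_struct L M" and fin: "finite_types L M"
  shows "omega_categorical L M"
  unfolding omega_categorical_def omega_categorical_theory_def isomorphic_def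
proof (intro allI impI)
  fix N N' :: "('a, 'b, nat) fostruct"
  assume *: "is_model L (theory_of L M) N \<and> is_model L (theory_of L M) N'"
  then have N: "is_struct L N" "is_struct L N'" by (auto simp: is_model_def)
  \<comment> \<open>Elementarity of the empty map is completeness of the theory; it starts the back
    and forth between two atomic models.\<close>
  have "elem_rel L N N' {}"
    unfolding elem_rel_def
  proof (intro conjI allI impI)
    fix p v w assume p: "fm_of L p" "v \<in> assignments N" "w \<in> assignments N'" "\<forall>x\<in>fv p. (v x, w x) \<in> {}"
    then have "fv p = {}" by blast
    then have "sat N v p \<longleftrightarrow> (\<forall>u\<in>assignments N. sat N u p)" "sat N' w p \<longleftrightarrow> (\<forall>u\<in>assignments N'. sat N' u p)"
      using p(2,3) sat_sentence[of p] by (metis (mono_tags))+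
    then show "sat N v p \<longleftrightarrow> sat N' w p" using theory_complete[OF M _ p(1)] * by blast
  qed simp
  then show "\<exists>f. is_iso L N N' f"
    using back_and_forth[of L N N' "{}"] N finite_types_transfer[OF M _ fin] * by auto
qed

section \<open>Omitting types\<close>

instance trm :: (countable) countable by countable_datatype
instance fm :: (countable, countable) countable by countable_datatype

lemma set_trm_of: "trm_of L t \<longleftrightarrow> set_trm t \<subseteq> Consts L"
  by (cases t) auto

lemma set_fm_of: "fm_of L p \<Longrightarrow> set1_fm p \<subseteq> Rels L \<and> set2_fm p \<subseteq> Consts L"
  by (induction p) (auto simp: set_trm_of)

text \<open>The types of symbols may be uncountable while the sets of symbols in use are countable.
  Numbering the symbols in use embeds the formulas of L into a countable type.\<close>

lemma countable_fms:
  assumes "countable (Rels L)" "countable (Consts L)"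
  shows "countable {p. fm_of L p}"
proof -
  let ?f = "map_fm (to_nat_on (Rels L)) (to_nat_on (Consts L))"
  have "inj_on ?f {p. fm_of L p}"
  proof (rule inj_onI)
    fix p q assume "p \<in> {p. fm_of L p}" "q \<in> {p. fm_of L p}" and eq: "?f p = ?f q"
    then have pq: "set1_fm p \<subseteq> Rels L" "set2_fm p \<subseteq> Consts L" "set1_fm q \<subseteq> Rels L" "set2_fm q \<subseteq> Consts L"
      using set_fm_of by blast+
    show "p = q"
      by (rule fm.inj_map_strong[OF _ _ eq]) (use pq assms in \<open>auto dest!: subsetD\<close>)
  qed
  then show ?thesis by (rule countableI')
qed

section \<open>Henkin constructions by finite satisfiability in a fixed structure\<close>

definition fin_supp :: "(nat \<Rightarrow> nat) set" where
  "fin_supp = {v. finite {i. v i \<noteq> 0}}"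

text \<open>Finite support is imposed on assignments of Henkin constants for this reason: formulas
  see finitely many variables, and the construction has to enumerate all closed instances.\<close>

lemma countable_fin_supp: "countable fin_supp"
proof -
  have "fin_supp \<subseteq> range (\<lambda>xs i. if i < length xs then xs ! i else 0)"
  proof
    fix v :: "nat \<Rightarrow> nat" assume "v \<in> fin_supp"
    then have "finite {i. v i \<noteq> 0}" by (simp add: fin_supp_def)
    then obtain n where n: "\<forall>i\<in>{i. v i \<noteq> 0}. i < n" using finite_nat_set_iff_bounded by auto
    have "v i = 0" if "\<not> i < n" for i using n that by auto
    then have "v = (\<lambda>i. if i < length (map v [0..<n]) then map v [0..<n] ! i else 0)"
      by (intro ext) simp
    then show "v \<in> range (\<lambda>xs i. if i < length xs then xs ! i else 0)" by (rule range_eqI)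
  qed
  then show ?thesis by (rule countable_subset) simp
qed

lemma fin_supp_upd: "v \<in> fin_supp \<Longrightarrow> v(x := y) \<in> fin_supp"
proof -
  assume "v \<in> fin_supp"
  moreover have "{i. (v(x := y)) i \<noteq> 0} \<subseteq> insert x {i. v i \<noteq> 0}" by auto
  ultimately show ?thesis unfolding fin_supp_def using finite_subset by blast
qed

lemma fin_supp_zero: "(\<lambda>_. 0) \<in> fin_supp"
  by (simp add: fin_supp_def)

lemma fin_supp_restrict: "(\<lambda>i. if i < (n::nat) then f i else 0) \<in> fin_supp"
proof -
  have "{i. (if i < n then f i else 0) \<noteq> 0} \<subseteq> {..<n}" by (auto split: if_splits)
  then show ?thesis unfolding fin_supp_def using finite_subset by blast
qed

text \<open>A pair \<open>(p, v)\<close> stands for the formula \<open>p\<close> with each variable \<open>x\<close> replaced by the Henkin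
  constant \<open>v x\<close>; working with pairs avoids substitution into formulas.\<close>

definition closures :: "('r, 'c) lang \<Rightarrow> (('r, 'c) fm \<times> (nat \<Rightarrow> nat)) set" where
  "closures L = {p. fm_of L p} \<times> fin_supp"

definition holds :: "('r, 'c, 'a) fostruct \<Rightarrow> (nat \<Rightarrow> 'a) \<Rightarrow> (('r, 'c) fm \<times> (nat \<Rightarrow> nat)) set \<Rightarrow> bool" where
  "holds M e \<Gamma> \<longleftrightarrow> (\<forall>(p, v)\<in>\<Gamma>. sat M (e \<circ> v) p)"

text \<open>Finite satisfiability in M itself takes the place of consistency with the theory of M. A
  maximal set of this kind contains every sentence true in M.\<close>

definition fsat :: "('r, 'c, 'a) fostruct \<Rightarrow> (('r, 'c) fm \<times> (nat \<Rightarrow> nat)) set \<Rightarrow> bool" where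
  "fsat M \<Gamma> \<longleftrightarrow> (\<forall>\<Delta>\<subseteq>\<Gamma>. finite \<Delta> \<longrightarrow> (\<exists>e\<in>assignments M. holds M e \<Delta>))"

definition used :: "(('r, 'c) fm \<times> (nat \<Rightarrow> nat)) set \<Rightarrow> nat set" where
  "used \<Gamma> = (\<Union>(p, v)\<in>\<Gamma>. v ` fv p)"

lemma holds_insert: "holds M e (insert (p, v) \<Gamma>) \<longleftrightarrow> sat M (e \<circ> v) p \<and> holds M e \<Gamma>"
  by (simp add: holds_def)

lemma holds_subset: "holds M e \<Gamma> \<Longrightarrow> \<Delta> \<subseteq> \<Gamma> \<Longrightarrow> holds M e \<Delta>"
  unfolding holds_def by blast

lemma holds_cong: "(\<And>y. y \<in> used \<Gamma> \<Longrightarrow> e y = e' y) \<Longrightarrow> holds M e \<Gamma> \<longleftrightarrow> holds M e' \<Gamma>"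
proof -
  assume *: "\<And>y. y \<in> used \<Gamma> \<Longrightarrow> e y = e' y"
  have "sat M (e \<circ> v) p \<longleftrightarrow> sat M (e' \<circ> v) p" if "(p, v) \<in> \<Gamma>" for p v
    by (rule sat_cong) (use * that in \<open>force simp: used_def\<close>)
  then show ?thesis unfolding holds_def by blast
qed

lemma used_mono: "\<Delta> \<subseteq> \<Gamma> \<Longrightarrow> used \<Delta> \<subseteq> used \<Gamma>"
  unfolding used_def by blast

lemma used_insert: "used (insert (p, v) \<Gamma>) = v ` fv p \<union> used \<Gamma>"
  by (simp add: used_def)

lemma used_mem: "(p, v) \<in> \<Gamma> \<Longrightarrow> v ` fv p \<subseteq> used \<Gamma>"
  by (force simp: used_def)

lemma fsat_insertI:
  assumes "\<And>\<Delta>. \<Delta> \<subseteq> \<Gamma> \<Longrightarrow> finite \<Delta> \<Longrightarrow> \<exists>e\<in>assignments M. holds M e (insert c \<Delta>)"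
  shows "fsat M (insert c \<Gamma>)"
  unfolding fsat_def
proof (intro allI impI)
  fix \<Delta> assume "\<Delta> \<subseteq> insert c \<Gamma>" "finite \<Delta>"
  then have "\<Delta> - {c} \<subseteq> \<Gamma>" "finite (\<Delta> - {c})" by auto
  then obtain e where "e \<in> assignments M" "holds M e (insert c (\<Delta> - {c}))" using assms by blast
  then show "\<exists>e\<in>assignments M. holds M e \<Delta>" using holds_subset[of M e "insert c (\<Delta> - {c})" \<Delta>] by blast
qed

lemma fsat_decide:
  assumes "fsat M \<Gamma>"
  shows "fsat M (insert (p, v) \<Gamma>) \<or> fsat M (insert (Neg p, v) \<Gamma>)"
proof (rule ccontr)
  assume "\<not> ?thesis"
  then obtain \<Delta> \<Delta>' where d: "\<Delta> \<subseteq> \<Gamma>" "finite \<Delta>" "\<forall>e\<in>assignments M. \<not> holds M e (insert (p, v) \<Delta>)"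
    "\<Delta>' \<subseteq> \<Gamma>" "finite \<Delta>'" "\<forall>e\<in>assignments M. \<not> holds M e (insert (Neg p, v) \<Delta>')"
    using fsat_insertI[of \<Gamma> M "(p, v)"] fsat_insertI[of \<Gamma> M "(Neg p, v)"] by blast
  then obtain e where e: "e \<in> assignments M" "holds M e (\<Delta> \<union> \<Delta>')"
    using assms unfolding fsat_def by (metis Un_subset_iff finite_Un)
  then have "holds M e \<Delta>" "holds M e \<Delta>'" using holds_subset by blast+
  then show False using d(3,6) e(1) by (auto simp: holds_insert)
qed

text \<open>The name y is new, so it can be reinterpreted as a witness without disturbing the finite
  set under consideration.\<close>

lemma fsat_witness:
  assumes "fsat M \<Gamma>" "(Ex x p, v) \<in> \<Gamma>" "y \<notin> used \<Gamma>"
  shows "fsat M (insert (p, v(x := y)) \<Gamma>)"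
proof (rule fsat_insertI)
  fix \<Delta> assume \<Delta>: "\<Delta> \<subseteq> \<Gamma>" "finite \<Delta>"
  then obtain e where e: "e \<in> assignments M" "holds M e (insert (Ex x p, v) \<Delta>)"
    using assms(1,2) unfolding fsat_def by (metis finite_insert insert_subset)
  then obtain a where a: "a \<in> univ M" "sat M ((e \<circ> v)(x := a)) p" by (auto simp: holds_insert)
  let ?e = "e(y := a)"
  have "holds M ?e \<Delta>"
  proof -
    have "holds M e \<Delta> \<longleftrightarrow> holds M ?e \<Delta>"
      by (rule holds_cong) (use assms(3) used_mono[OF \<Delta>(1)] in auto)
    then show ?thesis using e(2) by (simp add: holds_insert)
  qed
  moreover have "sat M (?e \<circ> v(x := y)) p \<longleftrightarrow> sat M ((e \<circ> v)(x := a)) p"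
  proof (rule sat_cong)
    fix z assume "z \<in> fv p"
    then have "z \<noteq> x \<Longrightarrow> v z \<in> used \<Gamma>" using used_mem[OF assms(2)] by auto
    then show "(?e \<circ> v(x := y)) z = ((e \<circ> v)(x := a)) z" using assms(3) by auto
  qed
  ultimately have "holds M ?e (insert (p, v(x := y)) \<Delta>)" using a(2) by (simp add: holds_insert)
  then show "\<exists>e\<in>assignments M. holds M e (insert (p, v(x := y)) \<Delta>)"
    using assignments_upd[OF e(1) a(1)] by blast
qed

text \<open>The starting set may be infinite but names only finitely many Henkin constants, so fresh
  ones never run out. Finiteness of \<open>\<Gamma> - \<Gamma>0\<close> means that an extension of
  the empty set can be described by a single formula, on which the omission argument rests.\<close>

definition henkin_ext where
  "henkin_ext L M \<Gamma>0 \<Gamma> \<longleftrightarrow> \<Gamma>0 \<subseteq> \<Gamma> \<and> \<Gamma> \<subseteq> closures L \<and> finite (\<Gamma> - \<Gamma>0) \<and> finite (used \<Gamma>) \<and> fsat M \<Gamma>"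

lemma henkin_ext_insert:
  assumes "henkin_ext L M \<Gamma>0 \<Gamma>" "fm_of L p" "v \<in> fin_supp" "fsat M (insert (p, v) \<Gamma>)"
  shows "henkin_ext L M \<Gamma>0 (insert (p, v) \<Gamma>)"
  using assms by (auto simp: henkin_ext_def closures_def used_insert insert_Diff_if)

text \<open>Each stage refutes some formula of P at v, decides p at v, and adds a witness if an
  existential formula was accepted. P plays the type to be omitted: every tuple of names must
  violate one of its formulas.\<close>

lemma henkin_step:
  assumes \<Gamma>: "henkin_ext L M \<Gamma>0 \<Gamma>" and c: "fm_of L p" "v \<in> fin_supp"
    and omit: "\<And>\<Gamma> v. henkin_ext L M \<Gamma>0 \<Gamma> \<Longrightarrow> v \<in> fin_supp \<Longrightarrow>
       \<exists>q\<in>P. fm_of L q \<and> fsat M (insert (Neg q, v) \<Gamma>)"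
  shows "\<exists>\<Gamma>'. henkin_ext L M \<Gamma>0 \<Gamma>' \<and> \<Gamma> \<subseteq> \<Gamma>' \<and>
     ((p, v) \<in> \<Gamma>' \<or> (Neg p, v) \<in> \<Gamma>') \<and>
     (\<forall>x q. p = Ex x q \<longrightarrow> (p, v) \<in> \<Gamma>' \<longrightarrow> (\<exists>y. (q, v(x := y)) \<in> \<Gamma>')) \<and>
     (\<exists>q\<in>P. (Neg q, v) \<in> \<Gamma>')"
proof -
  obtain q where q: "q \<in> P" "fm_of L q" "fsat M (insert (Neg q, v) \<Gamma>)" using omit[OF \<Gamma> c(2)] by blast
  define \<Gamma>1 where "\<Gamma>1 = insert (Neg q, v) \<Gamma>"
  have \<Gamma>1: "henkin_ext L M \<Gamma>0 \<Gamma>1" unfolding \<Gamma>1_def by (rule henkin_ext_insert) (use \<Gamma> q c in auto)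
  define \<Gamma>2 where "\<Gamma>2 = (if fsat M (insert (p, v) \<Gamma>1) then insert (p, v) \<Gamma>1 else insert (Neg p, v) \<Gamma>1)"
  have "fsat M (insert (p, v) \<Gamma>1) \<or> fsat M (insert (Neg p, v) \<Gamma>1)"
    by (rule fsat_decide) (use \<Gamma>1 in \<open>simp add: henkin_ext_def\<close>)
  then have \<Gamma>2: "henkin_ext L M \<Gamma>0 \<Gamma>2" using \<Gamma>1 c by (auto simp: \<Gamma>2_def intro!: henkin_ext_insert)
  have sub: "\<Gamma> \<subseteq> \<Gamma>2" "(Neg q, v) \<in> \<Gamma>2" "(p, v) \<in> \<Gamma>2 \<or> (Neg p, v) \<in> \<Gamma>2"
    by (auto simp: \<Gamma>2_def \<Gamma>1_def)
  show ?thesis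
  proof (cases "\<exists>x r. p = Ex x r \<and> (p, v) \<in> \<Gamma>2")
    case False
    then show ?thesis using \<Gamma>2 sub q(1) by (intro exI[of _ \<Gamma>2]) blast
  next
    case True
    then obtain x r where r: "p = Ex x r" "(Ex x r, v) \<in> \<Gamma>2" by blast
    define y where "y = fresh (used \<Gamma>2)"
    have "y \<notin> used \<Gamma>2" unfolding y_def by (rule fresh) (use \<Gamma>2 in \<open>simp add: henkin_ext_def\<close>)
    then have "fsat M (insert (r, v(x := y)) \<Gamma>2)"
      using fsat_witness r(2) \<Gamma>2 by (auto simp: henkin_ext_def)
    then have "henkin_ext L M \<Gamma>0 (insert (r, v(x := y)) \<Gamma>2)"
      using henkin_ext_insert[OF \<Gamma>2] c r(1) fin_supp_upd by auto
    then show ?thesis using sub q(1) r by (intro exI[of _ "insert (r, v(x := y)) \<Gamma>2"]) auto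
  qed
qed

lemma henkin_set:
  assumes L: "countable (Rels L)" "countable (Consts L)"
    and \<Gamma>0: "henkin_ext L M \<Gamma>0 \<Gamma>0"
    and omit: "\<And>\<Gamma> v. henkin_ext L M \<Gamma>0 \<Gamma> \<Longrightarrow> v \<in> fin_supp \<Longrightarrow>
       \<exists>q\<in>P. fm_of L q \<and> fsat M (insert (Neg q, v) \<Gamma>)"
  shows "\<exists>\<Gamma>. \<Gamma>0 \<subseteq> \<Gamma> \<and> \<Gamma> \<subseteq> closures L \<and> fsat M \<Gamma> \<and>
     (\<forall>(p, v)\<in>closures L. (p, v) \<in> \<Gamma> \<or> (Neg p, v) \<in> \<Gamma>) \<and>
     (\<forall>x q v. (Ex x q, v) \<in> \<Gamma> \<longrightarrow> (\<exists>y. (q, v(x := y)) \<in> \<Gamma>)) \<and>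
     (\<forall>v\<in>fin_supp. \<exists>q\<in>P. (Neg q, v) \<in> \<Gamma>)"
proof -
  have cnt: "countable (closures L)"
    unfolding closures_def using countable_fms[OF L] countable_fin_supp by blast
  have top: "(Eq (Var 0) (Var 0), v) \<in> closures L" if "v \<in> fin_supp" for v
    using that by (simp add: closures_def)
  then have ne: "closures L \<noteq> {}" using fin_supp_zero by blast
  define c where "c = from_nat_into (closures L)"
  define good where "good k \<Gamma>' \<longleftrightarrow>
     (c k \<in> \<Gamma>' \<or> (Neg (fst (c k)), snd (c k)) \<in> \<Gamma>') \<and>
     (\<forall>x q. fst (c k) = Ex x q \<longrightarrow> c k \<in> \<Gamma>' \<longrightarrow> (\<exists>y. (q, (snd (c k))(x := y)) \<in> \<Gamma>')) \<and>
     (\<exists>q\<in>P. (Neg q, snd (c k)) \<in> \<Gamma>')" for k \<Gamma>'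
  have ck: "fm_of L (fst (c k)) \<and> snd (c k) \<in> fin_supp" for k
    using from_nat_into[OF ne, of k] by (auto simp: c_def closures_def mem_Times_iff)
  have step: "\<exists>\<Gamma>'. henkin_ext L M \<Gamma>0 \<Gamma>' \<and> \<Gamma> \<subseteq> \<Gamma>' \<and> good k \<Gamma>'" if "henkin_ext L M \<Gamma>0 \<Gamma>" for \<Gamma> k
  proof -
    obtain p v where pv: "c k = (p, v)" by fastforce
    then show ?thesis using henkin_step[OF that, of p v P] omit ck[of k] by (simp add: good_def)
  qed
  obtain G where G: "\<And>k. henkin_ext L M \<Gamma>0 (G k)" "\<And>k. G k \<subseteq> G (Suc k) \<and> good k (G (Suc k))"
    using dependent_nat_choice[of "\<lambda>_ \<Gamma>. henkin_ext L M \<Gamma>0 \<Gamma>" "\<lambda>k \<Gamma> \<Gamma>'. \<Gamma> \<subseteq> \<Gamma>' \<and> good k \<Gamma>'"]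
      \<Gamma>0 step by metis
  have mono: "G k \<subseteq> G l" if "k \<le> l" for k l
    using lift_Suc_mono_le[of G] G(2) that by blast
  let ?G = "\<Union>k. G k"
  have surj: "\<exists>k. c k = z" if "z \<in> closures L" for z
    using from_nat_into_surj[OF cnt that] by (simp add: c_def)
  have sub: "?G \<subseteq> closures L" using G(1) by (auto simp: henkin_ext_def)
  have fs: "fsat M ?G"
    unfolding fsat_def
  proof (intro allI impI)
    fix \<Delta> assume \<Delta>: "\<Delta> \<subseteq> ?G" "finite \<Delta>"
    then obtain k where k: "\<forall>d\<in>\<Delta>. d \<in> G (k d)" by (meson UN_iff subsetD)
    have "\<Delta> \<subseteq> G (Max (k ` \<Delta>))"
    proof
      fix d assume d: "d \<in> \<Delta>"
      then have "k d \<le> Max (k ` \<Delta>)" using \<Delta>(2) by simp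
      then show "d \<in> G (Max (k ` \<Delta>))" using k d mono by blast
    qed
    then show "\<exists>e\<in>assignments M. holds M e \<Delta>"
      using G(1)[of "Max (k ` \<Delta>)"] \<Delta>(2) unfolding henkin_ext_def fsat_def by blast
  qed
  have dec: "(p, v) \<in> ?G \<or> (Neg p, v) \<in> ?G" if pv: "(p, v) \<in> closures L" for p v
  proof -
    obtain k where "c k = (p, v)" using surj pv by blast
    then have "(p, v) \<in> G (Suc k) \<or> (Neg p, v) \<in> G (Suc k)" using G(2)[of k] by (simp add: good_def)
    then show ?thesis by blast
  qed
  have wit: "\<exists>y. (q, v(x := y)) \<in> ?G" if ex: "(Ex x q, v) \<in> ?G" for x q v
  proof -
    obtain k where k: "c k = (Ex x q, v)" using surj ex sub by blast
    \<comment> \<open>The stage that treats this pair accepts it or its negation. Finite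
      satisfiability excludes the negation, so the pair was present at that very stage and received
      its witness.\<close>
    have "(Neg (Ex x q), v) \<notin> ?G"
    proof
      assume "(Neg (Ex x q), v) \<in> ?G"
      then have "{(Ex x q, v), (Neg (Ex x q), v)} \<subseteq> ?G" using ex by blast
      then obtain e where "holds M e {(Ex x q, v), (Neg (Ex x q), v)}"
        using fs unfolding fsat_def by (meson finite.emptyI finite.insertI)
      then show False by (auto simp: holds_def)
    qed
    then have "(Ex x q, v) \<in> G (Suc k)" using G(2)[of k] k by (auto simp: good_def)
    then have "\<exists>y. (q, v(x := y)) \<in> G (Suc k)" using G(2)[of k] k by (simp add: good_def)
    then show ?thesis by blast
  qed
  have om: "\<exists>q\<in>P. (Neg q, v) \<in> ?G" if v: "v \<in> fin_supp" for v
  proof -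
    obtain k where "c k = (Eq (Var 0) (Var 0), v)" using surj top[OF v] by blast
    then have "\<exists>q\<in>P. (Neg q, v) \<in> G (Suc k)" using G(2)[of k] by (simp add: good_def)
    then show ?thesis by blast
  qed
  have "\<Gamma>0 \<subseteq> ?G" using G(1)[of 0] by (auto simp: henkin_ext_def)
  moreover have "\<forall>(p, v)\<in>closures L. (p, v) \<in> ?G \<or> (Neg p, v) \<in> ?G" using dec by blast
  moreover have "\<forall>x q v. (Ex x q, v) \<in> ?G \<longrightarrow> (\<exists>y. (q, v(x := y)) \<in> ?G)" using wit by blast
  moreover have "\<forall>v\<in>fin_supp. \<exists>q\<in>P. (Neg q, v) \<in> ?G" using om by blast
  ultimately show ?thesis using sub fs by (intro exI[of _ ?G] conjI)
qed

section \<open>The term model of a maximal finitely satisfiable set\<close>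

locale henkin =
  fixes L :: "('r, 'c) lang" and M :: "('r, 'c, 'a) fostruct" and \<Gamma>
  assumes struct: "is_struct L M"
    and sub: "\<Gamma> \<subseteq> closures L" and fs: "fsat M \<Gamma>"
    and dec: "(p, v) \<in> closures L \<Longrightarrow> (p, v) \<in> \<Gamma> \<or> (Neg p, v) \<in> \<Gamma>"
    and wit: "(Ex x q, v) \<in> \<Gamma> \<Longrightarrow> \<exists>y. (q, v(x := y)) \<in> \<Gamma>"
begin

text \<open>If the conclusion were missing, its negation would belong to the set, contradicting
  finite satisfiability. Every closure property below is an instance with an explicit finite set of
  premises.\<close>

lemma entail:
  assumes "\<Delta> \<subseteq> \<Gamma>" "finite \<Delta>" "fm_of L p" "v \<in> fin_supp"
    and "\<And>e. e \<in> assignments M \<Longrightarrow> holds M e \<Delta> \<Longrightarrow> sat M (e \<circ> v) p"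
  shows "(p, v) \<in> \<Gamma>"
proof (rule ccontr)
  assume "(p, v) \<notin> \<Gamma>"
  then have "(Neg p, v) \<in> \<Gamma>" using dec assms by (auto simp: closures_def)
  then obtain e where e: "e \<in> assignments M" "holds M e (insert (Neg p, v) \<Delta>)"
    using fs assms(1,2) unfolding fsat_def by (metis finite_insert insert_subset)
  then show False using assms(5) by (auto simp: holds_insert)
qed

lemma neg_iff:
  assumes "fm_of L p" "v \<in> fin_supp"
  shows "(Neg p, v) \<in> \<Gamma> \<longleftrightarrow> (p, v) \<notin> \<Gamma>"
proof
  assume n: "(Neg p, v) \<in> \<Gamma>"
  show "(p, v) \<notin> \<Gamma>"
  proof
    assume "(p, v) \<in> \<Gamma>"
    then have "{(p, v), (Neg p, v)} \<subseteq> \<Gamma>" using n by blast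
    then obtain e where "holds M e {(p, v), (Neg p, v)}"
      using fs unfolding fsat_def by (meson finite.emptyI finite.insertI)
    then show False by (simp add: holds_def)
  qed
qed (use dec assms in \<open>auto simp: closures_def\<close>)

definition pr :: "nat \<Rightarrow> nat \<Rightarrow> nat \<Rightarrow> nat" where
  "pr y z = (\<lambda>_. 0)(0 := y, 1 := z)"

lemma pr_simps [simp]: "pr y z 0 = y" "pr y z (Suc 0) = z" "pr y z \<in> fin_supp"
  by (simp_all add: pr_def fin_supp_upd fin_supp_zero)

definition eqv :: "nat \<Rightarrow> nat \<Rightarrow> bool" where
  "eqv y z \<longleftrightarrow> (Eq (Var 0) (Var 1), pr y z) \<in> \<Gamma>"

lemma eqv_refl: "eqv y y"
  unfolding eqv_def by (rule entail[of "{}"]) auto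

lemma eqv_sym: "eqv y z \<Longrightarrow> eqv z y"
  unfolding eqv_def by (rule entail[of "{(Eq (Var 0) (Var 1), pr y z)}"]) (auto simp: holds_def)

lemma eqv_trans: "eqv x y \<Longrightarrow> eqv y z \<Longrightarrow> eqv x z"
  unfolding eqv_def
  by (rule entail[of "{(Eq (Var 0) (Var 1), pr x y), (Eq (Var 0) (Var 1), pr y z)}"]) (auto simp: holds_def)

text \<open>Least representatives instead of equivalence classes keep the term model on the natural
  numbers, where categoricity is formulated.\<close>

definition rep :: "nat \<Rightarrow> nat" where
  "rep y = (LEAST z. eqv y z)"

lemma rep_iff: "rep y = rep z \<longleftrightarrow> eqv y z"
proof
  have r: "eqv x (rep x)" for x unfolding rep_def using eqv_refl by (rule LeastI)
  assume "rep y = rep z"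
  then show "eqv y z" using r[of y] r[of z] eqv_sym eqv_trans by metis
next
  assume e: "eqv y z"
  have "eqv y = eqv z"
    using eqv_trans[OF e] eqv_trans[OF eqv_sym[OF e]] by blast
  then show "rep y = rep z" unfolding rep_def by simp
qed

definition con :: "'c \<Rightarrow> nat" where
  "con c = (SOME y. (Eq (Var 0) (Cst c), (\<lambda>_. 0)(0 := y)) \<in> \<Gamma>)"

lemma con: "c \<in> Consts L \<Longrightarrow> (Eq (Var 0) (Cst c), (\<lambda>_. 0)(0 := con c)) \<in> \<Gamma>"
  unfolding con_def
proof (rule someI_ex)
  assume c: "c \<in> Consts L"
  have "(Ex 0 (Eq (Var 0) (Cst c)), \<lambda>_. 0) \<in> \<Gamma>"
    by (rule entail[of "{}"]) (use c struct fin_supp_zero in \<open>auto simp: is_struct_def\<close>)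
  then show "\<exists>y. (Eq (Var 0) (Cst c), (\<lambda>_. 0)(0 := y)) \<in> \<Gamma>" using wit by blast
qed

fun name :: "(nat \<Rightarrow> nat) \<Rightarrow> 'c trm \<Rightarrow> nat" where
  "name v (Var x) = v x"
| "name v (Cst c) = con c"

text \<open>The premises to feed into \<open>entail\<close> so that a constant symbol may be
  exchanged for its Henkin name.\<close>

fun con_facts :: "'c trm \<Rightarrow> (('r, 'c) fm \<times> (nat \<Rightarrow> nat)) set" where
  "con_facts (Var x) = {}"
| "con_facts (Cst c) = {(Eq (Var 0) (Cst c), (\<lambda>_. 0)(0 := con c))}"

lemma con_facts: "trm_of L t \<Longrightarrow> con_facts t \<subseteq> \<Gamma>" "finite (con_facts t)"
  by (cases t; use con in auto)+

lemma trm_val_name: "holds M e (con_facts t) \<Longrightarrow> trm_val M (e \<circ> v) t = e (name v t)"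
  by (cases t) (auto simp: holds_def)

definition term_model :: "('r, 'c, nat) fostruct" where
  "term_model = \<lparr>univ = range rep,
     rel = (\<lambda>r. {map rep ys | ys. length ys = arity L r \<and>
       (Rel r (map Var [0..<length ys]), \<lambda>i. if i < length ys then ys ! i else 0) \<in> \<Gamma>}),
     cst = (\<lambda>c. rep (con c))\<rparr>"

lemma trm_val_term_model: "trm_val term_model (rep \<circ> v) t = rep (name v t)"
  by (cases t) (auto simp: term_model_def)

lemma truth: "fm_of L p \<Longrightarrow> v \<in> fin_supp \<Longrightarrow> sat term_model (rep \<circ> v) p \<longleftrightarrow> (p, v) \<in> \<Gamma>"
proof (induction p arbitrary: v)
  case (Eq s t)
  let ?e = "(Eq (Var 0) (Var 1), pr (name v s) (name v t))" and ?C = "con_facts s \<union> con_facts t"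
  have C: "?C \<subseteq> \<Gamma>" "finite ?C" using con_facts Eq by auto
  have h: "trm_val M (e \<circ> v) s = e (name v s)" "trm_val M (e \<circ> v) t = e (name v t)"
    if "holds M e ?C" for e
    using that trm_val_name holds_subset by (metis sup_ge1, metis sup_ge2)
  have "?e \<in> \<Gamma> \<longleftrightarrow> (Eq s t, v) \<in> \<Gamma>"
  proof
    assume "?e \<in> \<Gamma>"
    then show "(Eq s t, v) \<in> \<Gamma>"
      by (intro entail[of "insert ?e ?C"]) (use C h Eq in \<open>auto simp: holds_insert\<close>)
  next
    assume "(Eq s t, v) \<in> \<Gamma>"
    then show "?e \<in> \<Gamma>"
      by (intro entail[of "insert (Eq s t, v) ?C"]) (use C h Eq in \<open>auto simp: holds_insert\<close>)
  qed
  then show ?case by (simp add: trm_val_term_model[unfolded comp_def] comp_def rep_iff eqv_def)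
next
  case (Rel r ts)
  let ?C = "\<Union>t\<in>set ts. con_facts t"
  have C: "?C \<subseteq> \<Gamma>" "finite ?C" using con_facts Rel by auto
  have h: "map (trm_val M (e \<circ> v)) ts = map (e \<circ> name v) ts" if "holds M e ?C" for e
    using that by (auto intro!: trm_val_name holds_subset[of M e ?C])
  let ?v = "\<lambda>ys i. if i < length ys then ys ! i else 0"
  let ?at = "\<lambda>ys. (Rel r (map Var [0..<length ys]), ?v ys) :: ('r, 'c) fm \<times> (nat \<Rightarrow> nat)"
  have at: "holds M e {?at ys} \<longleftrightarrow> map e ys \<in> rel M r" for e ys
  proof -
    have "map (trm_val M (e \<circ> ?v ys) \<circ> Var) [0..<length ys] = map e ys"
      by (rule nth_equalityI) auto
    then show ?thesis by (simp add: holds_def)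
  qed
  have len: "length ts = arity L r" "r \<in> Rels L" using Rel by auto
  have "map (trm_val term_model (rep \<circ> v)) ts = map rep (map (name v) ts)"
    by (simp add: trm_val_term_model)
  then have "sat term_model (rep \<circ> v) (Rel r ts) \<longleftrightarrow>
      (\<exists>ys. map rep (map (name v) ts) = map rep ys \<and> length ys = arity L r \<and> ?at ys \<in> \<Gamma>)"
    by (simp only: sat.simps) (simp add: term_model_def)
  also have "\<dots> \<longleftrightarrow> (Rel r ts, v) \<in> \<Gamma>"
  proof
    assume "\<exists>ys. map rep (map (name v) ts) = map rep ys \<and> length ys = arity L r \<and> ?at ys \<in> \<Gamma>"
    then obtain ys where ys: "map rep (map (name v) ts) = map rep ys" "length ys = arity L r" "?at ys \<in> \<Gamma>"
      by blast
    \<comment> \<open>Names with the same representative need not be equal; these equations carry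
      the atom from ys to the names of the terms ts.\<close>
    let ?E = "(\<lambda>i. (Eq (Var 0) (Var 1), pr (name v (ts ! i)) (ys ! i)) :: ('r, 'c) fm \<times> (nat \<Rightarrow> nat)) ` {..<length ys}"
    have "rep (name v (ts ! i)) = rep (ys ! i)" if "i < length ys" for i
      using arg_cong[OF ys(1), of "\<lambda>xs. xs ! i"] that ys(2) len by simp
    then have E: "?E \<subseteq> \<Gamma>" by (auto simp: rep_iff eqv_def)
    show "(Rel r ts, v) \<in> \<Gamma>"
    proof (rule entail[of "insert (?at ys) (?E \<union> ?C)"])
      show "insert (?at ys) (?E \<union> ?C) \<subseteq> \<Gamma>" "finite (insert (?at ys) (?E \<union> ?C))"
        using ys(3) E C by auto
      fix e assume e: "holds M e (insert (?at ys) (?E \<union> ?C))"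
      have "map e ys \<in> rel M r" using at holds_subset[OF e, of "{?at ys}"] by blast
      moreover have "map (e \<circ> name v) ts = map e ys"
      proof (rule nth_equalityI)
        fix i assume "i < length (map (e \<circ> name v) ts)"
        then have i: "i < length ys" "i < length ts" using len ys(2) by auto
        have "holds M e ?E" using holds_subset[OF e] by blast
        then have "e (name v (ts ! i)) = e (ys ! i)" using i by (auto simp: holds_def)
        then show "map (e \<circ> name v) ts ! i = map e ys ! i" using i by simp
      qed (use len ys in simp)
      moreover have "map (trm_val M (e \<circ> v)) ts = map (e \<circ> name v) ts"
        by (rule h) (rule holds_subset[OF e], blast)
      ultimately show "sat M (e \<circ> v) (Rel r ts)" by simp
    qed (use Rel in auto)
  next
    assume R: "(Rel r ts, v) \<in> \<Gamma>"
    let ?ys = "map (name v) ts"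
    have "?at ?ys \<in> \<Gamma>"
    proof (rule entail[of "insert (Rel r ts, v) ?C"])
      show "insert (Rel r ts, v) ?C \<subseteq> \<Gamma>" "finite (insert (Rel r ts, v) ?C)" using R C by auto
      show "fm_of L (Rel r (map Var [0..<length ?ys]))" using len by auto
      fix e assume e: "holds M e (insert (Rel r ts, v) ?C)"
      then have "map (trm_val M (e \<circ> v)) ts \<in> rel M r" by (simp add: holds_insert)
      moreover have "map (trm_val M (e \<circ> v)) ts = map (e \<circ> name v) ts"
        by (rule h) (rule holds_subset[OF e], blast)
      ultimately have "holds M e {?at ?ys}" unfolding at by simp
      then show "sat M (e \<circ> ?v ?ys) (Rel r (map Var [0..<length ?ys]))" by (simp only: holds_def) simp
    qed (rule fin_supp_restrict)
    then show "\<exists>ys. map rep (map (name v) ts) = map rep ys \<and> length ys = arity L r \<and> ?at ys \<in> \<Gamma>"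
      using len by (intro exI[of _ ?ys]) simp
  qed
  finally show ?case .
next
  case (Neg p)
  then show ?case by (simp add: neg_iff)
next
  case (Conj p q)
  have "(Conj p q, v) \<in> \<Gamma> \<longleftrightarrow> (p, v) \<in> \<Gamma> \<and> (q, v) \<in> \<Gamma>"
  proof (intro iffI conjI)
    assume "(Conj p q, v) \<in> \<Gamma>"
    then show "(p, v) \<in> \<Gamma>" "(q, v) \<in> \<Gamma>"
      by (intro entail[of "{(Conj p q, v)}"]; use Conj.prems in \<open>auto simp: holds_def\<close>)+
  next
    assume "(p, v) \<in> \<Gamma> \<and> (q, v) \<in> \<Gamma>"
    then show "(Conj p q, v) \<in> \<Gamma>"
      by (intro entail[of "{(p, v), (q, v)}"]) (use Conj.prems in \<open>auto simp: holds_def\<close>)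
  qed
  then show ?case using Conj by simp
next
  case (Ex x q)
  have "sat term_model (rep \<circ> v) (Ex x q) \<longleftrightarrow> (\<exists>y. sat term_model ((rep \<circ> v)(x := rep y)) q)"
    by (auto simp: term_model_def)
  also have "\<dots> \<longleftrightarrow> (\<exists>y. sat term_model (rep \<circ> v(x := y)) q)" by (simp add: fun_upd_comp)
  also have "\<dots> \<longleftrightarrow> (\<exists>y. (q, v(x := y)) \<in> \<Gamma>)"
    using Ex.IH[OF _ fin_supp_upd[OF Ex.prems(2)]] Ex.prems(1) by (simp only: fm_of.simps)
  also have "\<dots> \<longleftrightarrow> (Ex x q, v) \<in> \<Gamma>"
  proof
    assume "\<exists>y. (q, v(x := y)) \<in> \<Gamma>"
    then obtain y where y: "(q, v(x := y)) \<in> \<Gamma>" by blast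
    show "(Ex x q, v) \<in> \<Gamma>"
    proof (rule entail[of "{(q, v(x := y))}"])
      fix e assume e: "e \<in> assignments M" "holds M e {(q, v(x := y))}"
      then have "sat M ((e \<circ> v)(x := e y)) q" by (simp add: holds_def fun_upd_comp)
      moreover have "e y \<in> univ M" using e by (auto simp: assignments_def)
      ultimately show "sat M (e \<circ> v) (Ex x q)" by auto
    qed (use y Ex.prems in auto)
  qed (rule wit)
  finally show ?case .
qed

lemma term_model_struct: "is_struct L term_model"
  by (auto simp: is_struct_def term_model_def tuples_def)

lemma term_model_model: "is_model L (theory_of L M) term_model"
  unfolding is_model_def
proof (intro conjI ballI term_model_struct)
  fix p v assume p: "p \<in> theory_of L M"
  then have "(p, \<lambda>_. 0) \<in> \<Gamma>"
  proof (intro entail[of "{}"])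
    fix e assume "e \<in> assignments M"
    then have "e \<circ> (\<lambda>_. 0) \<in> assignments M" by (auto simp: assignments_def)
    then show "sat M (e \<circ> (\<lambda>_. 0)) p" using p by (simp add: theory_of_def)
  qed (use p in \<open>auto simp: theory_of_def fin_supp_zero\<close>)
  then have "sat term_model (rep \<circ> (\<lambda>_. 0)) p"
    using truth p by (auto simp: theory_of_def fin_supp_zero)
  then show "sat term_model v p" using p sat_sentence[of p] by (auto simp: theory_of_def)
qed

end

text \<open>Used in two ways: with empty \<open>\<Gamma>0\<close> and P a type without isolating
  formula it omits P; with P consisting of a contradiction it realises an infinite
  \<open>\<Gamma>0\<close>.\<close>

lemma henkin_model:
  assumes "countable (Rels L)" "countable (Consts L)" and M: "is_struct L M"
    and "henkin_ext L M \<Gamma>0 \<Gamma>0"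
    and "\<And>\<Gamma> v. henkin_ext L M \<Gamma>0 \<Gamma> \<Longrightarrow> v \<in> fin_supp \<Longrightarrow>
       \<exists>q\<in>P. fm_of L q \<and> fsat M (insert (Neg q, v) \<Gamma>)"
  shows "\<exists>(N :: ('r, 'c, nat) fostruct) \<rho>. is_model L (theory_of L M) N \<and> univ N = range \<rho> \<and>
     (\<forall>(p, v)\<in>\<Gamma>0. sat N (\<rho> \<circ> v) p) \<and> (\<forall>v\<in>fin_supp. \<exists>q\<in>P. \<not> sat N (\<rho> \<circ> v) q)"
proof -
  have "\<exists>\<Gamma>. \<Gamma>0 \<subseteq> \<Gamma> \<and> \<Gamma> \<subseteq> closures L \<and> fsat M \<Gamma> \<and>
     (\<forall>(p, v)\<in>closures L. (p, v) \<in> \<Gamma> \<or> (Neg p, v) \<in> \<Gamma>) \<and>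
     (\<forall>x q v. (Ex x q, v) \<in> \<Gamma> \<longrightarrow> (\<exists>y. (q, v(x := y)) \<in> \<Gamma>)) \<and>
     (\<forall>v\<in>fin_supp. \<exists>q\<in>P. (Neg q, v) \<in> \<Gamma>)"
    by (rule henkin_set[OF assms(1,2,4)]) (rule assms(5))
  then obtain \<Gamma> where \<Gamma>: "\<Gamma>0 \<subseteq> \<Gamma>" "\<Gamma> \<subseteq> closures L" "fsat M \<Gamma>"
     "\<forall>(p, v)\<in>closures L. (p, v) \<in> \<Gamma> \<or> (Neg p, v) \<in> \<Gamma>"
     "\<forall>x q v. (Ex x q, v) \<in> \<Gamma> \<longrightarrow> (\<exists>y. (q, v(x := y)) \<in> \<Gamma>)"
     "\<forall>v\<in>fin_supp. \<exists>q\<in>P. (Neg q, v) \<in> \<Gamma>"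
    by (elim exE conjE) (rule that)
  interpret henkin L M \<Gamma>
    using \<Gamma>(2-5) M by unfold_locales auto
  have truth': "sat term_model (rep \<circ> v) p" if "(p, v) \<in> \<Gamma>" for p v
    using truth[of p v] that \<Gamma>(2) by (auto simp: closures_def)
  have "\<forall>v\<in>fin_supp. \<exists>q\<in>P. \<not> sat term_model (rep \<circ> v) q"
    using truth' \<Gamma>(6) by fastforce
  moreover have "\<forall>(p, v)\<in>\<Gamma>0. sat term_model (rep \<circ> v) p"
    using truth' \<Gamma>(1) by blast
  moreover have "univ term_model = range rep" by (simp add: term_model_def)
  ultimately show ?thesis using term_model_model by blast
qed

section \<open>The Ryll-Nardzewski theorem\<close>

lemma is_iso_comp:
  assumes f: "is_iso L M N f" and g: "is_iso L N K g"
  shows "is_iso L M K (g \<circ> f)"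
  unfolding is_iso_def
proof (intro conjI ballI)
  show "bij_betw (g \<circ> f) (univ M) (univ K)"
    using f g by (auto simp: is_iso_def intro: bij_betw_trans)
next
  fix r xs assume r: "r \<in> Rels L" and xs: "xs \<in> tuples (univ M) (arity L r)"
  have "f ` univ M = univ N" using f by (simp add: is_iso_def bij_betw_def)
  then have "map f xs \<in> tuples (univ N) (arity L r)" using xs by (auto simp: tuples_def)
  then show "xs \<in> rel M r \<longleftrightarrow> map (g \<circ> f) xs \<in> rel K r"
    using f g r xs unfolding is_iso_def by (metis map_map)
qed (use f g in \<open>auto simp: is_iso_def\<close>)

text \<open>Categoricity compares structures on the natural numbers, so M is first copied there
  along a numbering of its universe.\<close>

lemma omega_categorical_iso:
  fixes M :: "('r, 'c, 'a) fostruct" and N :: "('r, 'c, nat) fostruct"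
  assumes M: "is_struct L M" "countable (univ M)" and cat: "omega_categorical L M"
    and N: "is_model L (theory_of L M) N"
  shows "\<exists>f. is_iso L M N f"
proof -
  define h where "h = to_nat_on (univ M)"
  define M' :: "('r, 'c, nat) fostruct" where
    "M' = \<lparr>univ = h ` univ M, rel = (\<lambda>r. map h ` (rel M r \<inter> lists (univ M))), cst = h \<circ> cst M\<rparr>"
  have inj: "inj_on h (univ M)" unfolding h_def by (rule inj_on_to_nat_on[OF M(2)])
  have iso: "is_iso L M M' h"
    unfolding is_iso_def
  proof (intro conjI ballI)
    show "bij_betw h (univ M) (univ M')" using inj by (simp add: M'_def bij_betw_def)
  next
    fix r xs assume "r \<in> Rels L" "xs \<in> tuples (univ M) (arity L r)"
    then have xs: "xs \<in> lists (univ M)" by (auto simp: tuples_def)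
    show "xs \<in> rel M r \<longleftrightarrow> map h xs \<in> rel M' r"
    proof
      assume "map h xs \<in> rel M' r"
      then obtain ys where ys: "ys \<in> rel M r" "ys \<in> lists (univ M)" "map h xs = map h ys"
        by (auto simp: M'_def)
      have "inj_on h (set xs \<union> set ys)" using inj xs ys(2) by (auto intro: inj_on_subset)
      then have "xs = ys" using ys(3) inj_on_map_eq_map by blast
      then show "xs \<in> rel M r" using ys(1) by simp
    qed (use xs in \<open>simp add: M'_def\<close>)
  qed (simp add: M'_def)
  have "is_struct L M'"
    using M(1) by (fastforce simp: is_struct_def M'_def tuples_def)
  moreover have "sat M' v p" if p: "p \<in> theory_of L M" and v: "v \<in> assignments M'" for p v
  proof -
    obtain e where e: "e \<in> assignments M" using assignments_nonempty[OF M(1)] by blast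
    then have "sat M' (h \<circ> e) p" using iso_sat[OF M(1) iso, of p e] p by (auto simp: theory_of_def)
    then show ?thesis using sat_sentence[of p M' "h \<circ> e" v] p by (simp add: theory_of_def)
  qed
  ultimately have "is_model L (theory_of L M) M'" by (simp add: is_model_def)
  then obtain f where "is_iso L M' N f"
    using cat N unfolding omega_categorical_def omega_categorical_theory_def isomorphic_def by blast
  then show ?thesis using is_iso_comp[OF iso] by blast
qed

text \<open>The formula says that the Henkin constants can be interpreted so that
  \<open>\<Gamma>\<close> holds and, for i below n, variable i is the value of the constant
  \<open>v i\<close>.\<close>

lemma realisation_formula:
  assumes M: "is_struct L M" and \<Gamma>: "finite \<Gamma>" "\<Gamma> \<subseteq> closures L"
  shows "\<exists>\<theta>. fm_of L \<theta> \<and> fv \<theta> \<subseteq> {..<n} \<and>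
     (\<forall>u\<in>assignments M. sat M u \<theta> \<longrightarrow> (\<exists>e\<in>assignments M. holds M e \<Gamma> \<and> (\<forall>i<n. u i = e (v i)))) \<and>
     (\<forall>e\<in>assignments M. holds M e \<Gamma> \<longrightarrow> sat M (e \<circ> v) \<theta>)"
proof -
  have ne: "univ M \<noteq> {}" using M by (simp add: is_struct_def)
  obtain gs where gs: "set gs = \<Gamma>" using \<Gamma>(1) finite_list by blast
  \<comment> \<open>Variable \<open>y + n\<close> stands for the Henkin constant y; the shift keeps
    these variables apart from the first n, which stay free.\<close>
  define ps where "ps = map (\<lambda>(p, w). rename (\<lambda>x. w x + n) p) gs @ map (\<lambda>i. Eq (Var i) (Var (v i + n))) [0..<n]"
  define \<gamma> where "\<gamma> = Conjs ps"
  define ys where "ys = sorted_list_of_set (fv \<gamma> - {..<n})"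
  have ys: "set ys = fv \<gamma> - {..<n}" by (simp add: ys_def)
  have \<gamma>: "sat M u \<gamma> \<longleftrightarrow> holds M (\<lambda>y. u (y + n)) \<Gamma> \<and> (\<forall>i<n. u i = u (v i + n))" for u
  proof -
    have "sat M u \<gamma> \<longleftrightarrow> (\<forall>(p, w)\<in>\<Gamma>. sat M (u \<circ> (\<lambda>x. w x + n)) p) \<and> (\<forall>i<n. u i = u (v i + n))"
      unfolding \<gamma>_def sat_Conjs[OF ne] ps_def using gs by (auto simp: ball_Un)
    then show ?thesis by (simp add: holds_def comp_def)
  qed
  define \<theta> where "\<theta> = Exs ys \<gamma>"
  have "fm_of L \<gamma>"
    unfolding \<gamma>_def ps_def using gs \<Gamma>(2) by (auto simp: closures_def intro!: fm_of_rename)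
  then have "fm_of L \<theta>" by (simp add: \<theta>_def)
  moreover have "fv \<theta> \<subseteq> {..<n}" by (auto simp: \<theta>_def ys)
  moreover have "\<exists>e\<in>assignments M. holds M e \<Gamma> \<and> (\<forall>i<n. u i = e (v i))"
    if u: "u \<in> assignments M" "sat M u \<theta>" for u
  proof -
    obtain w where w: "\<forall>y\<in>set ys. w y \<in> univ M" "\<forall>y. y \<notin> set ys \<longrightarrow> w y = u y" "sat M w \<gamma>"
      using u(2) unfolding \<theta>_def sat_Exs by blast
    have "w y \<in> univ M" for y using w(1,2) u(1) by (cases "y \<in> set ys") (auto simp: assignments_def)
    then have "(\<lambda>y. w (y + n)) \<in> assignments M" by (auto simp: assignments_def)
    moreover have "u i = w (v i + n)" if "i < n" for i
      using w(2,3) ys that by (simp add: \<gamma>)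
    ultimately show ?thesis using w(3) by (intro bexI[of _ "\<lambda>y. w (y + n)"]) (auto simp: \<gamma>)
  qed
  moreover have "sat M (e \<circ> v) \<theta>" if e: "e \<in> assignments M" "holds M e \<Gamma>" for e
  proof -
    let ?w = "\<lambda>z. if z < n then e (v z) else e (z - n)"
    let ?w' = "\<lambda>z. if z \<in> set ys then ?w z else (e \<circ> v) z"
    have "sat M ?w \<gamma>" using e by (simp add: \<gamma>)
    moreover have "sat M ?w \<gamma> \<longleftrightarrow> sat M ?w' \<gamma>"
      by (rule sat_cong) (auto simp: ys)
    ultimately have "sat M ?w' \<gamma>" by simp
    moreover have "\<forall>y\<in>set ys. ?w' y \<in> univ M" using e(1) by (auto simp: assignments_def)
    ultimately show ?thesis unfolding \<theta>_def sat_Exs by (intro exI[of _ ?w']) simp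
  qed
  ultimately show ?thesis by blast
qed

lemma fsat_of_holds: "e \<in> assignments M \<Longrightarrow> holds M e \<Gamma> \<Longrightarrow> fsat M \<Gamma>"
  unfolding fsat_def using holds_subset by blast

text \<open>A realised type that is not isolated could be omitted.\<close>

lemma omega_categorical_atomic:
  fixes M :: "('r, 'c, 'a) fostruct"
  assumes L: "countable (Rels L)" "countable (Consts L)"
    and M: "is_struct L M" "countable (univ M)" and cat: "omega_categorical L M"
  shows "atomic_struct L M"
proof (rule ccontr)
  assume "\<not> atomic_struct L M"
  then obtain n e0 where e0: "e0 \<in> assignments M" and no: "\<And>p. complete_fm L M n p \<Longrightarrow> \<not> sat M e0 p"
    unfolding atomic_struct_def by blast
  define P where "P = {q. fm_of L q \<and> fv q \<subseteq> {..<n} \<and> sat M e0 q}"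
  have PN: "q \<in> P \<or> Neg q \<in> P" if "fm_of L q" "fv q \<subseteq> {..<n}" for q using that by (auto simp: P_def)
  have ext0: "henkin_ext L M {} {}"
    using fsat_of_holds[OF e0, of "{}"] by (auto simp: henkin_ext_def used_def holds_def)
  have omit: "\<exists>q\<in>P. fm_of L q \<and> fsat M (insert (Neg q, v) \<Gamma>)"
    if \<Gamma>: "henkin_ext L M {} \<Gamma>" and v: "v \<in> fin_supp" for \<Gamma> v
  proof (rule ccontr)
    \<comment> \<open>If no member of P can be refuted at v, then \<open>\<Gamma>\<close> forces all
      of P on the tuple named by v, and the formula describing the possible values of that tuple
      isolates P.\<close>
    assume *: "\<not> ?thesis"
    have fin: "finite \<Gamma>" "\<Gamma> \<subseteq> closures L" "fsat M \<Gamma>" using \<Gamma> by (auto simp: henkin_ext_def)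
    have imp: "sat M (e \<circ> v) q" if "e \<in> assignments M" "holds M e \<Gamma>" "q \<in> P" for e q
    proof (rule ccontr)
      assume "\<not> sat M (e \<circ> v) q"
      then have "holds M e (insert (Neg q, v) \<Gamma>)" using that by (simp add: holds_insert)
      then show False using * fsat_of_holds that by (auto simp: P_def)
    qed
    obtain \<theta> where \<theta>: "fm_of L \<theta>" "fv \<theta> \<subseteq> {..<n}"
      "\<And>u. u \<in> assignments M \<Longrightarrow> sat M u \<theta> \<Longrightarrow> \<exists>e\<in>assignments M. holds M e \<Gamma> \<and> (\<forall>i<n. u i = e (v i))"
      "\<And>e. e \<in> assignments M \<Longrightarrow> holds M e \<Gamma> \<Longrightarrow> sat M (e \<circ> v) \<theta>"
      using realisation_formula[OF M(1) fin(1,2), of n v] by blast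
    have all: "sat M u q" if u: "u \<in> assignments M" "sat M u \<theta>" and q: "q \<in> P" for u q
    proof -
      obtain e where e: "e \<in> assignments M" "holds M e \<Gamma>" "\<forall>i<n. u i = e (v i)" using \<theta>(3) u by blast
      have "sat M u q \<longleftrightarrow> sat M (e \<circ> v) q"
        by (rule sat_cong) (use e(3) q in \<open>auto simp: P_def\<close>)
      then show ?thesis using imp e q by blast
    qed
    have "complete_fm L M n \<theta>"
      unfolding complete_fm_def
    proof (intro conjI allI impI \<theta>(1,2))
      fix q assume "fm_of L q" "fv q \<subseteq> {..<n}"
      then consider "q \<in> P" | "Neg q \<in> P" using PN by blast
      then show "(\<forall>u\<in>assignments M. sat M u \<theta> \<longrightarrow> sat M u q) \<or> (\<forall>u\<in>assignments M. sat M u \<theta> \<longrightarrow> \<not> sat M u q)"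
      proof cases
        case 1
        then show ?thesis using all by blast
      next
        case 2
        then have "\<forall>u\<in>assignments M. sat M u \<theta> \<longrightarrow> sat M u (Neg q)" using all by blast
        then show ?thesis by simp
      qed
    qed
    \<comment> \<open>A complete formula cannot hold at \<open>e0\<close>, so its negation lies in P
      and is forced by \<open>\<Gamma>\<close>; but \<open>\<Gamma>\<close> forces the formula
      itself as well.\<close>
    then have "Neg \<theta> \<in> P" using no PN \<theta>(1,2) by (auto simp: P_def)
    moreover obtain e where e: "e \<in> assignments M" "holds M e \<Gamma>"
      using fin unfolding fsat_def by blast
    ultimately have "sat M (e \<circ> v) (Neg \<theta>)" using imp by blast
    then show False using \<theta>(4)[OF e] by simp
  qed
  obtain N :: "('r, 'c, nat) fostruct" and \<rho> where N: "is_model L (theory_of L M) N" "univ N = range \<rho>"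
    "\<forall>v\<in>fin_supp. \<exists>q\<in>P. \<not> sat N (\<rho> \<circ> v) q"
    using henkin_model[OF L M(1) ext0 omit] by blast
  obtain f where f: "is_iso L M N f" using omega_categorical_iso[OF M cat N(1)] by blast
  have "f (e0 i) \<in> range \<rho>" for i
    using f e0 N(2) unfolding is_iso_def bij_betw_def assignments_def by blast
  then have "\<exists>y. \<rho> y = f (e0 i)" for i by (metis image_iff)
  then obtain y where y: "\<And>i. \<rho> (y i) = f (e0 i)" by metis
  let ?v = "\<lambda>i. if i < n then y i else 0"
  obtain q where q: "q \<in> P" "\<not> sat N (\<rho> \<circ> ?v) q" using N(3) fin_supp_restrict by blast
  have "sat N (\<rho> \<circ> ?v) q \<longleftrightarrow> sat N (f \<circ> e0) q"
    by (rule sat_cong) (use q(1) y in \<open>auto simp: P_def\<close>)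
  also have "\<dots>" using q(1) iso_sat[OF M(1) f _ e0] by (auto simp: P_def)
  finally show False using q(2) by simp
qed

text \<open>If no finite family of isolating formulas covers M, their negations are jointly finitely
  satisfiable. A countable model realising all these negations at one tuple cannot be isomorphic to
  the atomic structure M.\<close>

lemma omega_categorical_finite_types:
  fixes M :: "('r, 'c, 'a) fostruct"
  assumes L: "countable (Rels L)" "countable (Consts L)"
    and M: "is_struct L M" "countable (univ M)" and cat: "omega_categorical L M"
  shows "finite_types L M"
  unfolding finite_types_def
proof (rule allI, rule ccontr)
  fix n
  assume no: "\<nexists>\<Phi>. finite \<Phi> \<and> (\<forall>p\<in>\<Phi>. complete_fm L M n p) \<and> (\<forall>v\<in>assignments M. \<exists>p\<in>\<Phi>. sat M v p)"
  \<comment> \<open>Variable i below n is named by constant i; sending the other variables to 0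
    gives finite support, and the isolating formulas do not see them.\<close>
  define \<iota> where "\<iota> i = (if i < n then i else 0)" for i :: nat
  have \<iota>: "\<iota> \<in> fin_supp" unfolding \<iota>_def[abs_def] by (rule fin_supp_restrict)
  define \<Gamma>0 where "\<Gamma>0 = (\<lambda>p. (Neg p, \<iota>)) ` {p. complete_fm L M n p}"
  \<comment> \<open>Omitting a contradiction imposes no condition, which turns the omission theorem
    into plain compactness.\<close>
  define bot :: "('r, 'c) fm" where "bot = Neg (Eq (Var 0) (Var 0))"
  have "fsat M \<Gamma>0"
    unfolding fsat_def
  proof (intro allI impI)
    fix \<Delta> assume \<Delta>: "\<Delta> \<subseteq> \<Gamma>0" "finite \<Delta>"
    then obtain \<Phi> where \<Phi>: "\<Phi> \<subseteq> {p. complete_fm L M n p}" "finite \<Phi>" "\<Delta> = (\<lambda>p. (Neg p, \<iota>)) ` \<Phi>"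
      unfolding \<Gamma>0_def by (meson finite_subset_image)
    have "\<forall>p\<in>\<Phi>. complete_fm L M n p" using \<Phi>(1) by blast
    then obtain e where e: "e \<in> assignments M" "\<forall>p\<in>\<Phi>. \<not> sat M e p"
      using no[unfolded not_ex, THEN spec, of \<Phi>] \<Phi>(2) by auto
    have "\<not> sat M (e \<circ> \<iota>) p" if "p \<in> \<Phi>" for p
    proof -
      have "sat M (e \<circ> \<iota>) p \<longleftrightarrow> sat M e p"
        by (rule sat_cong) (use \<Phi>(1) that in \<open>auto simp: \<iota>_def complete_fm_def\<close>)
      then show ?thesis using e that by simp
    qed
    then show "\<exists>e\<in>assignments M. holds M e \<Delta>" using e(1) \<Phi>(3) by (auto simp: holds_def)
  qed
  moreover have "\<Gamma>0 \<subseteq> closures L" using \<iota> by (auto simp: \<Gamma>0_def closures_def complete_fm_def)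
  moreover have "used \<Gamma>0 \<subseteq> {..<n}" by (auto simp: used_def \<Gamma>0_def \<iota>_def complete_fm_def)
  then have "finite (used \<Gamma>0)" by (rule finite_subset) simp
  ultimately have ext0: "henkin_ext L M \<Gamma>0 \<Gamma>0" by (simp add: henkin_ext_def)
  have omit: "\<exists>q\<in>{bot}. fm_of L q \<and> fsat M (insert (Neg q, v) \<Gamma>)"
    if \<Gamma>: "henkin_ext L M \<Gamma>0 \<Gamma>" for \<Gamma> v
  proof -
    have "\<exists>e\<in>assignments M. holds M e (insert (Neg bot, v) \<Delta>)" if "\<Delta> \<subseteq> \<Gamma>" "finite \<Delta>" for \<Delta>
    proof -
      obtain e where "e \<in> assignments M" "holds M e \<Delta>"
        using \<Gamma> \<open>\<Delta> \<subseteq> \<Gamma>\<close> \<open>finite \<Delta>\<close> unfolding henkin_ext_def fsat_def by blast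
      then show ?thesis by (auto simp: holds_insert bot_def)
    qed
    then have "fsat M (insert (Neg bot, v) \<Gamma>)" by (rule fsat_insertI)
    then show ?thesis by (simp add: bot_def)
  qed
  obtain N :: "('r, 'c, nat) fostruct" and \<rho> where N: "is_model L (theory_of L M) N" "univ N = range \<rho>"
    "\<forall>(p, v)\<in>\<Gamma>0. sat N (\<rho> \<circ> v) p"
    using henkin_model[OF L M(1) ext0, of "{bot}"] omit by blast
  obtain f where f: "is_iso L M N f" using omega_categorical_iso[OF M cat N(1)] by blast
  have img: "f ` univ M = univ N" using f by (simp add: is_iso_def bij_betw_def)
  have "\<exists>a\<in>univ M. f a = \<rho> (\<iota> i)" for i using img N(2) by (metis image_iff rangeI)
  then obtain u where u: "\<And>i. u i \<in> univ M" "\<And>i. f (u i) = \<rho> (\<iota> i)" by metis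
  have ua: "u \<in> assignments M" using u(1) by (auto simp: assignments_def)
  then obtain p where p: "complete_fm L M n p" "sat M u p"
    using omega_categorical_atomic[OF L M cat] unfolding atomic_struct_def by blast
  have "sat N (f \<circ> u) p" using iso_sat[OF M(1) f _ ua] p by (auto simp: complete_fm_def)
  moreover have "f \<circ> u = \<rho> \<circ> \<iota>" using u(2) by auto
  ultimately have "sat N (\<rho> \<circ> \<iota>) p" by simp
  moreover have "sat N (\<rho> \<circ> \<iota>) (Neg p)" using N(3) p(1) by (auto simp: \<Gamma>0_def)
  ultimately show False by simp
qed

section \<open>Permutation groups with trivial algebraic closure\<close>

locale perm_group =
  fixes X :: "'a set" and G :: "('a \<Rightarrow> 'a) set"
  assumes id_mem: "id \<in> G"
    and comp_mem: "f \<in> G \<Longrightarrow> g \<in> G \<Longrightarrow> f \<circ> g \<in> G"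
    and inv_mem: "f \<in> G \<Longrightarrow> inv f \<in> G"
    and bij_mem: "f \<in> G \<Longrightarrow> bij f"
    and closed_mem: "f \<in> G \<Longrightarrow> x \<in> X \<Longrightarrow> f x \<in> X"
begin

definition stab :: "'a set \<Rightarrow> ('a \<Rightarrow> 'a) set" where
  "stab A = {g \<in> G. \<forall>a\<in>A. g a = a}"

definition conj_over :: "'a set \<Rightarrow> 'a list \<Rightarrow> 'a list \<Rightarrow> bool" where
  "conj_over A xs ys \<longleftrightarrow> (\<exists>g\<in>stab A. map g xs = ys)"

definition orb :: "'a set \<Rightarrow> 'a \<Rightarrow> 'a set" where
  "orb A x = (\<lambda>g. g x) ` stab A"

text \<open>Algebraic closure in the sense of the group: finite orbits under the pointwise
  stabiliser take the place of algebraic formulas.\<close>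

definition acl :: "'a set \<Rightarrow> 'a set" where
  "acl A = {x \<in> X. finite (orb A x)}"

lemma stab_empty [simp]: "stab {} = G"
  by (auto simp: stab_def)

lemma stab_G: "g \<in> stab A \<Longrightarrow> g \<in> G"
  by (auto simp: stab_def)

lemma stab_fix: "g \<in> stab A \<Longrightarrow> a \<in> A \<Longrightarrow> g a = a"
  by (auto simp: stab_def)

lemma stab_mono: "A \<subseteq> B \<Longrightarrow> stab B \<subseteq> stab A"
  by (auto simp: stab_def)

lemma id_stab: "id \<in> stab A"
  by (auto simp: stab_def id_mem)

lemma comp_stab: "f \<in> stab A \<Longrightarrow> g \<in> stab A \<Longrightarrow> f \<circ> g \<in> stab A"
  by (auto simp: stab_def comp_mem)

lemma inv_cancel: "g \<in> G \<Longrightarrow> inv g (g x) = x" "g \<in> G \<Longrightarrow> g (inv g x) = x"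
  by (auto dest!: bij_mem simp: bij_def surj_f_inv_f)

lemma inv_stab: "f \<in> stab A \<Longrightarrow> inv f \<in> stab A"
  by (auto simp: stab_def inv_mem) (metis inv_cancel(1))

lemma inj_mem: "g \<in> G \<Longrightarrow> g x = g y \<longleftrightarrow> x = y"
  by (metis inv_cancel(1))

lemma conj_over_refl: "conj_over A xs xs"
  unfolding conj_over_def using id_stab by force

lemma conj_over_sym: "conj_over A xs ys \<Longrightarrow> conj_over A ys xs"
  unfolding conj_over_def
proof (elim bexE)
  fix g assume g: "g \<in> stab A" "map g xs = ys"
  have "map (inv g) ys = xs"
    using g(1) by (auto simp: g(2)[symmetric] inv_cancel stab_G intro!: map_idI)
  then show "\<exists>g\<in>stab A. map g ys = xs" using inv_stab[OF g(1)] by blast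
qed

lemma conj_over_trans: "conj_over A xs ys \<Longrightarrow> conj_over A ys zs \<Longrightarrow> conj_over A xs zs"
  unfolding conj_over_def by (metis comp_stab map_map)

lemma conj_over_map: "g \<in> stab A \<Longrightarrow> conj_over A xs (map g xs)"
  unfolding conj_over_def by auto

lemma conj_over_append_fixed:
  assumes "conj_over {} (as @ xs) (as @ ys)"
  shows "conj_over (set as) xs ys"
proof -
  obtain g where "g \<in> G" "map g as = as" "map g xs = ys"
    using assms by (auto simp: conj_over_def)
  then have "g \<in> stab (set as)" by (auto simp: stab_def map_idI) (metis map_eq_conv map_ident)
  then show ?thesis using \<open>map g xs = ys\<close> by (auto simp: conj_over_def)
qed

lemma map_tuples: "g \<in> G \<Longrightarrow> xs \<in> tuples X n \<Longrightarrow> map g xs \<in> tuples X n"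
  by (auto simp: tuples_def closed_mem)

lemma orbI: "g \<in> stab A \<Longrightarrow> g x \<in> orb A x"
  unfolding orb_def by (rule imageI)

lemma orb_refl: "x \<in> orb A x"
  using orbI[OF id_stab] by simp

lemma orb_image: "g \<in> G \<Longrightarrow> orb (g ` A) (g x) = g ` orb A x"
proof -
  have *: "orb (g ` A) (g x) \<subseteq> g ` orb A x" if g: "g \<in> G" for g A x
  proof
    fix y assume "y \<in> orb (g ` A) (g x)"
    then obtain h where h: "h \<in> stab (g ` A)" "y = h (g x)" by (auto simp: orb_def)
    let ?k = "inv g \<circ> h \<circ> g"
    have "?k \<in> stab A"
      using h g by (auto simp: stab_def comp_mem inv_mem inv_cancel)
    moreover have "y = g (?k x)" using h g by (simp add: inv_cancel)
    ultimately show "y \<in> g ` orb A x" using orbI by (metis imageI)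
  qed
  assume g: "g \<in> G"
  have "g ` orb A x \<subseteq> orb (g ` A) (g x)"
  proof -
    have "inv g ` g ` A = A" "inv g (g x) = x" using g by (auto simp: inv_cancel image_image)
    then have "orb A x \<subseteq> inv g ` orb (g ` A) (g x)"
      using *[OF inv_mem[OF g], of "g ` A" "g x"] by simp
    then show ?thesis using g by (force simp: inv_cancel)
  qed
  with *[OF g] show ?thesis by blast
qed

lemma acl_image_mem: "g \<in> G \<Longrightarrow> x \<in> acl A \<Longrightarrow> g x \<in> acl (g ` A)"
  by (auto simp: acl_def orb_image closed_mem)

lemma acl_image: "g \<in> G \<Longrightarrow> acl (g ` A) = g ` acl A"
proof -
  assume g: "g \<in> G"
  have "x \<in> g ` acl A" if "x \<in> acl (g ` A)" for x
  proof -
    have "inv g x \<in> acl (inv g ` g ` A)" using that g inv_mem acl_image_mem by blast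
    moreover have "inv g ` g ` A = A" using g by (auto simp: inv_cancel image_image)
    ultimately have "g (inv g x) \<in> g ` acl A" by (metis imageI)
    then show ?thesis using g by (simp add: inv_cancel)
  qed
  then show ?thesis using acl_image_mem[OF g] by blast
qed

lemma acl_subset: "acl A \<subseteq> X"
  by (auto simp: acl_def)

lemma subset_acl: "A \<subseteq> X \<Longrightarrow> A \<subseteq> acl A"
proof
  fix x assume "A \<subseteq> X" "x \<in> A"
  then have "orb A x \<subseteq> {x}" by (auto simp: orb_def stab_def)
  with \<open>A \<subseteq> X\<close> \<open>x \<in> A\<close> show "x \<in> acl A"
    by (auto simp: acl_def intro: finite_subset)
qed

lemma acl_mono: "A \<subseteq> B \<Longrightarrow> acl A \<subseteq> acl B"
proof -
  assume "A \<subseteq> B"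
  then have "orb B x \<subseteq> orb A x" for x unfolding orb_def by (intro image_mono stab_mono)
  then show ?thesis by (auto simp: acl_def intro: finite_subset)
qed

text \<open>A permutation fixing \<open>A\<close> induces one of finitely many permutations of the finite set
  \<open>acl A\<close>, so the stabiliser of \<open>acl A\<close> has finite index in that of \<open>A\<close>.\<close>

lemma acl_acl:
  assumes fin: "finite (acl A)" and A: "A \<subseteq> X"
  shows "acl (acl A) = acl A"
proof
  show "acl A \<subseteq> acl (acl A)" using subset_acl[OF acl_subset] .
next
  show "acl (acl A) \<subseteq> acl A"
  proof
    fix y assume y: "y \<in> acl (acl A)"
    define B where "B = acl A"
    define \<rho> where "\<rho> g = restrict g B" for g :: "'a \<Rightarrow> 'a"
    have inB: "g b \<in> B" if "g \<in> stab A" "b \<in> B" for g b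
      using that acl_image[of g A] stab_fix[of g A] unfolding B_def
      by (metis (no_types, lifting) image_cong image_eqI image_ident stab_G)
    have "\<rho> ` stab A \<subseteq> B \<rightarrow>\<^sub>E B" using inB by (auto simp: \<rho>_def)
    then have finr: "finite (\<rho> ` stab A)"
      by (rule finite_subset) (simp add: finite_PiE B_def fin)
    \<comment> \<open>One stabiliser element for each induced map on B; the orbit of y over A is
      covered by the corresponding translates of its orbit over B.\<close>
    define pick where "pick r = (SOME h. h \<in> stab A \<and> \<rho> h = r)" for r
    have pick: "pick (\<rho> g) \<in> stab A" "\<rho> (pick (\<rho> g)) = \<rho> g" if "g \<in> stab A" for g
      using someI[of "\<lambda>h. h \<in> stab A \<and> \<rho> h = \<rho> g" g] that unfolding pick_def by auto
    have "orb A y \<subseteq> (\<Union>r\<in>\<rho> ` stab A. pick r ` orb B y)"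
    proof
      fix z assume "z \<in> orb A y"
      then obtain g where g: "g \<in> stab A" "z = g y" by (auto simp: orb_def)
      define h where "h = pick (\<rho> g)"
      have h: "h \<in> stab A" "\<rho> h = \<rho> g" using pick[OF g(1)] by (auto simp: h_def)
      have eq: "h b = g b" if "b \<in> B" for b
        using h(2) that unfolding \<rho>_def by (metis restrict_apply')
      have "inv h \<circ> g \<in> stab B"
        using g h eq inv_cancel(1)[OF stab_G[OF h(1)]]
        by (auto simp: stab_def comp_mem inv_mem) (metis)
      then have "(inv h \<circ> g) y \<in> orb B y" unfolding orb_def by (rule imageI)
      moreover have "z = h ((inv h \<circ> g) y)" using g h by (simp add: inv_cancel stab_G)
      ultimately show "z \<in> (\<Union>r\<in>\<rho> ` stab A. pick r ` orb B y)"
        using g(1) h_def by blast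
    qed
    moreover have "finite (orb B y)" using y by (simp add: acl_def B_def)
    ultimately have "finite (orb A y)" using finr by (meson finite_UN_I finite_imageI finite_subset)
    then show "y \<in> acl A" using y by (simp add: acl_def)
  qed
qed

text \<open>Finite form of Neumann's lemma, by induction on D. The orbit of d is infinite and so has
  a point f0 outside F. For each f in F in that orbit fix a corrector \<open>t f\<close> moving f to
  f0. If g sends d into F, composing with the corrector of \<open>g d\<close> repairs this.\<close>

lemma neumann_separation:
  assumes "finite D" "finite F" "D \<subseteq> X" "D \<inter> acl A = {}"
  shows "\<exists>g\<in>stab A. g ` D \<inter> F = {}"
  using assms
proof (induction D arbitrary: F rule: finite_induct)
  case empty
  then show ?case using id_stab by auto
next
  case (insert d D)
  have "infinite (orb A d)" using insert.prems by (auto simp: acl_def)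
  then obtain f0 where f0: "f0 \<in> orb A d" "f0 \<notin> F"
    using insert.prems(1) by (meson finite_subset subsetI)
  define t where "t f = (SOME t. t \<in> stab A \<and> t f = f0)" for f
  have t: "t f \<in> stab A \<and> t f f = f0" if f: "f \<in> orb A d" for f
  proof -
    obtain g h where "g \<in> stab A" "f0 = g d" "h \<in> stab A" "f = h d" using f f0 by (auto simp: orb_def)
    then have "g \<circ> inv h \<in> stab A \<and> (g \<circ> inv h) f = f0"
      by (simp add: comp_stab inv_stab inv_cancel stab_G)
    then show ?thesis unfolding t_def by (rule someI[where P = "\<lambda>t. t \<in> stab A \<and> t f = f0"])
  qed
  \<comment> \<open>The induction hypothesis has to avoid also the preimages of F under all
    correctors, so that correcting d brings no other point back into F. Finitely many correctors
    suffice.\<close>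
  define F' where "F' = F \<union> (\<Union>f\<in>F \<inter> orb A d. inv (t f) ` F)"
  have "finite F'" using insert.prems(1) by (auto simp: F'_def)
  then obtain g where g: "g \<in> stab A" "g ` D \<inter> F' = {}"
    using insert.IH[of F'] insert.prems by auto
  show ?case
  proof (cases "g d \<in> F")
    case False
    then have "g ` insert d D \<inter> F = {}" using g by (auto simp: F'_def)
    then show ?thesis using g(1) by blast
  next
    case True
    have o: "g d \<in> orb A d" using g(1) by (auto simp: orb_def)
    define h where "h = t (g d) \<circ> g"
    have "h \<in> stab A" using t[OF o] g(1) by (simp add: h_def comp_stab)
    moreover have "h ` insert d D \<inter> F = {}"
    proof -
      have "h d \<notin> F" using t[OF o] f0 by (simp add: h_def)
      moreover have "h x \<notin> F" if x: "x \<in> D" for x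
      proof
        assume "h x \<in> F"
        then have "inv (t (g d)) (h x) \<in> F'" using True o by (auto simp: F'_def)
        then have "g x \<in> F'" using t[OF o] inv_cancel(1)[OF stab_G, of "t (g d)"] by (auto simp: h_def)
        then show False using g(2) x by blast
      qed
      ultimately show ?thesis by auto
    qed
    ultimately show ?thesis by blast
  qed
qed

end

lemma finite_image_by_cover:
  assumes "finite P" "\<And>x. x \<in> S \<Longrightarrow> \<exists>B\<in>P. Q x B"
    and "\<And>x y B. x \<in> S \<Longrightarrow> y \<in> S \<Longrightarrow> Q x B \<Longrightarrow> Q y B \<Longrightarrow> f x = f y"
  shows "finite (f ` S)"
proof (rule finite_subset)
  show "f ` S \<subseteq> (\<lambda>B. f (SOME x. x \<in> S \<and> Q x B)) ` P"
  proof clarify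
    fix x assume x: "x \<in> S"
    then obtain B where B: "B \<in> P" "Q x B" using assms(2) by blast
    have "(SOME x. x \<in> S \<and> Q x B) \<in> S \<and> Q (SOME x. x \<in> S \<and> Q x B) B"
      by (rule someI[where P = "\<lambda>x. x \<in> S \<and> Q x B"]) (use x B in blast)
    then have "f x = f (SOME x. x \<in> S \<and> Q x B)" using assms(3) x B by blast
    then show "f x \<in> (\<lambda>B. f (SOME x. x \<in> S \<and> Q x B)) ` P" using B(1) by blast
  qed
qed (use assms(1) in simp)

text \<open>The trace of mutual algebraicity on the group: up to finitely many patterns, a tuple \<open>c\<close>
  only sees a tuple \<open>d\<close> through a symmetric relation \<open>\<Lambda>\<close> of finite degree.\<close>

definition (in perm_group) separated ::
  "nat \<Rightarrow> nat \<Rightarrow> nat \<Rightarrow> 'a list set set \<Rightarrow> ('a \<Rightarrow> 'a \<Rightarrow> bool) \<Rightarrow> bool" where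
  "separated k m r P \<Lambda> \<longleftrightarrow> finite P \<and> tuples X (k + m) \<subseteq> \<Union>P \<and> (\<forall>a. finite {b. \<Lambda> a b}) \<and>
      (\<forall>a b. \<Lambda> a b \<longrightarrow> \<Lambda> b a) \<and>
      (\<forall>B\<in>P. \<forall>c\<in>tuples X k. \<forall>c'\<in>tuples X k. \<forall>e\<in>tuples X m. \<forall>d\<in>tuples X r.
         c @ e \<in> B \<longrightarrow> c' @ e \<in> B \<longrightarrow> (\<forall>a\<in>set c \<union> set c'. \<forall>b\<in>set d. \<not> \<Lambda> a b) \<longrightarrow>
         conj_over {} (d @ e @ c) (d @ e @ c'))"

lemma (in perm_group) separatedD:
  assumes "separated k m r P \<Lambda>"
  shows "finite P" "tuples X (k + m) \<subseteq> \<Union>P" "finite {b. \<Lambda> a b}" "\<Lambda> a b \<Longrightarrow> \<Lambda> b a"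
    "B \<in> P \<Longrightarrow> c \<in> tuples X k \<Longrightarrow> c' \<in> tuples X k \<Longrightarrow> e \<in> tuples X m \<Longrightarrow> d \<in> tuples X r \<Longrightarrow>
     c @ e \<in> B \<Longrightarrow> c' @ e \<in> B \<Longrightarrow> (\<And>a b. a \<in> set c \<union> set c' \<Longrightarrow> b \<in> set d \<Longrightarrow> \<not> \<Lambda> a b) \<Longrightarrow>
     conj_over {} (d @ e @ c) (d @ e @ c')"
proof -
  show "finite P" "tuples X (k + m) \<subseteq> \<Union>P" "finite {b. \<Lambda> a b}" "\<Lambda> a b \<Longrightarrow> \<Lambda> b a"
    using assms by (auto simp: separated_def)
  have *: "\<forall>B\<in>P. \<forall>c\<in>tuples X k. \<forall>c'\<in>tuples X k. \<forall>e\<in>tuples X m. \<forall>d\<in>tuples X r.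
         c @ e \<in> B \<longrightarrow> c' @ e \<in> B \<longrightarrow> (\<forall>a\<in>set c \<union> set c'. \<forall>b\<in>set d. \<not> \<Lambda> a b) \<longrightarrow>
         conj_over {} (d @ e @ c) (d @ e @ c')"
    using assms by (simp add: separated_def)
  show "B \<in> P \<Longrightarrow> c \<in> tuples X k \<Longrightarrow> c' \<in> tuples X k \<Longrightarrow> e \<in> tuples X m \<Longrightarrow> d \<in> tuples X r \<Longrightarrow>
     c @ e \<in> B \<Longrightarrow> c' @ e \<in> B \<Longrightarrow> (\<And>a b. a \<in> set c \<union> set c' \<Longrightarrow> b \<in> set d \<Longrightarrow> \<not> \<Lambda> a b) \<Longrightarrow>
     conj_over {} (d @ e @ c) (d @ e @ c')"
    by (rule *[rule_format])
qed

section \<open>Triviality of algebraic closure\<close>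

locale tame_group = perm_group +
  assumes finite_orbits: "\<exists>S. finite S \<and> (\<forall>xs\<in>tuples X n. \<exists>ys\<in>S. conj_over {} xs ys)"
    and separation: "\<exists>P \<Lambda>. separated k m r P \<Lambda>"
begin

lemma finite_orbits_over:
  assumes "finite A" "A \<subseteq> X"
  shows "\<exists>S. finite S \<and> (\<forall>xs\<in>tuples X n. \<exists>ys\<in>S. conj_over A xs ys)"
proof -
  obtain as where as: "set as = A" using assms(1) finite_list by blast
  obtain S where S: "finite S" "\<forall>xs\<in>tuples X (length as + n). \<exists>ys\<in>S. conj_over {} xs ys"
    using finite_orbits by blast
  define pick where "pick s = (SOME xs. conj_over {} (as @ xs) s)" for s
  have "\<exists>ys\<in>pick ` S. conj_over A xs ys" if xs: "xs \<in> tuples X n" for xs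
  proof -
    have "as @ xs \<in> tuples X (length as + n)" using xs as assms by (auto simp: tuples_def)
    then obtain s where s: "s \<in> S" "conj_over {} (as @ xs) s" using S by blast
    then have "conj_over {} (as @ pick s) s" unfolding pick_def by (rule_tac someI)
    then have "conj_over {} (as @ xs) (as @ pick s)"
      using s conj_over_sym conj_over_trans by blast
    then show ?thesis using conj_over_append_fixed as s(1) by blast
  qed
  then show ?thesis using S(1) by blast
qed

text \<open>There are finitely many orbits of points over A, and the closure of A is the union of
  the finite ones.\<close>

lemma finite_acl:
  assumes "finite A" "A \<subseteq> X"
  shows "finite (acl A)"
proof -
  obtain S where S: "finite S" "\<forall>xs\<in>tuples X 1. \<exists>ys\<in>S. conj_over A xs ys"
    using finite_orbits_over[OF assms] by blast
  have "finite (orb A ` acl A)"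
  proof (rule finite_image_by_cover[OF S(1), where Q = "\<lambda>x s. conj_over A [x] s"])
    show "\<exists>s\<in>S. conj_over A [x] s" if "x \<in> acl A" for x
      using that S(2) acl_subset[of A] by (auto simp: tuples_def)
  next
    fix x y s assume "conj_over A [x] s" "conj_over A [y] s"
    then have "conj_over A [x] [y]" using conj_over_sym conj_over_trans by blast
    then obtain g where g: "g \<in> stab A" "y = g x" by (auto simp: conj_over_def)
    have "orb (g ` A) (g x) = g ` orb A x" using g orb_image stab_G by blast
    moreover have "g ` A = A" using g(1) by (auto simp: stab_def image_iff)
    moreover have "g ` orb A x = orb A x"
    proof -
      have sub: "h ` orb A x \<subseteq> orb A x" if "h \<in> stab A" for h
        using comp_stab[OF that] unfolding orb_def by (auto simp: image_iff) (metis comp_apply)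
      have "orb A x \<subseteq> g ` orb A x"
      proof
        fix z assume "z \<in> orb A x"
        then have "inv g z \<in> orb A x" using sub[OF inv_stab[OF g(1)]] by blast
        then have "g (inv g z) \<in> g ` orb A x" by (rule imageI)
        then show "z \<in> g ` orb A x" using g stab_G inv_cancel(2) by metis
      qed
      with sub[OF g(1)] show ?thesis by blast
    qed
    ultimately show "orb A x = orb A y" using g(2) by metis
  qed
  moreover have "\<forall>B\<in>orb A ` acl A. finite B" by (auto simp: acl_def)
  ultimately have "finite (\<Union>(orb A ` acl A))" by auto
  then show ?thesis by (rule finite_subset[rotated]) (use orb_refl in blast)
qed

lemma acl_idem: "finite A \<Longrightarrow> A \<subseteq> X \<Longrightarrow> acl (acl A) = acl A"
  using acl_acl finite_acl by blast

text \<open>Suppose A misses \<open>acl {y}\<close>. After a conjugation, y lies only in infinite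
  pattern classes, and Neumann's lemma moves A, with y fixed, off the finitely many points linked to
  y. All but finitely many points in a class of y are then unlinked to A too, hence conjugate to y
  over A, so y has an infinite orbit over A.\<close>

lemma acl_trivial:
  assumes A: "finite A" "A \<subseteq> X" and y: "y \<in> acl A" "y \<notin> acl {}"
  shows "A \<inter> acl {y} \<noteq> {}"
proof
  assume disj: "A \<inter> acl {y} = {}"
  obtain xs where xs: "set xs = A" using A(1) finite_list by blast
  obtain P \<Lambda> where PL: "separated 1 0 (length xs) P \<Lambda>" using separation by blast
  note P = separatedD(1-3)[OF PL] and sym = separatedD(4)[OF PL]
  \<comment> \<open>The orbit of y is infinite and the union of the finite pattern classes is
    finite, so some conjugate of y lies outside them.\<close>
  define Fin where "Fin = (\<Union>B\<in>{B\<in>P. finite {x\<in>X. [x] \<in> B}}. {x\<in>X. [x] \<in> B})"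
  have "finite Fin" using P(1) by (auto simp: Fin_def)
  moreover have yX: "y \<in> X" using y acl_subset by blast
  then have "infinite (orb {} y)" using y by (auto simp: acl_def)
  ultimately obtain z where "z \<in> orb {} y" "z \<notin> Fin" by (meson finite_subset subsetI)
  then obtain g where g: "g \<in> G" "g y \<notin> Fin" by (auto simp: orb_def)
  have gy: "g y \<in> X" using yX g closed_mem by blast
  have A1: "g ` A \<subseteq> X" using A(2) g closed_mem by blast
  have disj1: "g ` A \<inter> acl {g y} = {}"
    using acl_image[OF g(1), of "{y}"] disj inj_mem[OF g(1)] by auto
  obtain h where h: "h \<in> stab {g y}" "h ` g ` A \<inter> {b. \<Lambda> (g y) b} = {}"
    using neumann_separation[OF _ P(3) A1 disj1] A(1) by blast
  let ?k = "h \<circ> g" and ?y = "g y"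
  have k: "?k \<in> G" "?k y = ?y" using h g by (auto simp: stab_def comp_mem)
  let ?A = "?k ` A" let ?xs = "map ?k xs"
  have yA: "?y \<in> acl ?A" using acl_image_mem[OF k(1) y(1)] k(2) by simp
  obtain B where B: "B \<in> P" "[?y] \<in> B"
    using subsetD[OF P(2), of "[?y]"] gy by (auto simp: tuples_def)
  have "infinite {x\<in>X. [x] \<in> B}" using g(2) B gy by (auto simp: Fin_def)
  moreover have "finite (\<Union>a\<in>?A. {b. \<Lambda> a b})" using A(1) P(3) by auto
  ultimately have inf: "infinite ({x\<in>X. [x] \<in> B} - (\<Union>a\<in>?A. {b. \<Lambda> a b}))" by (rule Diff_infinite_finite[rotated])
  have "{x\<in>X. [x] \<in> B} - (\<Union>a\<in>?A. {b. \<Lambda> a b}) \<subseteq> orb ?A ?y"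
  proof
    fix y' assume y': "y' \<in> {x\<in>X. [x] \<in> B} - (\<Union>a\<in>?A. {b. \<Lambda> a b})"
    have "conj_over {} (?xs @ [] @ [?y]) (?xs @ [] @ [y'])"
    proof (rule separatedD(5)[OF PL B(1)])
      show "?xs \<in> tuples X (length xs)" using A xs by (intro map_tuples k) (auto simp: tuples_def)
      show "\<not> \<Lambda> a b" if "a \<in> set [?y] \<union> set [y']" "b \<in> set ?xs" for a b
        using that h(2) y' sym xs by auto
    qed (use gy y' B in \<open>auto simp: tuples_def\<close>)
    then have "conj_over (set ?xs) [?y] [y']" using conj_over_append_fixed[of ?xs] by auto
    then have "conj_over ?A [?y] [y']" using xs by simp
    then obtain j where "j \<in> stab ?A" "y' = j ?y" by (auto simp: conj_over_def)
    then show "y' \<in> orb ?A ?y" using orbI by blast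
  qed
  with inf have "infinite (orb ?A ?y)" using infinite_super by blast
  with yA show False by (simp add: acl_def)
qed

section \<open>Cells and their colours\<close>

definition cell :: "'a \<Rightarrow> 'a set" where
  "cell x = acl {x} - acl {}"

lemma finite_cell: "x \<in> X \<Longrightarrow> finite (cell x)"
  using finite_acl[of "{x}"] by (simp add: cell_def)

lemma cell_subset: "cell x \<subseteq> X - acl {}"
  using acl_subset by (auto simp: cell_def)

lemma cell_refl: "x \<in> X - acl {} \<Longrightarrow> x \<in> cell x"
  using subset_acl[of "{x}"] by (auto simp: cell_def)

text \<open>Triviality for a singleton is an exchange property. With idempotence of the closure it
  makes the cells a partition of \<open>X - acl {}\<close>.\<close>

lemma cell_sym: "x \<in> X - acl {} \<Longrightarrow> y \<in> cell x \<Longrightarrow> x \<in> cell y"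
  using acl_trivial[of "{x}" y] by (auto simp: cell_def)

lemma cell_mono:
  assumes "x \<in> X" "y \<in> cell x"
  shows "cell y \<subseteq> cell x"
proof -
  have "acl {y} \<subseteq> acl (acl {x})" using assms by (intro acl_mono) (auto simp: cell_def)
  then show ?thesis using acl_idem[of "{x}"] assms by (auto simp: cell_def)
qed

lemma cell_eq: "x \<in> X - acl {} \<Longrightarrow> y \<in> cell x \<Longrightarrow> cell y = cell x"
  using cell_mono[of x y] cell_mono[of y x] cell_sym[of x y] cell_subset[of x] by blast

lemma acl_empty_image: "g \<in> G \<Longrightarrow> g ` acl {} = acl {}"
  using acl_image[of g "{}"] by simp

lemma cell_image: "g \<in> G \<Longrightarrow> cell (g x) = g ` cell x"
  using acl_image[of g "{x}"] acl_empty_image[of g]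
  by (simp add: cell_def image_set_diff bij_is_inj bij_mem)

text \<open>Having the same type over generic r-tuples. The exception set absorbs the tuples d that
  are linked to c or c', and finite unions of exception sets give transitivity.\<close>

definition sim :: "nat \<Rightarrow> 'a list \<Rightarrow> 'a list \<Rightarrow> bool" where
  "sim r c c' \<longleftrightarrow> (\<exists>F. finite F \<and>
     (\<forall>d\<in>tuples X r. set d \<inter> F = {} \<longrightarrow> conj_over (acl {}) (d @ c) (d @ c')))"

lemma sim_refl: "sim r c c"
  unfolding sim_def using conj_over_refl by blast

lemma sim_sym: "sim r c c' \<Longrightarrow> sim r c' c"
  unfolding sim_def by (meson conj_over_sym)

lemma sim_trans:
  assumes "sim r a b" "sim r b c" shows "sim r a c"
proof -
  obtain F where F: "finite F" "\<forall>d\<in>tuples X r. set d \<inter> F = {} \<longrightarrow> conj_over (acl {}) (d @ a) (d @ b)"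
    using assms unfolding sim_def by blast
  obtain F' where F': "finite F'" "\<forall>d\<in>tuples X r. set d \<inter> F' = {} \<longrightarrow> conj_over (acl {}) (d @ b) (d @ c)"
    using assms unfolding sim_def by blast
  have "\<forall>d\<in>tuples X r. set d \<inter> (F \<union> F') = {} \<longrightarrow> conj_over (acl {}) (d @ a) (d @ c)"
    using F(2) F'(2) conj_over_trans by (simp add: Int_Un_distrib) blast
  then show ?thesis using F(1) F'(1) unfolding sim_def by blast
qed

lemma sim_cong: "sim r c c' \<Longrightarrow> sim r c x \<longleftrightarrow> sim r c' x"
  using sim_trans[of r c c' x] sim_trans[of r c' c x] sim_sym[of r c c'] by metis

lemma sim_map:
  assumes g: "g \<in> stab (acl {})" and "sim r c c'"
  shows "sim r (map g c) (map g c')"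
proof -
  obtain F where F: "finite F" "\<forall>d\<in>tuples X r. set d \<inter> F = {} \<longrightarrow> conj_over (acl {}) (d @ c) (d @ c')"
    using assms unfolding sim_def by blast
  have "conj_over (acl {}) (d @ map g c) (d @ map g c')"
    if d: "d \<in> tuples X r" "set d \<inter> g ` F = {}" for d
  proof -
    let ?d = "map (inv g) d"
    have G: "g \<in> G" using g stab_G by blast
    have dd: "map g ?d = d" using G by (auto simp: inv_cancel intro!: map_idI)
    have "?d \<in> tuples X r" using d(1) G by (intro map_tuples inv_mem)
    moreover have "set ?d \<inter> F = {}" using d(2) G
      by (auto simp: inv_cancel) (metis G IntI empty_iff image_eqI inv_cancel(2))
    ultimately have "conj_over (acl {}) (?d @ c) (?d @ c')" using F by blast
    then have "conj_over (acl {}) (map g (?d @ c)) (map g (?d @ c'))"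
      using conj_over_map[OF g] conj_over_sym conj_over_trans by blast
    then show ?thesis using dd by simp
  qed
  then show ?thesis unfolding sim_def using F(1) by blast
qed

lemma finite_empty_acl: "finite (acl {})"
  using finite_acl[of "{}"] by simp

text \<open>The relation \<open>sim r\<close> between \<open>k\<close>-tuples is determined by the orbits of \<open>2k\<close>-tuples.\<close>

definition sim_rel :: "nat \<Rightarrow> nat \<Rightarrow> ('a list \<times> 'a list) set" where
  "sim_rel k r = {(c, c'). c \<in> tuples X k \<and> c' \<in> tuples X k \<and> sim r c c'}"

text \<open>This bound is uniform in r, so a colour, which involves all r at once, is decided by
  finitely many relations.\<close>

lemma finite_sim_rels: "finite (range (sim_rel k))"
proof -
  obtain S where S: "finite S" "\<forall>xs\<in>tuples X (k + k). \<exists>ys\<in>S. conj_over (acl {}) xs ys"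
    using finite_orbits_over[OF finite_empty_acl acl_subset] by blast
  define T where "T r = {s \<in> S. \<exists>(c, c')\<in>sim_rel k r. conj_over (acl {}) (c @ c') s}" for r
  have inv: "(c, c') \<in> sim_rel k r"
    if c: "c \<in> tuples X k" "c' \<in> tuples X k" and ab: "(a, b) \<in> sim_rel k r"
      and cv: "conj_over (acl {}) (a @ b) (c @ c')" for a b c c' r
  proof -
    obtain g where g: "g \<in> stab (acl {})" "map g a @ map g b = c @ c'"
      using cv by (auto simp: conj_over_def)
    have "map g a = c" "map g b = c'" using g(2) c ab by (auto simp: sim_rel_def tuples_def)
    then show ?thesis using sim_map[OF g(1)] c ab by (auto simp: sim_rel_def)
  qed
  have "sim_rel k r = {(c, c'). c \<in> tuples X k \<and> c' \<in> tuples X k \<and> (\<exists>s\<in>T r. conj_over (acl {}) (c @ c') s)}"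
    (is "_ = ?R r") for r
  proof (intro equalityI subrelI)
    fix c c' assume *: "(c, c') \<in> sim_rel k r"
    then have "c @ c' \<in> tuples X (k + k)" by (auto simp: sim_rel_def tuples_def)
    then obtain s where "s \<in> S" "conj_over (acl {}) (c @ c') s" using S by blast
    with * have "s \<in> T r" by (auto simp: T_def)
    with * \<open>conj_over _ _ s\<close> show "(c, c') \<in> ?R r" by (auto simp: sim_rel_def)
  next
    fix c c' assume *: "(c, c') \<in> ?R r"
    then obtain s where s: "s \<in> T r" "conj_over (acl {}) (c @ c') s" by blast
    then obtain a b where ab: "(a, b) \<in> sim_rel k r" "conj_over (acl {}) (a @ b) s" by (auto simp: T_def)
    have "conj_over (acl {}) (a @ b) (c @ c')" using ab s conj_over_sym conj_over_trans by blast
    then show "(c, c') \<in> sim_rel k r" using inv[OF _ _ ab(1)] * by blast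
  qed
  then have "sim_rel k r \<in>
      (\<lambda>T. {(c, c'). c \<in> tuples X k \<and> c' \<in> tuples X k \<and> (\<exists>s\<in>T. conj_over (acl {}) (c @ c') s)}) ` Pow S" for r
    by (rule image_eqI) (simp add: T_def)
  then have "range (sim_rel k) \<subseteq>
      (\<lambda>T. {(c, c'). c \<in> tuples X k \<and> c' \<in> tuples X k \<and> (\<exists>s\<in>T. conj_over (acl {}) (c @ c') s)}) ` Pow S"
    by blast
  then show ?thesis using S(1) by (meson finite_Pow_iff finite_imageI finite_subset)
qed

text \<open>With an enumeration of \<open>acl {}\<close> as parameter, separation makes tuples of
  the same pattern conjugate over \<open>acl {}\<close> for every d off the finitely many points
  linked to either tuple.\<close>

lemma finite_sim_classes: "finite ((\<lambda>c. sim_rel k r `` {c}) ` tuples X k)"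
proof -
  obtain zs where zs: "set zs = acl {}" using finite_empty_acl finite_list by blast
  obtain P \<Lambda> where P: "separated k (length zs) r P \<Lambda>" using separation by blast
  have sep: "sim r c c'"
    if c: "c \<in> tuples X k" "c' \<in> tuples X k" and B: "c @ zs \<in> B" "c' @ zs \<in> B" "B \<in> P" for c c' B
  proof -
    define F where "F = (\<Union>a\<in>set c \<union> set c'. {b. \<Lambda> a b})"
    have "finite F" using separatedD(3)[OF P] by (auto simp: F_def)
    moreover have "conj_over (acl {}) (d @ c) (d @ c')"
      if d: "d \<in> tuples X r" "set d \<inter> F = {}" for d
    proof -
      have "conj_over {} (d @ zs @ c) (d @ zs @ c')"
        by (rule separatedD(5)[OF P B(3) c _ d(1) B(1,2)])
          (use d(2) zs acl_subset[of "{}"] in \<open>auto simp: tuples_def F_def\<close>)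
      then obtain g where g: "g \<in> G" "map g d = d" "map g zs = zs" "map g c = c'"
        by (auto simp: conj_over_def)
      have "g \<in> stab (acl {})" using g(1,3) zs by (auto simp: stab_def) (metis map_eq_conv map_ident)
      then show ?thesis using g(2,4) by (auto simp: conj_over_def)
    qed
    ultimately show ?thesis unfolding sim_def by blast
  qed
  show ?thesis
  proof (rule finite_image_by_cover[OF separatedD(1)[OF P], where Q = "\<lambda>c B. c @ zs \<in> B \<and> B \<in> P"])
    show "\<exists>B\<in>P. c @ zs \<in> B \<and> B \<in> P" if "c \<in> tuples X k" for c
    proof -
      have "c @ zs \<in> tuples X (k + length zs)" using that zs acl_subset[of "{}"] by (auto simp: tuples_def)
      then show ?thesis using separatedD(2)[OF P] by blast
    qed
  next
    fix c c' B assume "c \<in> tuples X k" "c' \<in> tuples X k" "c @ zs \<in> B \<and> B \<in> P" "c' @ zs \<in> B \<and> B \<in> P"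
    then have "sim r c c'" using sep by blast
    then show "sim_rel k r `` {c} = sim_rel k r `` {c'}"
      using \<open>c \<in> tuples X k\<close> \<open>c' \<in> tuples X k\<close> sim_cong by (auto simp: sim_rel_def)
  qed
qed

definition colour :: "'a list \<Rightarrow> 'a list set" where
  "colour c = {c' \<in> tuples X (length c). \<forall>r. sim r c c'}"

lemma colour_eq_iff:
  assumes "set c \<subseteq> X" "set c' \<subseteq> X"
  shows "colour c = colour c' \<longleftrightarrow> length c = length c' \<and> (\<forall>r. sim r c c')"
proof
  assume "colour c = colour c'"
  moreover have "c' \<in> colour c'" using assms sim_refl by (auto simp: colour_def tuples_def)
  ultimately have "c' \<in> colour c" by simp
  then show "length c = length c' \<and> (\<forall>r. sim r c c')" by (auto simp: colour_def tuples_def)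
next
  assume *: "length c = length c' \<and> (\<forall>r. sim r c c')"
  have "sim r c x \<longleftrightarrow> sim r c' x" for r x by (rule sim_cong) (use * in simp)
  then show "colour c = colour c'" using * unfolding colour_def by simp
qed

lemma finite_colours: "finite (colour ` tuples X k)"
proof -
  define R where "R = range (sim_rel k)"
  define pat where "pat c = (\<lambda>\<rho>. (\<rho>, \<rho> `` {c})) ` R" for c
  have "finite R" unfolding R_def by (rule finite_sim_rels)
  have "pat ` tuples X k \<subseteq> Pow (SIGMA \<rho>:R. (\<lambda>c. \<rho> `` {c}) ` tuples X k)"
    by (auto simp: pat_def)
  moreover have "finite (SIGMA \<rho>:R. (\<lambda>c. \<rho> `` {c}) ` tuples X k)"
    using \<open>finite R\<close> finite_sim_classes by (auto simp: R_def)
  ultimately have fin: "finite (pat ` tuples X k)" by (meson finite_Pow_iff finite_subset)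
  show ?thesis
  proof (rule finite_image_by_cover[OF fin, where Q = "\<lambda>c p. pat c = p"])
    fix c c' p assume c: "c \<in> tuples X k" "c' \<in> tuples X k" and p: "pat c = p" "pat c' = p"
    have "sim r c c'" for r
    proof -
      have "(sim_rel k r, sim_rel k r `` {c'}) \<in> pat c'" unfolding pat_def R_def by (rule image_eqI) auto
      then have "(sim_rel k r, sim_rel k r `` {c'}) \<in> pat c" using p by (simp only:)
      then have "sim_rel k r `` {c'} = sim_rel k r `` {c}" by (auto simp: pat_def)
      moreover have "(c', c') \<in> sim_rel k r" using c sim_refl by (auto simp: sim_rel_def)
      ultimately show ?thesis by (auto simp: sim_rel_def)
    qed
    then show "colour c = colour c'" using c by (subst colour_eq_iff) (auto simp: tuples_def)
  qed auto
qed

text \<open>Only equality of colours is carried along, since g c and c need not have the same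
  colour.\<close>

lemma colour_map:
  assumes g: "g \<in> stab (acl {})" and c: "set c \<subseteq> X" "set c' \<subseteq> X" and "colour c = colour c'"
  shows "colour (map g c) = colour (map g c')"
proof -
  have "set (map g c) \<subseteq> X" "set (map g c') \<subseteq> X" using c closed_mem[OF stab_G[OF g]] by auto
  then show ?thesis using assms sim_map[OF g] by (simp add: colour_eq_iff)
qed

text \<open>Stationarity: by triviality, the tuple \<open>d\<close> can be moved away from any finite set without
  moving \<open>c\<close> and \<open>c'\<close>.\<close>

lemma colour_stationary:
  assumes c: "set c \<subseteq> X - acl {}" "set c' \<subseteq> X - acl {}" "colour c = colour c'"
    and d: "set d \<subseteq> X - acl {}" "\<And>x y. x \<in> set c \<union> set c' \<Longrightarrow> y \<in> set d \<Longrightarrow> y \<notin> cell x"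
  shows "conj_over (acl {}) (d @ c) (d @ c')"
proof -
  let ?A = "acl {} \<union> (set c \<union> set c')"
  have "sim (length d) c c'" using c by (subst (asm) colour_eq_iff) auto
  then obtain F where F: "finite F"
    "\<forall>d'\<in>tuples X (length d). set d' \<inter> F = {} \<longrightarrow> conj_over (acl {}) (d' @ c) (d' @ c')"
    unfolding sim_def by blast
  have AX: "set c \<union> set c' \<subseteq> X" using c by blast
  have "acl ?A \<subseteq> acl (acl (set c \<union> set c'))"
    using acl_mono[of "{}" "set c \<union> set c'"] subset_acl[OF AX] by (intro acl_mono) auto
  then have acl: "acl ?A \<subseteq> acl (set c \<union> set c')" using acl_idem[OF _ AX] by simp
  \<comment> \<open>By triviality, a point of d algebraic over the entries of c and c' would lie in
    the cell of one of them, which is excluded.\<close>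
  have "set d \<inter> acl ?A = {}"
  proof (rule ccontr)
    assume "set d \<inter> acl ?A \<noteq> {}"
    then obtain y where y: "y \<in> set d" "y \<in> acl (set c \<union> set c')" using acl by blast
    then have "(set c \<union> set c') \<inter> acl {y} \<noteq> {}" using acl_trivial[OF _ AX] d(1) by blast
    then obtain x where x: "x \<in> set c \<union> set c'" "x \<in> acl {y}" by blast
    then have "x \<in> cell y" using c by (auto simp: cell_def)
    then have "y \<in> cell x" using cell_sym d(1) y(1) by blast
    then show False using d(2) x(1) y(1) by blast
  qed
  then obtain g where g: "g \<in> stab ?A" "g ` set d \<inter> F = {}"
    using neumann_separation[of "set d" F ?A] F(1) d(1) by blast
  have gZ: "g \<in> stab (acl {})" using g(1) stab_mono[of "acl {}" ?A] by blast
  have gc: "map g c = c" "map g c' = c'" using g(1) by (auto simp: stab_def intro!: map_idI)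
  have "conj_over (acl {}) (map g d @ c) (map g d @ c')"
    using F(2)[rule_format, of "map g d"] g(2) map_tuples[OF stab_G[OF g(1)], of d "length d"] d(1)
    by (auto simp: tuples_def)
  then have "conj_over (acl {}) (map g (d @ c)) (map g (d @ c'))" using gc by simp
  then show ?thesis using conj_over_map[OF gZ] conj_over_sym conj_over_trans by blast
qed

text \<open>All orders of a cell are kept: colours belong to enumerations, and two orders of one
  cell may differ in colour.\<close>

definition cell_enums :: "'a list set" where
  "cell_enums = {c. distinct c \<and> (\<exists>x\<in>X - acl {}. set c = cell x)}"

lemma cell_enum_subset: "c \<in> cell_enums \<Longrightarrow> set c \<subseteq> X - acl {}"
  using cell_subset by (auto simp: cell_enums_def)

lemma cell_enum_eq: "c \<in> cell_enums \<Longrightarrow> x \<in> set c \<Longrightarrow> set c = cell x"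
  using cell_eq by (auto simp: cell_enums_def)

lemma cell_enum_map:
  assumes "g \<in> G" "c \<in> cell_enums"
  shows "map g c \<in> cell_enums"
proof -
  obtain x where x: "x \<in> X - acl {}" "set c = cell x" "distinct c"
    using assms(2) by (auto simp: cell_enums_def)
  have "g x \<notin> acl {}"
    using x(1) acl_empty_image[OF assms(1)] inj_mem[OF assms(1)] by (metis DiffD2 imageE)
  then have "g x \<in> X - acl {}" using x(1) closed_mem assms(1) by blast
  moreover have "distinct (map g c)" using x(3) inj_mem[OF assms(1)] by (auto simp: distinct_map inj_on_def)
  moreover have "set (map g c) = cell (g x)" using cell_image[OF assms(1)] x(2) by simp
  ultimately show ?thesis by (auto simp: cell_enums_def)
qed

text \<open>Conjugate points have cells of equal size, and there are finitely many orbits of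
  points.\<close>

lemma cell_card_bound: "\<exists>N. \<forall>x\<in>X. card (cell x) \<le> N"
proof -
  obtain S where S: "finite S" "\<forall>xs\<in>tuples X 1. \<exists>ys\<in>S. conj_over {} xs ys"
    using finite_orbits by blast
  have "finite ((\<lambda>x. card (cell x)) ` X)"
  proof (rule finite_image_by_cover[OF S(1), where Q = "\<lambda>x s. conj_over {} [x] s"])
    show "\<exists>s\<in>S. conj_over {} [x] s" if "x \<in> X" for x using that S(2) by (auto simp: tuples_def)
  next
    fix x y s assume "conj_over {} [x] s" "conj_over {} [y] s"
    then have "conj_over {} [x] [y]" using conj_over_sym conj_over_trans by blast
    then obtain g where "g \<in> G" "y = g x" by (auto simp: conj_over_def)
    then show "card (cell x) = card (cell y)"
      by (simp add: cell_image) (metis bij_is_inj bij_mem card_image inj_on_subset subset_UNIV)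
  qed
  then show ?thesis by (auto intro!: exI[of _ "Max ((\<lambda>x. card (cell x)) ` X)"])
qed

lemma finite_cell_colours: "finite (colour ` cell_enums)"
proof -
  obtain N where N: "\<forall>x\<in>X. card (cell x) \<le> N" using cell_card_bound by blast
  have "cell_enums \<subseteq> (\<Union>k\<le>N. tuples X k)"
  proof
    fix c assume c: "c \<in> cell_enums"
    then have "length c \<le> N" using N by (auto simp: cell_enums_def distinct_card[symmetric])
    then show "c \<in> (\<Union>k\<le>N. tuples X k)" using cell_enum_subset[OF c] by (auto simp: tuples_def)
  qed
  then have "colour ` cell_enums \<subseteq> (\<Union>k\<le>N. colour ` tuples X k)" by blast
  then show ?thesis by (rule finite_subset) (use finite_colours in simp)
qed

lemma colour_representatives:
  "\<exists>S. finite S \<and> S \<subseteq> cell_enums \<and> (\<forall>c\<in>cell_enums. \<exists>s\<in>S. colour c = colour s)"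
  using finite_subset_image[OF finite_cell_colours order_refl] by (metis image_iff)

text \<open>Naming one cell of each colour turns the colours into invariants of the stabiliser of \<open>K\<close>.\<close>

theorem cell_decomposition:
  "\<exists>K C (col :: 'a list \<Rightarrow> 'a list set). finite K \<and> K \<subseteq> X \<and> finite (col ` C) \<and>
     (\<forall>c\<in>C. distinct c \<and> c \<noteq> [] \<and> set c \<subseteq> X - K) \<and>
     (\<forall>x\<in>X - K. \<exists>c\<in>C. x \<in> set c) \<and>
     (\<forall>c\<in>C. \<forall>c'\<in>C. set c = set c' \<or> set c \<inter> set c' = {}) \<and>
     (\<forall>c\<in>C. \<forall>c'\<in>C. col c = col c' \<longrightarrow> length c = length c') \<and>
     (\<forall>g\<in>stab K. \<forall>c\<in>C. map g c \<in> C \<and> col (map g c) = col c) \<and>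
     (\<forall>cs cs'. set cs \<subseteq> C \<longrightarrow> set cs' \<subseteq> C \<longrightarrow> distinct (map set cs) \<longrightarrow> distinct (map set cs') \<longrightarrow>
        map col cs = map col cs' \<longrightarrow> (\<exists>g\<in>stab K. map (map g) cs = cs'))"
proof -
  obtain S where S: "finite S" "S \<subseteq> cell_enums" "\<forall>c\<in>cell_enums. \<exists>s\<in>S. colour c = colour s"
    using colour_representatives by blast
  define K where "K = acl {} \<union> (\<Union>s\<in>S. set s)"
  define C where "C = {c \<in> cell_enums. set c \<inter> K = {}}"
  have finK: "finite K" using S(1) finite_empty_acl by (simp add: K_def)
  have KX: "K \<subseteq> X" using S(2) cell_enum_subset acl_subset by (auto simp: K_def)
  have stabZ: "g \<in> stab (acl {})" if "g \<in> stab K" for g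
    using that stab_mono[of "acl {}" K] by (auto simp: K_def)
  have CX: "distinct c \<and> c \<noteq> [] \<and> set c \<subseteq> X - K" if "c \<in> C" for c
  proof -
    have c: "c \<in> cell_enums" "set c \<inter> K = {}" using that by (auto simp: C_def)
    obtain x where "x \<in> X - acl {}" "set c = cell x" "distinct c" using c(1) by (auto simp: cell_enums_def)
    then have "x \<in> set c" "distinct c" using cell_refl by blast+
    then have "c \<noteq> []" "distinct c" by auto
    then show ?thesis using c(2) cell_enum_subset[OF c(1)] by blast
  qed
  have Kclosed: "y \<in> K" if "x \<in> K - acl {}" "y \<in> cell x" for x y
    using that S(2) cell_enum_eq unfolding K_def by blast
  have cover: "\<exists>c\<in>C. x \<in> set c" if x: "x \<in> X - K" for x
  proof -
    have xZ: "x \<in> X - acl {}" using x by (auto simp: K_def)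
    obtain c where c: "set c = cell x" "distinct c" using finite_cell x finite_distinct_list by blast
    then have "c \<in> cell_enums" using xZ by (auto simp: cell_enums_def)
    moreover have "set c \<inter> K = {}"
    proof (rule ccontr)
      assume "set c \<inter> K \<noteq> {}"
      then obtain y where "y \<in> cell x" "y \<in> K" using c(1) by blast
      then have "y \<in> K - acl {}" "x \<in> cell y" using cell_sym[OF xZ] by (auto simp: cell_def)
      then show False using Kclosed x by blast
    qed
    ultimately show ?thesis using c(1) cell_refl[OF xZ] by (auto simp: C_def)
  qed
  have disj: "set c = set c' \<or> set c \<inter> set c' = {}" if "c \<in> C" "c' \<in> C" for c c'
    using that cell_enum_eq[of c] cell_enum_eq[of c'] by (auto simp only: C_def mem_Collect_eq)
  have len: "length c = length c'" if "c \<in> C" "c' \<in> C" "colour c = colour c'" for c c'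
    using that CX by (subst (asm) colour_eq_iff) blast+
  have inv: "map g c \<in> C \<and> colour (map g c) = colour c" if g: "g \<in> stab K" and c: "c \<in> C" for g c
  proof
    have "g x \<notin> K" if "x \<in> set c" for x
    proof
      assume "g x \<in> K"
      then have "g (g x) = g x" using stab_fix[OF g] by blast
      then have "g x = x" using inj_mem stab_G[OF g] by blast
      then show False using \<open>g x \<in> K\<close> CX[OF c] that by auto
    qed
    then show "map g c \<in> C" using cell_enum_map[OF stab_G[OF g]] c by (auto simp: C_def)
    obtain s where s: "s \<in> S" "colour c = colour s" using S(3) c by (auto simp: C_def)
    \<comment> \<open>The named cell s of the colour of c is fixed by g, which anchors the
      colour.\<close>
    have "colour (map g c) = colour (map g s)"
      by (rule colour_map[OF stabZ[OF g] _ _ s(2)]) (use CX[OF c] s(1) KX in \<open>auto simp: K_def\<close>)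
    moreover have "map g s = s" using s(1) stab_fix[OF g] by (auto simp: K_def intro!: map_idI)
    ultimately show "colour (map g c) = colour c" using s(2) by simp
  qed
  have amalg: "\<exists>g\<in>stab K. map (map g) cs = cs'"
    if "set cs \<subseteq> C" "set cs' \<subseteq> C" "distinct (map set cs)" "distinct (map set cs')"
      "map colour cs = map colour cs'" for cs cs'
    using that
  \<comment> \<open>Once g has placed the earlier cells, the image of c is moved to c' by an element
    that fixes K and all cells already placed.\<close>
  proof (induction cs arbitrary: cs')
    case Nil
    then show ?case using id_stab by auto
  next
    case (Cons c cs)
    then obtain c' ds where cs': "cs' = c' # ds" "colour c = colour c'" "map colour cs = map colour ds"
      by (cases cs') auto
    then obtain g where g: "g \<in> stab K" "map (map g) cs = ds"
      using Cons.IH[of ds] Cons.prems by auto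
    have gc: "map g c \<in> C" "colour (map g c) = colour c'"
      using inv[OF g(1), of c] Cons.prems cs' by auto
    have c': "c' \<in> C" using Cons.prems cs' by auto
    have gout: "set (map g c) \<inter> set d = {}" if "d \<in> set ds" for d
    proof (rule ccontr)
      assume ne: "set (map g c) \<inter> set d \<noteq> {}"
      have "d \<in> map g ` set cs" using that g(2) by (metis set_map)
      then obtain d0 where d0: "d0 \<in> set cs" "d = map g d0" by blast
      have "set (map g c) = set d" using disj[OF gc(1), of d] ne that Cons.prems cs' by auto
      then have "g ` set c = g ` set d0" using d0(2) by simp
      then have "set c = set d0" using bij_is_inj[OF bij_mem[OF stab_G[OF g(1)]]] by (simp add: inj_image_eq_iff)
      then show False using Cons.prems(3) d0(1) by auto
    qed
    have c'out: "set c' \<inter> set d = {}" if "d \<in> set ds" for d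
    proof -
      have "d \<in> C" "set c' \<notin> set ` set ds" using that Cons.prems cs' by auto
      then show ?thesis using disj[OF c', of d] that by blast
    qed
    \<comment> \<open>Stationarity works over \<open>acl {}\<close> and wants d outside it, so only
      the rest of K is listed in d, followed by the cells already placed.\<close>
    obtain ks where ks: "set ks = K - acl {}" using finK finite_list by blast
    have "conj_over (acl {}) ((ks @ concat ds) @ map g c) ((ks @ concat ds) @ c')"
    proof (rule colour_stationary)
      show "set (map g c) \<subseteq> X - acl {}" "set c' \<subseteq> X - acl {}"
        using CX[OF gc(1)] CX[OF c'] unfolding K_def by blast+
      have "set d \<subseteq> X - acl {}" if "d \<in> set ds" for d
      proof -
        have "d \<in> C" using that Cons.prems cs' by auto
        then show ?thesis using CX[of d] by (auto simp: K_def)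
      qed
      then show "set (ks @ concat ds) \<subseteq> X - acl {}" using ks KX by auto
      show "y \<notin> cell x" if x: "x \<in> set (map g c) \<union> set c'" and y: "y \<in> set (ks @ concat ds)" for x y
      proof
        assume yx: "y \<in> cell x"
        have "set (map g c) = cell x \<or> set c' = cell x"
          using x gc(1) c' cell_enum_eq by (auto simp: C_def)
        then have "y \<in> set (map g c) \<or> y \<in> set c'" using yx by blast
        moreover have "y \<notin> K" using calculation CX gc(1) c' by blast
        moreover have "y \<in> set ks \<or> (\<exists>d\<in>set ds. y \<in> set d)" using y by simp
        ultimately show False using ks gout c'out by blast
      qed
    qed (rule gc(2))
    then obtain h where h: "h \<in> stab (acl {})" "map h (ks @ concat ds) = ks @ concat ds" "map h (map g c) = c'"
      by (auto simp: conj_over_def)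
    have hfix: "h x = x" if "x \<in> set (ks @ concat ds)" for x
      using h(2) that by (metis map_eq_conv map_ident)
    have hK: "h \<in> stab K" using h(1) hfix ks by (auto simp: stab_def)
    have "map h d = d" if "d \<in> set ds" for d
      using that hfix by (auto intro!: map_idI)
    then have "map (map h) ds = ds" by (rule map_idI)
    then have "map (map (h \<circ> g)) (c # cs) = cs'" using g(2) h(3) cs'(1) by auto
    then show ?case by (rule bexI[OF _ comp_stab[OF hK g(1)]])
  qed
  have "finite (colour ` C)"
    by (rule finite_subset[OF _ finite_cell_colours]) (auto simp: C_def)
  moreover have "\<forall>c\<in>C. distinct c \<and> c \<noteq> [] \<and> set c \<subseteq> X - K" using CX by (rule ballI)
  moreover have "\<forall>x\<in>X - K. \<exists>c\<in>C. x \<in> set c" using cover by (rule ballI)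
  moreover have "\<forall>c\<in>C. \<forall>c'\<in>C. set c = set c' \<or> set c \<inter> set c' = {}"
    using disj by (intro ballI)
  moreover have "\<forall>c\<in>C. \<forall>c'\<in>C. colour c = colour c' \<longrightarrow> length c = length c'"
    using len by (intro ballI impI)
  moreover have "\<forall>g\<in>stab K. \<forall>c\<in>C. map g c \<in> C \<and> colour (map g c) = colour c"
    using inv by (intro ballI)
  moreover have "\<forall>cs cs'. set cs \<subseteq> C \<longrightarrow> set cs' \<subseteq> C \<longrightarrow> distinct (map set cs) \<longrightarrow> distinct (map set cs') \<longrightarrow>
        map colour cs = map colour cs' \<longrightarrow> (\<exists>g\<in>stab K. map (map g) cs = cs')"
    using amalg by (intro allI impI)
  ultimately show ?thesis using finK KX
    by (intro exI[of _ K] exI[of _ C] exI[of _ colour] conjI)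
qed

end

section \<open>Orbits and separation in the automorphism group\<close>

text \<open>Fixing every point outside the universe makes automorphisms permutations of the whole
  type, so that \<open>inv\<close> and composition are the group operations.\<close>

definition aut :: "('r, 'c) lang \<Rightarrow> ('r, 'c, 'a) fostruct \<Rightarrow> ('a \<Rightarrow> 'a) set" where
  "aut L M = {f. is_aut L M f \<and> (\<forall>x. x \<notin> univ M \<longrightarrow> f x = x)}"

lemma aut_bij_betw: "f \<in> aut L M \<Longrightarrow> bij_betw f (univ M) (univ M)"
  by (simp add: aut_def is_aut_def is_iso_def)

lemma autI:
  assumes f: "is_aut L M f"
  shows "(\<lambda>x. if x \<in> univ M then f x else x) \<in> aut L M" (is "?g \<in> _")
proof -
  have "is_aut L M ?g"
    unfolding is_aut_def is_iso_def
  proof (intro conjI ballI)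
    have b: "bij_betw f (univ M) (univ M)" using f by (simp add: is_aut_def is_iso_def)
    show "bij_betw ?g (univ M) (univ M)" by (subst bij_betw_cong[of _ _ f]) (simp_all add: b)
  next
    fix r xs assume r: "r \<in> Rels L" "xs \<in> tuples (univ M) (arity L r)"
    then have "map ?g xs = map f xs" by (auto simp: tuples_def)
    then show "xs \<in> rel M r \<longleftrightarrow> map ?g xs \<in> rel M r"
      using f r by (simp only: is_aut_def is_iso_def)
  next
    fix c assume "c \<in> Consts L"
    then have "f (cst M c) = cst M c" using f by (simp add: is_aut_def is_iso_def)
    then show "?g (cst M c) = cst M c" by simp
  qed
  then show ?thesis by (simp add: aut_def)
qed

lemma is_iso_inv:
  assumes f: "is_iso L M N f" and g: "bij_betw g (univ N) (univ M)" "\<And>x. x \<in> univ M \<Longrightarrow> g (f x) = x"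
    and M: "is_struct L M"
  shows "is_iso L N M g"
proof -
  have fb: "f ` univ M = univ N" using f by (auto simp: is_iso_def bij_betw_def)
  have fg: "f (g y) = y" if "y \<in> univ N" for y using that g(2) fb by force
  have gM: "g y \<in> univ M" if "y \<in> univ N" for y using that g(1) by (auto simp: bij_betw_def)
  show ?thesis
    unfolding is_iso_def
  proof (intro conjI ballI g(1))
    fix r ys assume r: "r \<in> Rels L" "ys \<in> tuples (univ N) (arity L r)"
    have "map g ys \<in> tuples (univ M) (arity L r)" using r(2) gM by (auto simp: tuples_def)
    then have "map g ys \<in> rel M r \<longleftrightarrow> map f (map g ys) \<in> rel N r"
      using f r(1) unfolding is_iso_def by blast
    moreover have "map f (map g ys) = ys" using r(2) fg by (auto simp: tuples_def intro!: map_idI)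
    ultimately show "ys \<in> rel N r \<longleftrightarrow> map g ys \<in> rel M r" by simp
  next
    fix c assume c: "c \<in> Consts L"
    then have "f (cst M c) = cst N c" using f by (simp add: is_iso_def)
    then show "g (cst N c) = cst M c" using g(2)[of "cst M c"] M c by (auto simp: is_struct_def)
  qed
qed

lemma perm_group_aut:
  assumes M: "is_struct L M"
  shows "perm_group (univ M) (aut L M)"
proof
  show "id \<in> aut L M" by (auto simp: aut_def is_aut_def is_iso_def)
  show closed: "f x \<in> univ M" if "f \<in> aut L M" "x \<in> univ M" for f x
    using aut_bij_betw[OF that(1)] that(2) by (auto simp: bij_betw_def)
  show bij: "bij f" if f: "f \<in> aut L M" for f
  proof -
    have "bij_betw f (- univ M) (- univ M)"
      by (subst bij_betw_cong[of _ _ id]) (use f in \<open>auto simp: aut_def\<close>)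
    then have "bij_betw f (univ M \<union> - univ M) (univ M \<union> - univ M)"
      by (rule bij_betw_combine[OF aut_bij_betw[OF f]]) auto
    then show ?thesis by simp
  qed
  show "f \<circ> g \<in> aut L M" if "f \<in> aut L M" "g \<in> aut L M" for f g
    using that is_iso_comp[of L M M g M f] by (auto simp: aut_def is_aut_def)
  show "inv f \<in> aut L M" if f: "f \<in> aut L M" for f
  proof -
    have i: "inv f (f x) = x" "f (inv f x) = x" for x
      using bij[OF f] by (auto simp: bij_def surj_f_inv_f)
    have im: "f ` univ M = univ M" using aut_bij_betw[OF f] by (simp add: bij_betw_def)
    have "bij_betw (inv f) (univ M) (univ M)"
    proof (rule bij_betw_imageI)
      show "inj_on (inv f) (univ M)" using i(2) by (metis inj_onI)
      show "inv f ` univ M = univ M" using im i(1) by (metis (no_types, lifting) image_cong image_ident image_image)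
    qed
    then have "is_iso L M M (inv f)"
      using is_iso_inv[OF _ _ _ M, of M f "inv f"] f i by (auto simp: aut_def is_aut_def)
    moreover have "inv f x = x" if "x \<notin> univ M" for x
      using f that i(1)[of x] by (auto simp: aut_def)
    ultimately show ?thesis by (simp add: aut_def is_aut_def)
  qed
qed

text \<open>Variables beyond the tuple all receive one fixed element, so tuples of the same length
  give assignments that agree there.\<close>

definition asg :: "('r, 'c, 'a) fostruct \<Rightarrow> 'a list \<Rightarrow> nat \<Rightarrow> 'a" where
  "asg M xs i = (if i < length xs then xs ! i else (SOME a. a \<in> univ M))"

lemma asg_assignments:
  assumes M: "is_struct L M" and "xs \<in> tuples (univ M) n"
  shows "asg M xs \<in> assignments M"
proof -
  have "(SOME a. a \<in> univ M) \<in> univ M" using M by (auto simp: is_struct_def some_in_eq)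
  then show ?thesis using assms(2) by (auto simp: asg_def assignments_def tuples_def)
qed

lemma asg_nth: "i < length xs \<Longrightarrow> asg M xs i = xs ! i"
  by (simp add: asg_def)

lemma complete_fm_conj_over:
  assumes M: "is_struct L M" "countable (univ M)" "atomic_struct L M"
    and p: "complete_fm L M n p" and xs: "xs \<in> tuples (univ M) n" "sat M (asg M xs) p"
    and ys: "ys \<in> tuples (univ M) n" "sat M (asg M ys) p"
  shows "perm_group.conj_over (aut L M) {} xs ys"
proof -
  interpret perm_group "univ M" "aut L M" by (rule perm_group_aut[OF M(1)])
  obtain f where f: "is_iso L M M f" "\<forall>i<n. f (asg M xs i) = asg M ys i"
    using complete_fm_conj[OF M p asg_assignments[OF M(1) xs(1)] xs(2) asg_assignments[OF M(1) ys(1)] ys(2)]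
    by blast
  let ?g = "\<lambda>x. if x \<in> univ M then f x else x"
  have "?g \<in> aut L M" by (rule autI) (simp add: is_aut_def f(1))
  moreover have "map ?g xs = ys"
  proof (rule nth_equalityI)
    show "length (map ?g xs) = length ys" using xs ys by (simp add: tuples_def)
    fix i assume "i < length (map ?g xs)"
    then have i: "i < n" "i < length xs" "i < length ys" using xs ys by (auto simp: tuples_def)
    then have "xs ! i \<in> univ M" using xs(1) by (auto simp: tuples_def)
    moreover have "f (asg M xs i) = asg M ys i" using f(2) i by blast
    ultimately show "map ?g xs ! i = ys ! i" using i by (simp add: asg_nth)
  qed
  ultimately show ?thesis by (auto simp: conj_over_def)
qed

text \<open>Realisations of one isolating formula are conjugate, so one realisation per satisfiable
  formula represents every orbit.\<close>

lemma finite_types_finite_orbits: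
  assumes M: "is_struct L M" "countable (univ M)" and fin: "finite_types L M"
  shows "\<exists>S. finite S \<and> (\<forall>xs\<in>tuples (univ M) n. \<exists>ys\<in>S. perm_group.conj_over (aut L M) {} xs ys)"
proof -
  obtain \<Phi> where \<Phi>: "finite \<Phi>" "\<forall>p\<in>\<Phi>. complete_fm L M n p" "\<forall>v\<in>assignments M. \<exists>p\<in>\<Phi>. sat M v p"
    using finite_typesD[OF fin, of n] by (elim exE conjE)
  define pick where "pick p = (SOME ys. ys \<in> tuples (univ M) n \<and> sat M (asg M ys) p)" for p
  have "\<exists>ys\<in>pick ` \<Phi>. perm_group.conj_over (aut L M) {} xs ys" if xs: "xs \<in> tuples (univ M) n" for xs
  proof -
    obtain p where p: "p \<in> \<Phi>" "sat M (asg M xs) p" using \<Phi>(3) asg_assignments[OF M(1) xs] by blast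
    have "pick p \<in> tuples (univ M) n \<and> sat M (asg M (pick p)) p"
      unfolding pick_def by (rule someI[of _ xs]) (use xs p in simp)
    then have "perm_group.conj_over (aut L M) {} xs (pick p)"
      using complete_fm_conj_over[OF M finite_types_atomic[OF fin]] \<Phi>(2) p xs by blast
    then show ?thesis using p(1) by blast
  qed
  then show ?thesis using \<Phi>(1) by blast
qed

text \<open>A semantic form of being a boolean combination; \<open>bool_comb_of_determined\<close>
  is the converse.\<close>

lemma bool_combs_support:
  assumes "q \<in> bool_combs S"
  shows "\<exists>\<Theta>\<subseteq>S. finite \<Theta> \<and> (\<forall>v w. (\<forall>\<theta>\<in>\<Theta>. sat M v \<theta> \<longleftrightarrow> sat M w \<theta>) \<longrightarrow> (sat M v q \<longleftrightarrow> sat M w q))"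
  using assms
proof induction
  case (base p)
  then show ?case by (intro exI[of _ "{p}"]) auto
next
  case (conj p q)
  then obtain \<Theta> \<Theta>' where "\<Theta> \<subseteq> S" "finite \<Theta>" "\<Theta>' \<subseteq> S" "finite \<Theta>'"
    "\<And>v w. (\<forall>\<theta>\<in>\<Theta>. sat M v \<theta> \<longleftrightarrow> sat M w \<theta>) \<Longrightarrow> (sat M v p \<longleftrightarrow> sat M w p)"
    "\<And>v w. (\<forall>\<theta>\<in>\<Theta>'. sat M v \<theta> \<longleftrightarrow> sat M w \<theta>) \<Longrightarrow> (sat M v q \<longleftrightarrow> sat M w q)"
    by auto
  then show ?case by (intro exI[of _ "\<Theta> \<union> \<Theta>'"]) (simp, blast)
qed auto

lemma struct_expand_simps [simp]:
  "univ (struct_expand M) = univ M" "rel (struct_expand M) = rel M"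
  "cst (struct_expand M) (Inl c) = cst M c" "cst (struct_expand M) (Inr a) = a"
  "assignments (struct_expand M) = assignments M"
  by (simp_all add: struct_expand_def assignments_def)

lemma lang_expand_simps [simp]:
  "Rels (lang_expand L A) = Rels L" "arity (lang_expand L A) = arity L"
  "Consts (lang_expand L A) = Consts L <+> A"
  by (simp_all add: lang_expand_def)

text \<open>Variables are listed in the order \<open>d\<close>, \<open>e\<close>, \<open>c\<close>.  A mutually algebraic formula involving both
  \<open>d\<close> and \<open>c\<close> is false when they are unlinked; the others only see \<open>d @ e\<close> or \<open>e @ c\<close>.\<close>

lemma mutually_algebraic_separated:
  fixes M :: "('r, 'c, 'a) fostruct"
  assumes M: "is_struct L M" "countable (univ M)" and fin: "finite_types L M"
    and ma: "mutually_algebraic L M"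
  shows "\<exists>P \<Lambda>. perm_group.separated (univ M) (aut L M) k m r P \<Lambda>"
proof -
  interpret perm_group "univ M" "aut L M" by (rule perm_group_aut[OF M(1)])
  let ?X = "univ M" and ?MM = "struct_expand M" and ?LM = "lang_expand L (univ M)"
  define n where "n = r + m + k"
  define S where "S = {s. fm_of ?LM s \<and> mutually_algebraic_fm ?MM s}"
  obtain \<Phi> where \<Phi>: "finite \<Phi>" "\<forall>p\<in>\<Phi>. complete_fm L M n p" "\<forall>v\<in>assignments M. \<exists>p\<in>\<Phi>. sat M v p"
    using finite_typesD[OF fin, of n] by (elim exE conjE)
  \<comment> \<open>Only the finitely many isolating formulas are decomposed, as they already decide
    the orbit of a tuple.\<close>
  have "\<exists>\<Theta>\<subseteq>S. finite \<Theta> \<and> (\<forall>v\<in>assignments M. \<forall>w\<in>assignments M.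
      (\<forall>\<theta>\<in>\<Theta>. sat ?MM v \<theta> \<longleftrightarrow> sat ?MM w \<theta>) \<longrightarrow> (sat M v p \<longleftrightarrow> sat M w p))" if p: "p \<in> \<Phi>" for p
  proof -
    let ?p = "subst Inl p Var :: ('r, 'c + 'a) fm"
    have "fm_of ?LM ?p" by (rule fm_of_subst[of L]) (use \<Phi>(2) p in \<open>auto simp: complete_fm_def\<close>)
    then obtain q where q: "q \<in> bool_combs S" "equivalent_in ?MM ?p q"
      using ma unfolding mutually_algebraic_def S_def Let_def by blast
    obtain \<Theta> where \<Theta>: "\<Theta> \<subseteq> S" "finite \<Theta>"
      "\<forall>v w. (\<forall>\<theta>\<in>\<Theta>. sat ?MM v \<theta> \<longleftrightarrow> sat ?MM w \<theta>) \<longrightarrow> (sat ?MM v q \<longleftrightarrow> sat ?MM w q)"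
      using bool_combs_support[OF q(1), of ?MM] by blast
    have "sat M v p \<longleftrightarrow> sat ?MM v q" if "v \<in> assignments M" for v
      using q(2) that sat_subst[of ?MM M Inl v p Var] by (simp add: equivalent_in_def)
    then show ?thesis using \<Theta> by (intro exI[of _ \<Theta>]) simp
  qed
  then obtain T where T: "\<And>p. p \<in> \<Phi> \<Longrightarrow> T p \<subseteq> S" "\<And>p. p \<in> \<Phi> \<Longrightarrow> finite (T p)"
    "\<And>p v w. p \<in> \<Phi> \<Longrightarrow> v \<in> assignments M \<Longrightarrow> w \<in> assignments M \<Longrightarrow>
       (\<forall>\<theta>\<in>T p. sat ?MM v \<theta> \<longleftrightarrow> sat ?MM w \<theta>) \<Longrightarrow> sat M v p \<longleftrightarrow> sat M w p"
    by metis
  define \<Theta> where "\<Theta> = (\<Union>p\<in>\<Phi>. T p)"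
  have \<Theta>: "finite \<Theta>" "\<Theta> \<subseteq> S" using \<Phi>(1) T(1,2) by (auto simp: \<Theta>_def)
  \<comment> \<open>Two elements are linked if they occur together in a tuple satisfying one of
    finitely many mutually algebraic formulas; hence the finite degree.\<close>
  define \<Lambda> where "\<Lambda> a b \<longleftrightarrow> (\<exists>\<theta>\<in>\<Theta>. \<exists>t\<in>defined_rel ?MM \<theta>. a \<in> set t \<and> b \<in> set t)" for a b
  have fin_deg: "finite {b. \<Lambda> a b}" for a
  proof -
    have "finite {t \<in> defined_rel ?MM \<theta>. a \<in> set t}" if "\<theta> \<in> \<Theta>" for \<theta>
    proof (cases "a \<in> ?X")
      case True
      then show ?thesis using that \<Theta>(2)
        by (auto simp: S_def mutually_algebraic_fm_def mutually_algebraic_rel_def)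
    next
      case False
      then have "{t \<in> defined_rel ?MM \<theta>. a \<in> set t} = {}"
        by (fastforce simp: defined_rel_def assignments_def)
      then show ?thesis by (simp only: finite.emptyI)
    qed
    then have "finite (\<Union>\<theta>\<in>\<Theta>. \<Union>t\<in>{t \<in> defined_rel ?MM \<theta>. a \<in> set t}. set t)"
      using \<Theta>(1) by blast
    then show ?thesis by (rule rev_finite_subset) (auto simp: \<Lambda>_def)
  qed
  define a0 where "a0 = (SOME a. a \<in> ?X)"
  \<comment> \<open>The places of d hold a dummy element. The recorded value says nothing about
    formulas mentioning d, but it is consulted only for formulas without a variable of d.\<close>
  define pat where "pat ce = {\<theta>\<in>\<Theta>. sat ?MM (asg M (replicate r a0 @ drop k ce @ take k ce)) \<theta>}" for ce
  define P where "P = (\<lambda>T. {ce. pat ce = T}) ` Pow \<Theta>"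
  have "separated k m r P \<Lambda>"
    unfolding separated_def
  proof (intro conjI allI impI ballI)
    show "finite P" using \<Theta>(1) by (simp add: P_def)
    show "tuples ?X (k + m) \<subseteq> \<Union> P"
    proof
      fix ce
      have "pat ce \<in> Pow \<Theta>" by (auto simp: pat_def)
      then show "ce \<in> \<Union> P" unfolding P_def by blast
    qed
    show "finite {b. \<Lambda> a b}" for a by (rule fin_deg)
    show "\<Lambda> b a" if "\<Lambda> a b" for a b using that by (auto simp: \<Lambda>_def)
  next
    fix B c c' e d
    assume B: "B \<in> P" and c: "c \<in> tuples ?X k" "c' \<in> tuples ?X k" and e: "e \<in> tuples ?X m"
      and d: "d \<in> tuples ?X r" and inB: "c @ e \<in> B" "c' @ e \<in> B"
      and un: "\<forall>a\<in>set c \<union> set c'. \<forall>b\<in>set d. \<not> \<Lambda> a b"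
    have len: "length c = k" "length c' = k" "length e = m" "length d = r"
      using c e d by (auto simp: tuples_def)
    have tup: "d @ e @ x \<in> tuples ?X n" if "x \<in> {c, c'}" for x
      using that c e d by (auto simp: tuples_def n_def)
    have as: "asg M (d @ e @ x) \<in> assignments M" if "x \<in> {c, c'}" for x
      using asg_assignments[OF M(1) tup[OF that]] .
    have same: "pat (c @ e) = pat (c' @ e)" using B inB by (auto simp: P_def)
    have "sat ?MM (asg M (d @ e @ c)) \<theta> \<longleftrightarrow> sat ?MM (asg M (d @ e @ c')) \<theta>" if \<theta>: "\<theta> \<in> \<Theta>" for \<theta>
    proof -
      consider (c) "fv \<theta> \<inter> {..<r} = {}" | (d) "fv \<theta> \<inter> {r + m..<n} = {}"
        | (both) i j where "i \<in> fv \<theta>" "i < r" "j \<in> fv \<theta>" "r + m \<le> j" "j < n"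
        by fastforce
      then show ?thesis
      proof cases
        case c
        have "sat ?MM (asg M (d @ e @ x)) \<theta> \<longleftrightarrow> \<theta> \<in> pat (x @ e)" if "x \<in> {c, c'}" for x
        proof -
          have "sat ?MM (asg M (d @ e @ x)) \<theta> \<longleftrightarrow> sat ?MM (asg M (replicate r a0 @ e @ x)) \<theta>"
          proof (rule sat_cong)
            fix i assume "i \<in> fv \<theta>"
            then have "\<not> i < r" using c by auto
            then show "asg M (d @ e @ x) i = asg M (replicate r a0 @ e @ x) i"
              by (simp add: asg_def nth_append len)
          qed
          then show ?thesis using that \<theta> len by (auto simp: pat_def)
        qed
        then show ?thesis using same by simp
      next
        case d
        show ?thesis
        proof (rule sat_cong)
          fix i assume "i \<in> fv \<theta>"
          \<comment> \<open>A variable from n on has the default value of \<open>asg\<close> on both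
            sides.\<close>
          then have "i < r + m \<or> \<not> i < n" using d by fastforce
          then show "asg M (d @ e @ c) i = asg M (d @ e @ c') i"
            using len by (auto simp: asg_def nth_append n_def)
        qed
      next
        case both
        have "\<not> sat ?MM (asg M (d @ e @ x)) \<theta>" if x: "x \<in> {c, c'}" for x
        proof
          assume s: "sat ?MM (asg M (d @ e @ x)) \<theta>"
          let ?t = "map (asg M (d @ e @ x)) (sorted_list_of_set (fv \<theta>))"
          have "?t \<in> defined_rel ?MM \<theta>" using s as[OF x] by (auto simp: defined_rel_def)
          moreover have "asg M (d @ e @ x) i \<in> set ?t" "asg M (d @ e @ x) j \<in> set ?t"
            using both by auto
          ultimately have "\<Lambda> (asg M (d @ e @ x) j) (asg M (d @ e @ x) i)"
            unfolding \<Lambda>_def using \<theta> by blast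
          moreover have "length x = k" using x len by auto
          then have "asg M (d @ e @ x) i = d ! i" "asg M (d @ e @ x) j = x ! (j - r - m)"
            using both len by (simp_all add: asg_def nth_append n_def less_diff_conv2)
          moreover have "d ! i \<in> set d" "x ! (j - r - m) \<in> set x"
            using both len \<open>length x = k\<close> by (auto simp: n_def)
          ultimately show False using un x by auto
        qed
        then show ?thesis by simp
      qed
    qed
    moreover obtain p where p: "p \<in> \<Phi>" "sat M (asg M (d @ e @ c)) p" using \<Phi>(3) as by blast
    ultimately have "sat M (asg M (d @ e @ c')) p"
      using T(3)[OF p(1), of "asg M (d @ e @ c)" "asg M (d @ e @ c')"] as p unfolding \<Theta>_def by blast
    then show "conj_over {} (d @ e @ c) (d @ e @ c')"
      using complete_fm_conj_over[OF M finite_types_atomic[OF fin]] \<Phi>(2) p tup by blast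
  qed
  then show ?thesis by blast
qed

text \<open>The complements of domain and range are infinite sets of natural numbers, hence in
  bijection with each other.\<close>

lemma extend_to_bij:
  assumes fin: "finite (R :: (nat \<times> nat) set)"
    and inj: "\<And>a b a' b'. (a, b) \<in> R \<Longrightarrow> (a', b') \<in> R \<Longrightarrow> a = a' \<longleftrightarrow> b = b'"
  shows "\<exists>\<sigma>. bij \<sigma> \<and> (\<forall>(a, b)\<in>R. \<sigma> a = b)"
proof -
  let ?A = "fst ` R" and ?B = "snd ` R"
  define f where "f a = (SOME b. (a, b) \<in> R)" for a
  have f: "f a = b" if "(a, b) \<in> R" for a b
    unfolding f_def by (rule some_equality) (use that inj[OF that] in blast)+
  have bf: "bij_betw f ?A ?B"
  proof (rule bij_betw_imageI)
    show "inj_on f ?A" using f inj by (fastforce intro!: inj_onI)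
    show "f ` ?A = ?B" using f by (force simp: image_iff)
  qed
  have inf: "infinite (- ?A)" "infinite (- ?B)" using fin by (simp_all add: finite_compl)
  define g where "g = from_nat_into (- ?B) \<circ> to_nat_on (- ?A)"
  have bg: "bij_betw g (- ?A) (- ?B)"
    unfolding g_def using inf
    by (auto intro!: bij_betw_trans[of _ _ UNIV] to_nat_on_infinite bij_betw_from_nat_into)
  define \<sigma> where "\<sigma> x = (if x \<in> ?A then f x else g x)" for x
  have "bij_betw \<sigma> (?A \<union> - ?A) (?B \<union> - ?B)"
  proof (rule bij_betw_combine)
    show "bij_betw \<sigma> ?A ?B" by (subst bij_betw_cong[of _ _ f]) (simp_all add: bf \<sigma>_def)
    show "bij_betw \<sigma> (- ?A) (- ?B)" by (subst bij_betw_cong[of _ _ g]) (simp_all add: bg \<sigma>_def)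
  qed auto
  then have "bij \<sigma>" by simp
  moreover have "\<sigma> a = b" if "(a, b) \<in> R" for a b
    using that f[OF that] by (force simp: \<sigma>_def)
  ultimately show ?thesis by blast
qed

section \<open>Orbits and separation in cellular structures\<close>

locale cellular_struct =
  fixes L :: "('r, 'c) lang" and M :: "('r, 'c, 'a) fostruct"
    and n :: nat and k :: "nat \<Rightarrow> nat" and K :: "'a set" and c :: "nat \<Rightarrow> nat \<Rightarrow> 'a list"
  assumes struct: "is_struct L M"
    and finK: "finite K"
    and len: "i < n \<Longrightarrow> length (c i j) = k i \<and> distinct (c i j)"
    and univ_eq: "univ M = K \<union> (\<Union>i<n. \<Union>j. set (c i j))"
    and Kdisj: "i < n \<Longrightarrow> K \<inter> set (c i j) = {}"
    and disj: "disjoint_family_on (\<lambda>(i, j). set (c i j)) ({..<n} \<times> UNIV)"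
    and perm: "i < n \<Longrightarrow> bij \<sigma> \<Longrightarrow> \<exists>f. is_aut L M f \<and> (\<forall>j. map f (c i j) = c i (\<sigma> j)) \<and>
                (\<forall>x\<in>univ M - (\<Union>j. set (c i j)). f x = x)"
begin

sublocale perm_group "univ M" "aut L M"
  by (rule perm_group_aut[OF struct])

lemma cell_unique:
  "i < n \<Longrightarrow> i' < n \<Longrightarrow> x \<in> set (c i j) \<Longrightarrow> x \<in> set (c i' j') \<Longrightarrow> i = i' \<and> j = j'"
  using disjoint_family_onD[OF disj, of "(i, j)" "(i', j')"] by auto

text \<open>Cellularity permutes one family at a time. Each such automorphism fixes the other
  families, so composing them realises all the permutations at once.\<close>

lemma permute_cells:
  assumes "\<And>i. i < n \<Longrightarrow> bij (\<sigma> i)"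
  shows "m \<le> n \<Longrightarrow> \<exists>f\<in>aut L M. (\<forall>x\<in>K. f x = x) \<and> (\<forall>i<m. \<forall>j. map f (c i j) = c i (\<sigma> i j)) \<and>
           (\<forall>i. m \<le> i \<longrightarrow> i < n \<longrightarrow> (\<forall>j. map f (c i j) = c i j))"
proof (induction m)
  case 0
  then show ?case using id_mem by (intro bexI[of _ id]) auto
next
  case (Suc m)
  then obtain f where f: "f \<in> aut L M" "\<forall>x\<in>K. f x = x" "\<forall>i<m. \<forall>j. map f (c i j) = c i (\<sigma> i j)"
    "\<forall>i. m \<le> i \<longrightarrow> i < n \<longrightarrow> (\<forall>j. map f (c i j) = c i j)" by auto
  obtain g where g: "is_aut L M g" "\<forall>j. map g (c m j) = c m (\<sigma> m j)"
    "\<forall>x\<in>univ M - (\<Union>j. set (c m j)). g x = x"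
    using perm[of m "\<sigma> m"] assms Suc.prems by auto
  let ?g = "\<lambda>x. if x \<in> univ M then g x else x"
  have mn: "m < n" using Suc.prems by simp
  have sub: "set (c i j) \<subseteq> univ M" if "i < n" for i j using that univ_eq by blast
  have gm: "map ?g (c m j) = c m (\<sigma> m j)" for j
  proof -
    have "map ?g (c m j) = map g (c m j)" using sub[OF mn] by auto
    then show ?thesis using g(2) by simp
  qed
  have gfix: "map ?g (c i j) = c i j" if "i < n" "i \<noteq> m" for i j
    using that g(3) sub[OF that(1)] cell_unique[OF that(1) mn] by (force intro!: map_idI)
  have "?g \<circ> f \<in> aut L M" using f(1) autI[OF g(1)] by (rule_tac comp_mem)
  moreover have "\<forall>x\<in>K. (?g \<circ> f) x = x" using f(2) g(3) Kdisj[OF mn] univ_eq by auto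
  moreover have "\<forall>i<Suc m. \<forall>j. map (?g \<circ> f) (c i j) = c i (\<sigma> i j)"
    using f(3,4) gm gfix mn by (auto simp: less_Suc_eq simp flip: map_map)
  moreover have "\<forall>i. Suc m \<le> i \<longrightarrow> i < n \<longrightarrow> (\<forall>j. map (?g \<circ> f) (c i j) = c i j)"
    using f(4) gfix by (auto simp flip: map_map)
  ultimately show ?case by blast
qed

text \<open>The link relation of a cellular structure. A point of K lies in no cell and is linked to
  nothing, not even to itself.\<close>

definition same_cell :: "'a \<Rightarrow> 'a \<Rightarrow> bool" where
  "same_cell x y \<longleftrightarrow> (\<exists>i<n. \<exists>j. x \<in> set (c i j) \<and> y \<in> set (c i j))"

lemma finite_same_cell: "finite {y. same_cell x y}"
proof (cases "\<exists>i<n. \<exists>j. x \<in> set (c i j)")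
  case True
  then obtain i j where ij: "i < n" "x \<in> set (c i j)" by blast
  have "y \<in> set (c i j)" if xy: "same_cell x y" for y
  proof -
    obtain i' j' where "i' < n" "x \<in> set (c i' j')" "y \<in> set (c i' j')"
      using xy unfolding same_cell_def by blast
    then show ?thesis using cell_unique[OF ij(1) _ ij(2)] by metis
  qed
  then have "{y. same_cell x y} \<subseteq> set (c i j)" by blast
  then show ?thesis by (rule finite_subset) simp
qed (simp add: same_cell_def)

text \<open>What permuting the cells within each family leaves unchanged: family and coordinate are
  kept, the number of the cell is forgotten, and a point of K is remembered itself.\<close>

definition position :: "'a \<Rightarrow> ('a + nat \<times> nat)" where
  "position x = (if x \<in> K then Inl x
     else Inr (SOME (i, l). i < n \<and> (\<exists>j. l < length (c i j) \<and> c i j ! l = x)))"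

lemma position_in: "x \<in> K \<Longrightarrow> position x = Inl x"
  by (simp add: position_def)

lemma position_out:
  assumes "i < n" "l < k i" "x = c i j ! l"
  shows "position x = Inr (i, l)"
proof -
  have x: "x \<in> set (c i j)" using assms len by auto
  then have "x \<notin> K" using Kdisj[OF assms(1)] by blast
  moreover have "(SOME (i, l). i < n \<and> (\<exists>j. l < length (c i j) \<and> c i j ! l = x)) = (i, l)"
  proof (rule some_equality)
    show "case (i, l) of (i, l) \<Rightarrow> i < n \<and> (\<exists>j. l < length (c i j) \<and> c i j ! l = x)"
      using assms len by auto
  next
    fix z assume "case z of (i, l) \<Rightarrow> i < n \<and> (\<exists>j. l < length (c i j) \<and> c i j ! l = x)"
    then obtain i' l' j' where z: "z = (i', l')" "i' < n" "l' < length (c i' j')" "c i' j' ! l' = x"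
      by (cases z) auto
    then have "x \<in> set (c i' j')" by auto
    then have "i' = i" "j' = j" using cell_unique x z assms by blast+
    then show "z = (i, l)" using z assms len[of i j] by (auto simp: nth_eq_iff_index_eq)
  qed
  ultimately show ?thesis by (simp add: position_def)
qed

lemma in_cell:
  assumes "x \<in> univ M - K"
  obtains i j l where "i < n" "l < k i" "x = c i j ! l" "x \<in> set (c i j)"
proof -
  obtain i j where ij: "i < n" "x \<in> set (c i j)" using assms univ_eq by blast
  then obtain l where "l < length (c i j)" "x = c i j ! l" by (metis in_set_conv_nth)
  then show thesis using that ij len by auto
qed

text \<open>The pairs in Z match cell numbers within each family. Agreement on
  \<open>same_cell\<close> makes this matching a finite partial injection, which extends to a
  permutation of the natural numbers; agreement of positions makes the resulting automorphism send x
  to y.\<close>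

lemma same_position_conj:
  assumes Z: "finite Z" "Z \<subseteq> univ M \<times> univ M"
    and pos: "\<And>x y. (x, y) \<in> Z \<Longrightarrow> position x = position y"
    and same: "\<And>x y x' y'. (x, y) \<in> Z \<Longrightarrow> (x', y') \<in> Z \<Longrightarrow> same_cell x x' \<longleftrightarrow> same_cell y y'"
  shows "\<exists>f\<in>aut L M. \<forall>(x, y)\<in>Z. f x = y"
proof -
  define R where "R i = {(j, j'). \<exists>(x, y)\<in>Z. x \<in> set (c i j) \<and> y \<in> set (c i j')}" for i
  have pair: "(x \<in> K \<and> y = x) \<or> (\<exists>i<n. \<exists>l<k i. \<exists>j j'. x = c i j ! l \<and> y = c i j' ! l)"
    if xy: "(x, y) \<in> Z" for x y
  proof (cases "x \<in> K")
    case True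
    then have "position y = Inl x" using pos[OF xy] position_in by simp
    then show ?thesis using True by (auto simp: position_def split: if_splits)
  next
    case False
    then have "x \<in> univ M - K" using xy Z(2) by blast
    then obtain i j l where x: "i < n" "l < k i" "x = c i j ! l" by (rule in_cell)
    then have py: "position y = Inr (i, l)" using pos[OF xy] position_out by simp
    then have "y \<notin> K" by (auto simp: position_def)
    then have "y \<in> univ M - K" using xy Z(2) by blast
    then obtain i' j' l' where y: "i' < n" "l' < k i'" "y = c i' j' ! l'" by (rule in_cell)
    then have "i' = i" "l' = l" using py position_out by auto
    then show ?thesis using x y by blast
  qed
  have "\<exists>\<sigma>. bij \<sigma> \<and> (\<forall>(a, b)\<in>R i. \<sigma> a = b)" if i: "i < n" for i
  proof (rule extend_to_bij)
    define num where "num x = (THE j. x \<in> set (c i j))" for x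
    have num: "num x = j" if "x \<in> set (c i j)" for x j
      unfolding num_def
    proof (rule the_equality)
      show "x \<in> set (c i j)" by (rule that)
      show "j' = j" if "x \<in> set (c i j')" for j'
        using cell_unique[OF i i that \<open>x \<in> set (c i j)\<close>] by simp
    qed
    have "R i \<subseteq> (\<lambda>(x, y). (num x, num y)) ` Z"
    proof clarify
      fix a b assume "(a, b) \<in> R i"
      then obtain x y where xy: "(x, y) \<in> Z" "x \<in> set (c i a)" "y \<in> set (c i b)" unfolding R_def by blast
      then have "(a, b) = (\<lambda>(x, y). (num x, num y)) (x, y)" using num by simp
      then show "(a, b) \<in> (\<lambda>(x, y). (num x, num y)) ` Z" using xy(1) by (rule image_eqI)
    qed
    then show "finite (R i)" by (rule finite_subset) (simp add: Z(1))
  next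
    fix a b a' b' assume ab: "(a, b) \<in> R i" "(a', b') \<in> R i"
    obtain x y where xy: "(x, y) \<in> Z" "x \<in> set (c i a)" "y \<in> set (c i b)"
      using ab(1) unfolding R_def by blast
    obtain x' y' where xy': "(x', y') \<in> Z" "x' \<in> set (c i a')" "y' \<in> set (c i b')"
      using ab(2) unfolding R_def by blast
    have iff: "same_cell u u' \<longleftrightarrow> j = j'" if u: "u \<in> set (c i j)" "u' \<in> set (c i j')" for u u' j j'
    proof
      assume "same_cell u u'"
      then obtain i1 j1 where 1: "i1 < n" "u \<in> set (c i1 j1)" "u' \<in> set (c i1 j1)"
        unfolding same_cell_def by blast
      then show "j = j'" using cell_unique[OF 1(1) i 1(2) u(1)] cell_unique[OF 1(1) i 1(3) u(2)] by simp
    next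
      assume "j = j'"
      then show "same_cell u u'" using u i unfolding same_cell_def by blast
    qed
    show "a = a' \<longleftrightarrow> b = b'"
      using same[OF xy(1) xy'(1)] iff[OF xy(2) xy'(2)] iff[OF xy(3) xy'(3)] by simp
  qed
  then obtain \<sigma> where \<sigma>: "\<And>i. i < n \<Longrightarrow> bij (\<sigma> i)" "\<And>i. i < n \<Longrightarrow> \<forall>(a, b)\<in>R i. \<sigma> i a = b" by metis
  obtain f where f: "f \<in> aut L M" "\<forall>x\<in>K. f x = x" "\<forall>i<n. \<forall>j. map f (c i j) = c i (\<sigma> i j)"
    using permute_cells[of \<sigma> n] \<sigma>(1) by auto
  have "f x = y" if xy: "(x, y) \<in> Z" for x y
  proof -
    consider "x \<in> K" "y = x" | i l j j' where "i < n" "l < k i" "x = c i j ! l" "y = c i j' ! l"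
      using pair[OF xy] by blast
    then show ?thesis
    proof cases
      case 1
      then show ?thesis using f by simp
    next
      case 2
      then have l: "l < length (c i j)" "l < length (c i j')" "l < length (c i (\<sigma> i j))" using len by auto
      then have "x \<in> set (c i j)" "y \<in> set (c i j')" using 2 by simp_all
      then have "(j, j') \<in> R i" using xy unfolding R_def by blast
      then have "\<sigma> i j = j'" using bspec[OF \<sigma>(2)[OF 2(1)], of "(j, j')"] by simp
      moreover have "f x = map f (c i j) ! l" using 2 l by simp
      ultimately show ?thesis using f(3) 2 by simp
    qed
  qed
  then show ?thesis using f(1) by blast
qed

text \<open>Positions and sharing of cells determine the orbit of a tuple, by
  \<open>same_position_conj\<close>, and take finitely many values for each length.\<close>

definition pattern :: "'a list \<Rightarrow> ('a + nat \<times> nat) list \<times> bool list list" where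
  "pattern xs = (map position xs, map (\<lambda>x. map (same_cell x) xs) xs)"

lemma finite_patterns: "finite (pattern ` tuples (univ M) N)"
proof -
  define Q where "Q = Inl ` K \<union> Inr ` (SIGMA i:{..<n}. {..<k i})"
  have "finite Q" using finK by (auto simp: Q_def)
  have "position x \<in> Q" if "x \<in> univ M" for x
  proof (cases "x \<in> K")
    case True
    then show ?thesis by (auto simp: Q_def position_in)
  next
    case False
    then have "x \<in> univ M - K" using that by blast
    then obtain i j l where "i < n" "l < k i" "x = c i j ! l" by (rule in_cell)
    then show ?thesis by (auto simp: Q_def position_out)
  qed
  then have "pattern ` tuples (univ M) N \<subseteq> {qs. set qs \<subseteq> Q \<and> length qs = N} \<times>
      {bss. set bss \<subseteq> {bs. set bs \<subseteq> UNIV \<and> length bs = N} \<and> length bss = N}"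
    by (auto simp: pattern_def tuples_def subset_iff)
  moreover have "finite \<dots>"
    by (intro finite_cartesian_product finite_lists_length_eq \<open>finite Q\<close>) simp
  ultimately show ?thesis by (rule finite_subset)
qed

lemma pattern_zip:
  assumes p: "pattern xs = pattern ys" and xy: "(x, y) \<in> set (zip xs ys)"
  shows "position x = position y" "(x', y') \<in> set (zip xs ys) \<Longrightarrow> same_cell x x' \<longleftrightarrow> same_cell y y'"
proof -
  have len: "length xs = length ys" using p unfolding pattern_def by (metis length_map prod.inject)
  obtain i where i: "i < length xs" "x = xs ! i" "y = ys ! i" using xy by (auto simp: in_set_zip)
  have "map position xs ! i = map position ys ! i" using p by (simp add: pattern_def)
  then show "position x = position y" using i len by simp
  assume "(x', y') \<in> set (zip xs ys)"
  then obtain j where j: "j < length xs" "x' = xs ! j" "y' = ys ! j" by (auto simp: in_set_zip)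
  have "map (\<lambda>x. map (same_cell x) xs) xs ! i ! j = map (\<lambda>x. map (same_cell x) ys) ys ! i ! j"
    using p by (simp only: pattern_def prod.inject)
  then show "same_cell x x' \<longleftrightarrow> same_cell y y'" using i j len by simp
qed

lemma set_zip_subset: "set (zip xs ys) \<subseteq> set xs \<times> set ys"
  by (auto dest: set_zip_leftD set_zip_rightD)

lemma conj_over_zip:
  assumes "f \<in> aut L M" "length xs = length ys" "\<forall>(x, y)\<in>set (zip xs ys). f x = y"
  shows "conj_over {} xs ys"
proof -
  have "map f xs = ys"
  proof (rule nth_equalityI)
    fix i assume "i < length (map f xs)"
    then have "(xs ! i, ys ! i) \<in> set (zip xs ys)" using assms(2) by (auto simp: in_set_zip)
    then show "map f xs ! i = ys ! i" using assms(3) \<open>i < length (map f xs)\<close> by auto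
  qed (use assms in simp)
  then show ?thesis using assms(1) by (auto simp: conj_over_def)
qed

lemma cellular_finite_orbits:
  "\<exists>S. finite S \<and> (\<forall>xs\<in>tuples (univ M) N. \<exists>ys\<in>S. conj_over {} xs ys)"
proof -
  obtain S where S: "finite S" "S \<subseteq> tuples (univ M) N" "pattern ` tuples (univ M) N = pattern ` S"
    using finite_subset_image[OF finite_patterns order_refl] by metis
  have "\<exists>ys\<in>S. conj_over {} xs ys" if xs: "xs \<in> tuples (univ M) N" for xs
  proof -
    obtain ys where ys: "ys \<in> S" "pattern xs = pattern ys" using S(3) xs by (metis imageE imageI)
    have len: "length xs = length ys" using ys S(2) xs by (auto simp: tuples_def)
    have sub: "set (zip xs ys) \<subseteq> univ M \<times> univ M"
      using xs ys(1) S(2) by (auto simp: tuples_def dest: set_zip_leftD set_zip_rightD)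
    obtain f where "f \<in> aut L M" "\<forall>(x, y)\<in>set (zip xs ys). f x = y"
      using same_position_conj[OF _ sub] pattern_zip[OF ys(2)] by blast
    then show ?thesis using conj_over_zip len ys(1) by blast
  qed
  then show ?thesis using S(1) by blast
qed

text \<open>If d shares no cell with a or a', then matching a @ e with a' @ e and fixing d still
  preserves positions and sharing of cells.\<close>

lemma cellular_separated: "\<exists>P \<Lambda>. separated k' m r P \<Lambda>"
proof -
  define P where "P = (\<lambda>p. {ce. pattern ce = p}) ` pattern ` tuples (univ M) (k' + m)"
  have "separated k' m r P same_cell"
    unfolding separated_def
  proof (intro conjI allI impI ballI)
    show "finite P" using finite_patterns by (simp add: P_def)
    show "tuples (univ M) (k' + m) \<subseteq> \<Union> P" by (auto simp: P_def)
    show "finite {b. same_cell a b}" for a by (rule finite_same_cell)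
    show "same_cell b a" if "same_cell a b" for a b using that by (auto simp: same_cell_def)
  next
    fix B a a' e d
    assume B: "B \<in> P" and a: "a \<in> tuples (univ M) k'" "a' \<in> tuples (univ M) k'" and e: "e \<in> tuples (univ M) m"
      and d: "d \<in> tuples (univ M) r" and inB: "a @ e \<in> B" "a' @ e \<in> B"
      and un: "\<forall>x\<in>set a \<union> set a'. \<forall>y\<in>set d. \<not> same_cell x y"
    have pat: "pattern (a @ e) = pattern (a' @ e)" using B inB by (auto simp: P_def)
    have len: "length a = length a'" using a by (simp add: tuples_def)
    define Z1 where "Z1 = set (zip (a @ e) (a' @ e))"
    define Z2 where "Z2 = {(x, x) | x. x \<in> set d}"
    have Z: "set (zip (d @ e @ a) (d @ e @ a')) = Z1 \<union> Z2"
      using len by (auto simp: Z1_def Z2_def zip_same)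
    have un': "\<not> same_cell y x" if "x \<in> set a \<union> set a'" "y \<in> set d" for x y
      using un that by (auto simp: same_cell_def)
    \<comment> \<open>A pair coming from a and a' is unlinked to z on both sides; a pair coming from
      e consists of equal points.\<close>
    have cross: "(same_cell z x \<longleftrightarrow> same_cell z y) \<and> (same_cell x z \<longleftrightarrow> same_cell y z)"
      if "(x, y) \<in> Z1" "z \<in> set d" for x y z
    proof -
      have "(x, y) \<in> set (zip a a') \<or> x = y" using that(1) len by (auto simp: Z1_def zip_same)
      then show ?thesis using un un' that(2) by (auto dest: set_zip_leftD set_zip_rightD)
    qed
    have "\<exists>f\<in>aut L M. \<forall>(x, y)\<in>Z1 \<union> Z2. f x = y"
    proof (rule same_position_conj)
      show "finite (Z1 \<union> Z2)" unfolding Z[symmetric] by simp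
      show "Z1 \<union> Z2 \<subseteq> univ M \<times> univ M" unfolding Z[symmetric]
        by (rule order_trans[OF set_zip_subset Sigma_mono]) (use a e d in \<open>auto simp: tuples_def\<close>)
      show "position x = position y" if "(x, y) \<in> Z1 \<union> Z2" for x y
        using that pattern_zip(1)[OF pat] by (auto simp: Z1_def Z2_def)
      show "same_cell x x' \<longleftrightarrow> same_cell y y'" if "(x, y) \<in> Z1 \<union> Z2" "(x', y') \<in> Z1 \<union> Z2" for x y x' y'
        using that pattern_zip(2)[OF pat, of x y x' y'] cross[of x y x'] cross[of x' y' x]
        by (auto simp: Z1_def Z2_def)
    qed
    then show "conj_over {} (d @ e @ a) (d @ e @ a')"
      using conj_over_zip[of _ "d @ e @ a" "d @ e @ a'"] len Z by auto
  qed
  then show ?thesis by blast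
qed

end

lemma cellular_structE:
  assumes "is_struct L M" "cellular L M"
  obtains n k K c where "cellular_struct L M n k K c"
proof -
  note c = assms(2)[unfolded cellular_def]
  show thesis
    using c
  proof (elim exE conjE, goal_cases)
    case (1 n k K c)
    show ?case
    proof (rule that[of n k K c], unfold_locales)
      show "length (c i j) = k i \<and> distinct (c i j)" if "i < n" for i j
        using 1(3) that by blast
      show "K \<inter> set (c i j) = {}" if "i < n" for i j using 1(5) that by blast
      show "\<exists>f. is_aut L M f \<and> (\<forall>j. map f (c i j) = c i (\<sigma> j)) \<and>
          (\<forall>x\<in>univ M - (\<Union>j. set (c i j)). f x = x)" if "i < n" "bij \<sigma>" for i \<sigma>
        using 1(8) that by simp
    qed (fact assms(1) 1(1) 1(4) 1(6))+
  qed
qed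

section \<open>From the cell decomposition to cellularity\<close>

locale cell_decomp =
  fixes L :: "('r, 'c) lang" and M :: "('r, 'c, 'a) fostruct"
    and K :: "'a set" and C :: "'a list set" and col :: "'a list \<Rightarrow> 'b"
  assumes struct: "is_struct L M" and countable: "countable (univ M)"
    and finK: "finite K" and KX: "K \<subseteq> univ M" and fincol: "finite (col ` C)"
    and cell: "c \<in> C \<Longrightarrow> distinct c \<and> c \<noteq> [] \<and> set c \<subseteq> univ M - K"
    and cover: "x \<in> univ M - K \<Longrightarrow> \<exists>c\<in>C. x \<in> set c"
    and disj: "c \<in> C \<Longrightarrow> c' \<in> C \<Longrightarrow> set c = set c' \<or> set c \<inter> set c' = {}"
    and len: "c \<in> C \<Longrightarrow> c' \<in> C \<Longrightarrow> col c = col c' \<Longrightarrow> length c = length c'"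
    and inv: "g \<in> aut L M \<Longrightarrow> (\<And>x. x \<in> K \<Longrightarrow> g x = x) \<Longrightarrow> c \<in> C \<Longrightarrow> map g c \<in> C \<and> col (map g c) = col c"
    and amalg: "set cs \<subseteq> C \<Longrightarrow> set cs' \<subseteq> C \<Longrightarrow> distinct (map set cs) \<Longrightarrow> distinct (map set cs') \<Longrightarrow>
      map col cs = map col cs' \<Longrightarrow> \<exists>g\<in>aut L M. (\<forall>x\<in>K. g x = x) \<and> map (map g) cs = cs'"
begin

lemma same_set: "c \<in> C \<Longrightarrow> c' \<in> C \<Longrightarrow> x \<in> set c \<Longrightarrow> x \<in> set c' \<Longrightarrow> set c = set c'"
  using disj[of c c'] by blast

definition pick :: "'a set \<Rightarrow> 'a list" where
  "pick S = (SOME c. c \<in> C \<and> set c = S)"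

text \<open>C may hold several enumerations of one cell. Keeping one of each places every point
  outside K in exactly one list and makes its coordinate well defined.\<close>

definition cells :: "'a list set" where
  "cells = pick ` set ` C"

lemma pick: "c \<in> C \<Longrightarrow> pick (set c) \<in> C \<and> set (pick (set c)) = set c"
  unfolding pick_def by (rule someI[of "\<lambda>d. d \<in> C \<and> set d = set c"]) simp

lemma cells_C: "d \<in> cells \<Longrightarrow> d \<in> C"
  using pick by (auto simp: cells_def)

lemma cells_unique: "d \<in> cells \<Longrightarrow> d' \<in> cells \<Longrightarrow> x \<in> set d \<Longrightarrow> x \<in> set d' \<Longrightarrow> d = d'"
proof -
  assume d: "d \<in> cells" "d' \<in> cells" and x: "x \<in> set d" "x \<in> set d'"
  then obtain c c' where c: "c \<in> C" "d = pick (set c)" "c' \<in> C" "d' = pick (set c')"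
    by (auto simp: cells_def)
  have "set d = set d'" using same_set[OF cells_C[OF d(1)] cells_C[OF d(2)] x] .
  then show "d = d'" using c pick by metis
qed

lemma cells_cover: "x \<in> univ M - K \<Longrightarrow> \<exists>d\<in>cells. x \<in> set d"
proof -
  assume "x \<in> univ M - K"
  then obtain c where c: "c \<in> C" "x \<in> set c" using cover by blast
  then have "pick (set c) \<in> cells" "x \<in> set (pick (set c))" using pick by (auto simp: cells_def)
  then show ?thesis by blast
qed

lemma cells_set_inj: "d \<in> cells \<Longrightarrow> d' \<in> cells \<Longrightarrow> set d = set d' \<Longrightarrow> d = d'"
proof -
  assume d: "d \<in> cells" "d' \<in> cells" "set d = set d'"
  then obtain x where "x \<in> set d" using cell cells_C by (metis hd_in_set)
  then show "d = d'" using cells_unique d by blast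
qed

definition permute :: "('a list \<Rightarrow> 'a list) \<Rightarrow> 'a \<Rightarrow> 'a" where
  "permute \<tau> x = (if \<exists>d\<in>cells. x \<in> set d then
     (case (SOME (d, l). d \<in> cells \<and> l < length d \<and> d ! l = x) of (d, l) \<Rightarrow> \<tau> d ! l) else x)"

lemma permute_nth:
  assumes d: "d \<in> cells" "l < length d"
  shows "permute \<tau> (d ! l) = \<tau> d ! l"
proof -
  have "(SOME (d', l'). d' \<in> cells \<and> l' < length d' \<and> d' ! l' = d ! l) = (d, l)"
  proof (rule some_equality)
    fix z assume "case z of (d', l') \<Rightarrow> d' \<in> cells \<and> l' < length d' \<and> d' ! l' = d ! l"
    then obtain d' l' where z: "z = (d', l')" "d' \<in> cells" "l' < length d'" "d' ! l' = d ! l"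
      by (cases z) auto
    then have "d ! l \<in> set d'" by (metis nth_mem)
    then have "d' = d" using cells_unique z d by (metis nth_mem)
    moreover have "distinct d" using cell cells_C d by blast
    ultimately show "z = (d, l)" using z d by (auto simp: nth_eq_iff_index_eq)
  qed (use d in simp)
  moreover have "\<exists>d'\<in>cells. d ! l \<in> set d'" using d by (meson nth_mem)
  ultimately show ?thesis by (simp add: permute_def)
qed

lemma permute_id: "(\<And>d. d \<in> cells \<Longrightarrow> x \<notin> set d) \<Longrightarrow> permute \<tau> x = x"
  by (auto simp: permute_def)

context
  fixes \<tau> :: "'a list \<Rightarrow> 'a list"
  assumes bij: "bij_betw \<tau> cells cells" and colour: "\<And>d. d \<in> cells \<Longrightarrow> col (\<tau> d) = col d"
begin

lemma \<tau>_cells: "d \<in> cells \<Longrightarrow> \<tau> d \<in> cells"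
  using bij by (auto simp: bij_betw_def)

lemma \<tau>_length: "d \<in> cells \<Longrightarrow> length (\<tau> d) = length d"
  using len[of "\<tau> d" d] colour \<tau>_cells cells_C by blast

lemma map_permute: "d \<in> cells \<Longrightarrow> map (permute \<tau>) d = \<tau> d"
  by (rule nth_equalityI) (simp_all add: \<tau>_length permute_nth)

text \<open>A finite tuple meets finitely many cells, and \<open>amalg\<close> moves these as
  \<open>\<tau>\<close> does. Preservation of relations is tested on finite tuples, so this suffices
  for an infinite permutation of cells to be an automorphism.\<close>

lemma permute_local:
  assumes xs: "set xs \<subseteq> univ M"
  shows "\<exists>g\<in>aut L M. map g xs = map (permute \<tau>) xs"
proof -
  define ce where "ce x = (SOME d. d \<in> cells \<and> x \<in> set d)" for x
  have ce: "ce x \<in> cells \<and> x \<in> set (ce x)" if "x \<in> set xs - K" for x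
    unfolding ce_def by (rule someI_ex) (use cells_cover[of x] that xs in blast)
  obtain ds where ds: "set ds = ce ` (set xs - K)" "distinct ds"
    using finite_distinct_list[of "ce ` (set xs - K)"] by auto
  have dsc: "set ds \<subseteq> cells" using ds(1) ce by auto
  have i1: "inj_on set (set ds)" using cells_set_inj dsc by (auto intro!: inj_onI)
  have "inj_on \<tau> (set ds)" by (rule inj_on_subset[OF bij_betw_imp_inj_on[OF bij] dsc])
  moreover have "inj_on set (\<tau> ` set ds)" using cells_set_inj dsc \<tau>_cells by (auto intro!: inj_onI)
  ultimately have i2: "inj_on (set \<circ> \<tau>) (set ds)" by (rule comp_inj_on)
  have "\<exists>g\<in>aut L M. (\<forall>x\<in>K. g x = x) \<and> map (map g) ds = map \<tau> ds"
  proof (rule amalg)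
    show "set ds \<subseteq> C" "set (map \<tau> ds) \<subseteq> C" using dsc cells_C \<tau>_cells by auto
    show "distinct (map set ds)" using ds(2) i1 by (simp add: distinct_map)
    show "distinct (map set (map \<tau> ds))" using ds(2) i2 by (simp add: distinct_map comp_def)
    show "map col ds = map col (map \<tau> ds)" using dsc colour by auto
  qed
  then obtain g where g: "g \<in> aut L M" "\<forall>x\<in>K. g x = x" "map (map g) ds = map \<tau> ds" by blast
  have "g x = permute \<tau> x" if x: "x \<in> set xs" for x
  proof (cases "x \<in> K")
    case True
    then have "\<And>d. d \<in> cells \<Longrightarrow> x \<notin> set d" using cell cells_C by blast
    then show ?thesis using True g(2) permute_id by simp
  next
    case False
    then have d: "ce x \<in> set ds" "ce x \<in> cells" "x \<in> set (ce x)" using x ds(1) ce by auto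
    then have "map g (ce x) = map (permute \<tau>) (ce x)" using g(3) map_permute by simp
    then show ?thesis using d(3) by simp
  qed
  then show ?thesis using g(1) by (intro bexI[of _ g]) auto
qed

lemma permute_aut: "is_aut L M (permute \<tau>)"
  unfolding is_aut_def is_iso_def
proof (intro conjI ballI)
  let ?f = "permute \<tau>"
  interpret perm_group "univ M" "aut L M" by (rule perm_group_aut[OF struct])
  show "bij_betw ?f (univ M) (univ M)"
  proof (rule bij_betw_imageI)
    show "inj_on ?f (univ M)"
    proof (rule inj_onI)
      fix x y assume xy: "x \<in> univ M" "y \<in> univ M" "?f x = ?f y"
      obtain g where "g \<in> aut L M" "map g [x, y] = map ?f [x, y]"
        using permute_local[of "[x, y]"] xy by auto
      then show "x = y" using xy(3) inj_mem[of g x y] by simp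
    qed
    show "?f ` univ M = univ M"
    proof
      show "?f ` univ M \<subseteq> univ M"
      proof clarify
        fix x assume x: "x \<in> univ M"
        obtain g where "g \<in> aut L M" "map g [x] = map ?f [x]" using permute_local[of "[x]"] x by auto
        then show "?f x \<in> univ M" using closed_mem[of g x] x by simp
      qed
      show "univ M \<subseteq> ?f ` univ M"
      proof
        fix y assume y: "y \<in> univ M"
        show "y \<in> ?f ` univ M"
        proof (cases "\<exists>d\<in>cells. y \<in> set d")
          case False
          then have "?f y = y" using permute_id by blast
          then show ?thesis using y by (metis imageI)
        next
          case True
          then obtain d where d: "d \<in> cells" "y \<in> set d" by blast
          then obtain d' where d': "d' \<in> cells" "d = \<tau> d'" using bij by (auto simp: bij_betw_def)
          then have "y \<in> ?f ` set d'" using map_permute[OF d'(1)] d(2) by (metis list.set_map)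
          moreover have "set d' \<subseteq> univ M" using cell cells_C d'(1) by blast
          ultimately show ?thesis by blast
        qed
      qed
    qed
  qed
  show "xs \<in> rel M r \<longleftrightarrow> map ?f xs \<in> rel M r"
    if r: "r \<in> Rels L" and xs: "xs \<in> tuples (univ M) (arity L r)" for r xs
  proof -
    obtain g where g: "g \<in> aut L M" "map g xs = map ?f xs"
      using permute_local xs unfolding tuples_def by blast
    have "xs \<in> rel M r \<longleftrightarrow> map g xs \<in> rel M r"
      using g(1) r xs unfolding aut_def is_aut_def is_iso_def by blast
    then show ?thesis using g(2) by simp
  qed
  show "?f (cst M a) = cst M a" if a: "a \<in> Consts L" for a
  proof -
    have "cst M a \<in> univ M" using a struct by (simp add: is_struct_def)
    then obtain g where g: "g \<in> aut L M" "map g [cst M a] = map ?f [cst M a]"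
      using permute_local[of "[cst M a]"] by auto
    have "g (cst M a) = cst M a" using g(1) a unfolding aut_def is_aut_def is_iso_def by blast
    then show ?thesis using g(2) by simp
  qed
qed

end

lemma countable_cells: "countable cells"
proof (rule countable_subset)
  show "cells \<subseteq> lists (univ M)" using cell cells_C by blast
qed (simp add: countable)

lemma isomorphic_over_of_aut:
  assumes f: "is_aut L M f" and A: "A \<subseteq> univ M" "\<And>x. x \<in> A \<Longrightarrow> f x = x"
    and a: "set a \<subseteq> univ M" "map f a = b"
  shows "isomorphic_over L M A a b"
proof -
  let ?N = "gen_substruct L M (A \<union> set a)" and ?N' = "gen_substruct L M (A \<union> set b)"
  have fc: "f (cst M c) = cst M c" if "c \<in> Consts L" for c
    using f that by (simp add: is_aut_def is_iso_def)
  have cM: "cst M ` Consts L \<subseteq> univ M" using struct by (auto simp: is_struct_def)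
  have u: "univ ?N = A \<union> set a \<union> cst M ` Consts L" "univ ?N' = A \<union> set b \<union> cst M ` Consts L"
    by (simp_all add: gen_substruct_def Let_def)
  have uM: "univ ?N \<subseteq> univ M" using u A(1) a(1) cM by blast
  have img: "f ` univ ?N = univ ?N'"
  proof -
    have "f ` A = A" "f ` set a = set b" "f ` cst M ` Consts L = cst M ` Consts L"
      using A(2) a(2) fc by (auto simp: image_iff)
    then show ?thesis by (simp add: u image_Un)
  qed
  have inj: "inj_on f (univ M)" using f by (simp add: is_aut_def is_iso_def bij_betw_def)
  have "is_iso L ?N ?N' f"
    unfolding is_iso_def
  proof (intro conjI ballI)
    show "bij_betw f (univ ?N) (univ ?N')"
      using img inj uM by (auto simp: bij_betw_def intro: inj_on_subset)
  next
    fix r xs assume r: "r \<in> Rels L" and xs: "xs \<in> tuples (univ ?N) (arity L r)"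
    have "set xs \<subseteq> univ ?N" using xs by (simp add: tuples_def)
    then have "f ` set xs \<subseteq> univ ?N'" unfolding img[symmetric] by (rule image_mono)
    then have "map f xs \<in> lists (univ ?N')" by (simp add: in_lists_conv_set image_subset_iff)
    moreover have "xs \<in> lists (univ ?N)" using xs by (auto simp: tuples_def)
    moreover have "xs \<in> rel M r \<longleftrightarrow> map f xs \<in> rel M r"
    proof -
      have "xs \<in> tuples (univ M) (arity L r)" using xs uM by (auto simp: tuples_def)
      then show ?thesis using f r unfolding is_aut_def is_iso_def by blast
    qed
    ultimately show "xs \<in> rel ?N r \<longleftrightarrow> map f xs \<in> rel ?N' r"
      unfolding u by (simp add: gen_substruct_def Let_def)
  qed (use fc in \<open>simp add: gen_substruct_def Let_def\<close>)
  then show ?thesis unfolding isomorphic_over_def using A(2) a(2) by blast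
qed

text \<open>The finitely many cells whose colour occurs only finitely often are put into the base.\<close>

theorem cellular: "cellular L M"
proof -
  define fam where "fam \<kappa> = {d \<in> cells. col d = \<kappa>}" for \<kappa>
  define I where "I = {\<kappa> \<in> col ` C. infinite (fam \<kappa>)}"
  have "finite I" using fincol by (simp add: I_def)
  then obtain cs0 where cs0: "set cs0 = I" "distinct cs0" using finite_distinct_list by blast
  define n where "n = length cs0"
  define c where "c i = from_nat_into (fam (cs0 ! i))" for i
  define k where "k i = length (c i 0)" for i
  define K' where "K' = K \<union> (\<Union>\<kappa>\<in>col ` C - I. \<Union>d\<in>fam \<kappa>. set d)"
  have cs0I: "cs0 ! i \<in> I" if "i < n" for i using that cs0(1) n_def by auto
  have bc: "bij_betw (c i) UNIV (fam (cs0 ! i))" if "i < n" for i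
    unfolding c_def
  proof (rule bij_betw_from_nat_into)
    show "countable (fam (cs0 ! i))" using countable_cells by (rule countable_subset[rotated]) (auto simp: fam_def)
    show "infinite (fam (cs0 ! i))" using cs0I[OF that] by (simp add: I_def)
  qed
  have cf: "c i j \<in> fam (cs0 ! i)" if "i < n" for i j using bc[OF that] by (auto simp: bij_betw_def)
  have cC: "c i j \<in> cells" "c i j \<in> C" "col (c i j) = cs0 ! i" if "i < n" for i j
    using cf[OF that, of j] cells_C by (auto simp: fam_def)
  have cinj: "c i j = c i' j' \<longleftrightarrow> i = i' \<and> j = j'" if "i < n" "i' < n" for i i' j j'
  proof
    assume eq: "c i j = c i' j'"
    then have "cs0 ! i = cs0 ! i'" using cC that by metis
    then have "i = i'" using cs0(2) that n_def nth_eq_iff_index_eq by blast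
    then show "i = i' \<and> j = j'" using eq bc[OF that(1)] by (auto simp: bij_betw_def inj_on_def)
  qed auto
  have finK': "finite K'"
    using finK fincol by (auto simp: K'_def I_def)
  have K'X: "K' \<subseteq> univ M" using KX cell cells_C by (auto simp: K'_def fam_def)
  have cdisj: "i = i' \<and> j = j'" if "i < n" "i' < n" "x \<in> set (c i j)" "x \<in> set (c i' j')" for i i' j j' x
    using cells_unique[OF cC(1)[OF that(1)] cC(1)[OF that(2)] that(3,4)] cinj that by blast
  have K'disj: "K' \<inter> set (c i j) = {}" if i: "i < n" for i j
  proof (rule ccontr)
    assume "K' \<inter> set (c i j) \<noteq> {}"
    then obtain x where x: "x \<in> K'" "x \<in> set (c i j)" by blast
    have "x \<notin> K" using x(2) cell cC(2)[OF i] by blast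
    then obtain d where d: "d \<in> cells" "col d \<notin> I" "x \<in> set d" using x(1) by (auto simp: K'_def fam_def)
    then have "d = c i j" using cells_unique cC(1)[OF i] x(2) by blast
    then show False using d(2) cC(3)[OF i] cs0I[OF i] by simp
  qed
  have ueq: "univ M = K' \<union> (\<Union>i<n. \<Union>j. set (c i j))"
  proof
    show "K' \<union> (\<Union>i<n. \<Union>j. set (c i j)) \<subseteq> univ M" using K'X cell cC(2) by blast
    show "univ M \<subseteq> K' \<union> (\<Union>i<n. \<Union>j. set (c i j))"
    proof
      fix x assume x: "x \<in> univ M"
      show "x \<in> K' \<union> (\<Union>i<n. \<Union>j. set (c i j))"
      proof (cases "x \<in> K")
        case False
        then obtain d where d: "d \<in> cells" "x \<in> set d" using cells_cover x by blast
        show ?thesis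
        proof (cases "col d \<in> I")
          case True
          then obtain i where i: "i < n" "cs0 ! i = col d" using cs0(1) n_def by (metis in_set_conv_nth)
          then have "d \<in> c i ` UNIV" using bc[OF i(1)] d(1) by (auto simp: bij_betw_def fam_def)
          then show ?thesis using d(2) i(1) by blast
        next
          case False
          then show ?thesis using d cells_C by (auto simp: K'_def fam_def)
        qed
      qed (simp add: K'_def)
    qed
  qed
  have perm: "\<exists>f. is_aut L M f \<and> (\<forall>j. map f (c i j) = c i (\<sigma> j)) \<and>
      (\<forall>x\<in>univ M - (\<Union>j. set (c i j)). f x = x)" if i: "i < n" and \<sigma>: "bij \<sigma>" for i and \<sigma> :: "nat \<Rightarrow> nat"
  proof -
    let ?D = "fam (cs0 ! i)"
    have Dc: "?D \<subseteq> cells" by (auto simp: fam_def)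
    \<comment> \<open>The permutation \<open>\<sigma>\<close> transported along the enumeration of
      the i-th colour; cells of other colours stay in place.\<close>
    define \<tau> where "\<tau> d = (if d \<in> ?D then c i (\<sigma> (the_inv_into UNIV (c i) d)) else d)" for d
    have ci: "inj (c i)" using bc[OF i] by (simp add: bij_betw_def)
    have \<tau>c: "\<tau> (c i j) = c i (\<sigma> j)" for j
      using cf[OF i] by (simp add: \<tau>_def the_inv_into_f_f[OF ci])
    have "bij_betw \<tau> (?D \<union> (cells - ?D)) (?D \<union> (cells - ?D))"
    proof (rule bij_betw_combine)
      have "bij_betw (c i \<circ> (\<sigma> \<circ> the_inv_into UNIV (c i))) ?D ?D"
        by (intro bij_betw_trans[of _ _ UNIV] bij_betw_the_inv_into bc[OF i] \<sigma>)
      then show "bij_betw \<tau> ?D ?D" by (subst bij_betw_cong) (auto simp: \<tau>_def)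
      show "bij_betw \<tau> (cells - ?D) (cells - ?D)"
        by (subst bij_betw_cong[of _ _ id]) (auto simp: \<tau>_def)
    qed auto
    then have \<tau>: "bij_betw \<tau> cells cells" using Dc by (simp add: Un_absorb1)
    have \<tau>col: "col (\<tau> d) = col d" if "d \<in> cells" for d
      using that cC(3)[OF i] by (auto simp: \<tau>_def fam_def)
    have "map (permute \<tau>) (c i j) = c i (\<sigma> j)" for j
      using map_permute[OF \<tau> \<tau>col cC(1)[OF i]] \<tau>c by simp
    moreover have "permute \<tau> x = x" if x: "x \<in> univ M - (\<Union>j. set (c i j))" for x
    proof (cases "\<exists>d\<in>cells. x \<in> set d")
      case True
      then obtain d where d: "d \<in> cells" "x \<in> set d" by blast
      have "d \<notin> ?D"
      proof
        assume "d \<in> ?D"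
        then have "d \<in> c i ` UNIV" using bc[OF i] by (simp add: bij_betw_def)
        then show False using d x by blast
      qed
      then have "\<tau> d = d" by (simp add: \<tau>_def)
      then have "map (permute \<tau>) d = d" using map_permute[OF \<tau> \<tau>col d(1)] by simp
      then show ?thesis using d(2) by (metis map_eq_conv map_ident)
    qed (use permute_id in blast)
    ultimately show ?thesis using permute_aut[OF \<tau> \<tau>col] by blast
  qed
  have iso: "isomorphic_over L M K' (c i j) (c i j')" if i: "i < n" for i j j'
  proof -
    \<comment> \<open>The transposition of j and j' gives an automorphism that fixes K' pointwise
      and carries one tuple to the other.\<close>
    let ?s = "\<lambda>x. if x = j then j' else if x = j' then j else x"
    have "bij ?s" by (rule o_bij[of ?s]) (auto simp: fun_eq_iff)
    then obtain f where f: "is_aut L M f" "\<forall>j. map f (c i j) = c i (?s j)"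
      "\<forall>x\<in>univ M - (\<Union>j. set (c i j)). f x = x" using perm[OF i] by blast
    show ?thesis
    proof (rule isomorphic_over_of_aut[OF f(1) K'X])
      show "f x = x" if "x \<in> K'" for x using f(3) that K'X K'disj[OF i] by blast
      show "set (c i j) \<subseteq> univ M" using cell cC(2)[OF i] by blast
      show "map f (c i j) = c i j'" using f(2) by simp
    qed
  qed
  show ?thesis
    unfolding cellular_def
  proof (rule exI[of _ n], rule exI[of _ k], rule exI[of _ K'], rule exI[of _ c], intro conjI allI impI)
    show "finite K'" by (rule finK')
    show "0 < k i" if "i < n" for i using cell[OF cC(2)[OF that]] by (simp add: k_def)
    show "length (c i j) = k i" if "i < n" for i j
      unfolding k_def by (rule len) (use cC that in auto)
    show "distinct (c i j)" if "i < n" for i j using cell[OF cC(2)[OF that]] by blast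
    show "univ M = K' \<union> (\<Union>i<n. \<Union>j. set (c i j))" by (rule ueq)
    show "K' \<inter> set (c i j) = {}" if "i < n" for i j by (rule K'disj[OF that])
    show "disjoint_family_on (\<lambda>(i, j). set (c i j)) ({..<n} \<times> UNIV)"
      unfolding disjoint_family_on_def using cdisj by auto
    show "isomorphic_over L M K' (c i j) (c i j')" if "i < n" for i j j' by (rule iso[OF that])
    show "\<exists>f. is_aut L M f \<and> (\<forall>j. map f (c i j) = c i (\<sigma> j)) \<and>
      (\<forall>x\<in>univ M - (\<Union>j. set (c i j)). f x = x)" if "i < n" "bij \<sigma>" for i and \<sigma> :: "nat \<Rightarrow> nat"
      by (rule perm[OF that])
  qed
qed

end

section \<open>From the cell decomposition to mutual algebraicity\<close>

text \<open>Shannon expansion: induction on \<open>\<Theta>\<close> splits D by the truth value of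
  one formula. With \<open>\<Theta>\<close> empty, D is constant on A, and any member of S yields a
  contradiction and a tautology.\<close>

lemma bool_comb_of_determined:
  assumes "finite \<Theta>" "\<Theta> \<subseteq> S" "S \<noteq> {}"
    and "\<And>v w. v \<in> A \<Longrightarrow> w \<in> A \<Longrightarrow> (\<And>\<theta>. \<theta> \<in> \<Theta> \<Longrightarrow> sat M v \<theta> \<longleftrightarrow> sat M w \<theta>) \<Longrightarrow> D v \<longleftrightarrow> D w"
  shows "\<exists>q\<in>bool_combs S. \<forall>v\<in>A. sat M v q \<longleftrightarrow> D v"
  using assms(1,2,4)
proof (induction \<Theta> arbitrary: D rule: finite_induct)
  case empty
  obtain s where s: "s \<in> bool_combs S" using assms(3) bool_combs.base by blast
  have "Conj s (Neg s) \<in> bool_combs S" "Neg (Conj s (Neg s)) \<in> bool_combs S"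
    using s by (auto intro: bool_combs.intros)
  moreover have "(\<forall>v\<in>A. D v) \<or> (\<forall>v\<in>A. \<not> D v)" using empty(2) by blast
  ultimately show ?case by (metis sat.simps(3) sat.simps(4))
next
  case (insert \<theta> \<Theta>)
  \<comment> \<open>The cofactor of D for value b, quantified over w so that it depends on v only
    through the remaining formulas.\<close>
  define E where "E b v \<longleftrightarrow> (\<exists>w\<in>A. (\<forall>\<eta>\<in>\<Theta>. sat M v \<eta> \<longleftrightarrow> sat M w \<eta>) \<and> sat M w \<theta> = b \<and> D w)" for b v
  have "\<exists>q\<in>bool_combs S. \<forall>v\<in>A. sat M v q \<longleftrightarrow> E b v" for b
  proof (rule insert.IH)
    show "\<Theta> \<subseteq> S" using insert.prems by blast
    show "E b v \<longleftrightarrow> E b w" if "\<And>\<eta>. \<eta> \<in> \<Theta> \<Longrightarrow> sat M v \<eta> \<longleftrightarrow> sat M w \<eta>" for v w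
      unfolding E_def using that by simp
  qed
  then obtain q where q: "\<And>b. q b \<in> bool_combs S" "\<And>b v. v \<in> A \<Longrightarrow> sat M v (q b) \<longleftrightarrow> E b v" by metis
  have ED: "E (sat M v \<theta>) v \<longleftrightarrow> D v" if v: "v \<in> A" for v
  proof
    assume "E (sat M v \<theta>) v"
    then obtain w where w: "w \<in> A" "\<forall>\<eta>\<in>\<Theta>. sat M v \<eta> \<longleftrightarrow> sat M w \<eta>" "sat M w \<theta> = sat M v \<theta>" "D w"
      unfolding E_def by blast
    have "D v \<longleftrightarrow> D w" by (rule insert.prems(2)[OF v w(1)]) (use w in auto)
    then show "D v" using w(4) by simp
  qed (use v in \<open>auto simp: E_def\<close>)
  have \<theta>: "\<theta> \<in> bool_combs S" using insert.prems by (auto intro: bool_combs.base)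
  let ?q = "Neg (Conj (Neg (Conj \<theta> (q True))) (Neg (Conj (Neg \<theta>) (q False))))"
  have "?q \<in> bool_combs S" using \<theta> q(1) by (intro bool_combs.neg bool_combs.conj)
  moreover have "sat M v ?q \<longleftrightarrow> D v" if "v \<in> A" for v
    using ED[OF that] q(2)[OF that] by (cases "sat M v \<theta>") auto
  ultimately show ?case by blast
qed

lemma finite_set_trm: "finite (set_trm t)"
  by (cases t) auto

lemma finite_consts: "finite (set2_fm p)"
  by (induction p) (auto simp: finite_set_trm)

lemma Plus_restrict: "S \<subseteq> B <+> X \<Longrightarrow> Inr -` S \<subseteq> A \<Longrightarrow> S \<subseteq> B <+> A"
proof
  fix x assume "S \<subseteq> B <+> X" "Inr -` S \<subseteq> A" "x \<in> S"
  then show "x \<in> B <+> A" by (cases x) auto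
qed

lemma fm_of_params:
  "fm_of (lang_expand L X) p \<Longrightarrow> Inr -` set2_fm p \<subseteq> A \<Longrightarrow> fm_of (lang_expand L A) p"
proof (induction p)
  case (Eq s t)
  then show ?case using Plus_restrict[of "set_trm s" "Consts L" X A] Plus_restrict[of "set_trm t" "Consts L" X A]
    by (simp add: set_trm_of)
next
  case (Rel r ts)
  have "trm_of (lang_expand L A) t" if t: "t \<in> set ts" for t
  proof -
    have "set_trm t \<subseteq> Consts L <+> X" using Rel t by (auto simp: set_trm_of)
    moreover have "Inr -` set_trm t \<subseteq> A" using Rel(2) t by auto
    ultimately show ?thesis using Plus_restrict by (simp add: set_trm_of)
  qed
  then show ?case using Rel by simp
qed auto

lemma finite_params:
  assumes "fm_of (lang_expand L X) p"
  shows "\<exists>A\<subseteq>X. finite A \<and> fm_of (lang_expand L A) p"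
proof -
  let ?A = "Inr -` set2_fm p"
  have "set2_fm p \<subseteq> Consts L <+> X" using set_fm_of[OF assms] by simp
  then have "?A \<subseteq> X" by auto
  moreover have "finite ?A" using finite_consts by (rule finite_vimageI) simp
  ultimately show ?thesis using fm_of_params[OF assms] by blast
qed

text \<open>D at v depends only on the orbit of the tuple listing K followed by the values of v on
  W, and an orbit is cut out by one of finitely many isolating formulas. D is the disjunction of
  those that occur, with the elements of K put in as constants.\<close>

lemma invariant_definable:
  fixes M :: "('r, 'c, 'a) fostruct"
  assumes M: "is_struct L M" "countable (univ M)" and fin: "finite_types L M"
    and K: "finite K" "K \<subseteq> univ M" and W: "finite W"
    and local: "\<And>v w. (\<And>x. x \<in> W \<Longrightarrow> v x = w x) \<Longrightarrow> D v \<longleftrightarrow> D w"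
    and inv: "\<And>g v. g \<in> aut L M \<Longrightarrow> (\<And>x. x \<in> K \<Longrightarrow> g x = x) \<Longrightarrow> v \<in> assignments M \<Longrightarrow> D v \<Longrightarrow> D (g \<circ> v)"
  shows "\<exists>\<psi>. fm_of (lang_expand L (univ M)) \<psi> \<and> fv \<psi> = W \<and>
    (\<forall>v\<in>assignments M. sat (struct_expand M) v \<psi> \<longleftrightarrow> D v)"
proof -
  let ?MM = "struct_expand M"
  obtain ks where ks: "set ks = K" using K(1) finite_list by blast
  obtain ws where ws: "set ws = W" using W finite_list by blast
  define N where "N = length ks"
  define n where "n = N + length ws"
  \<comment> \<open>The first N variables become names for K, the next ones the variables of
    W.\<close>
  define \<tau> :: "nat \<Rightarrow> ('c + 'a) trm" where
    "\<tau> i = (if i < N then Cst (Inr (ks ! i)) else if i < n then Var (ws ! (i - N)) else Var 0)" for i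
  define u where "u v = (\<lambda>i. trm_val ?MM v (\<tau> i))" for v :: "nat \<Rightarrow> 'a"
  have ua: "u v \<in> assignments M" if "v \<in> assignments M" for v
  proof -
    have "ks ! i \<in> univ M" if "i < N" for i using that K(2) ks N_def by (metis nth_mem subsetD)
    moreover have "v j \<in> univ M" for j using that by (auto simp: assignments_def)
    ultimately have "u v i \<in> univ M" for i by (auto simp: u_def \<tau>_def)
    then show ?thesis by (auto simp: assignments_def)
  qed
  obtain \<Phi> where \<Phi>: "finite \<Phi>" "\<forall>p\<in>\<Phi>. complete_fm L M n p" "\<forall>v\<in>assignments M. \<exists>p\<in>\<Phi>. sat M v p"
    using finite_typesD[OF fin, of n] by (elim exE conjE)
  define \<Psi> where "\<Psi> = {p \<in> \<Phi>. \<exists>v\<in>assignments M. D v \<and> sat M (u v) p}"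
  have "finite \<Psi>" using \<Phi>(1) by (simp add: \<Psi>_def)
  then obtain ps where ps: "set ps = \<Psi>" using finite_list by blast
  define \<psi>0 where "\<psi>0 = subst Inl (Disjs ps) \<tau>"
  have neM: "univ M \<noteq> {}" using M(1) by (simp add: is_struct_def)
  have \<psi>0: "sat ?MM v \<psi>0 \<longleftrightarrow> D v" if v: "v \<in> assignments M" for v
  proof -
    have "sat ?MM v \<psi>0 \<longleftrightarrow> sat M (u v) (Disjs ps)"
      unfolding \<psi>0_def u_def by (rule sat_subst) simp_all
    also have "\<dots> \<longleftrightarrow> D v"
    proof
      assume "sat M (u v) (Disjs ps)"
      then obtain p where p: "p \<in> \<Psi>" "sat M (u v) p" by (auto simp: sat_Disjs[OF neM] ps)
      then obtain w where w: "w \<in> assignments M" "D w" "sat M (u w) p" "complete_fm L M n p"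
        using \<Phi>(2) by (auto simp: \<Psi>_def)
      obtain f where f: "is_iso L M M f" "\<forall>i<n. f (u w i) = u v i"
        using complete_fm_conj[OF M finite_types_atomic[OF fin] w(4) ua[OF w(1)] w(3) ua[OF v] p(2)] by blast
      let ?g = "\<lambda>x. if x \<in> univ M then f x else x"
      have "?g \<in> aut L M" by (rule autI) (simp add: is_aut_def f(1))
      have uw: "u w i \<in> univ M" for i using ua[OF w(1)] by (auto simp: assignments_def)
      have "?g x = x" if "x \<in> K" for x
      proof -
        obtain i where i: "i < N" "x = ks ! i" using \<open>x \<in> K\<close> ks N_def by (metis in_set_conv_nth)
        then have "u w i = x" "u v i = x" "i < n" by (auto simp: u_def \<tau>_def n_def)
        then show ?thesis using f(2) by auto
      qed
      then have "D (?g \<circ> w)" using inv[OF \<open>?g \<in> aut L M\<close> _ w(1,2)] by blast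
      moreover have "(?g \<circ> w) x = v x" if "x \<in> W" for x
      proof -
        obtain i where i: "i < length ws" "x = ws ! i" using \<open>x \<in> W\<close> ws by (metis in_set_conv_nth)
        then have "u w (N + i) = w x" "u v (N + i) = v x" "N + i < n" by (auto simp: u_def \<tau>_def n_def)
        then have "f (w x) = v x" "w x \<in> univ M" using f(2) uw by metis+
        then show ?thesis by simp
      qed
      ultimately show "D v" using local[of "?g \<circ> w" v] by blast
    next
      assume "D v"
      moreover obtain p where "p \<in> \<Phi>" "sat M (u v) p" using \<Phi>(3) ua[OF v] by blast
      ultimately have "p \<in> \<Psi>" using v by (auto simp: \<Psi>_def)
      then show "sat M (u v) (Disjs ps)" using \<open>sat M (u v) p\<close> by (auto simp: sat_Disjs[OF neM] ps)
    qed
    finally show ?thesis .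
  qed
  have psn: "fm_of L p \<and> fv p \<subseteq> {..<n}" if "p \<in> set ps" for p
    using that \<Phi>(2) by (auto simp: ps \<Psi>_def complete_fm_def)
  have dn: "fv (Disjs ps) \<subseteq> {..<n}" using psn by auto
  have "trm_of (lang_expand L (univ M)) (\<tau> i)" if "i < n" for i
    using K(2) ks N_def by (auto simp: \<tau>_def)
  then have fm: "fm_of (lang_expand L (univ M)) \<psi>0"
    unfolding \<psi>0_def by (intro fm_of_subst[of L]) (use psn dn in auto)
  have fv: "fv \<psi>0 \<subseteq> W"
  proof -
    have "fv_trm (\<tau> i) \<subseteq> W" if "i < n" for i
      using that ws by (auto simp: \<tau>_def n_def split: if_splits)
    then show ?thesis using dn unfolding \<psi>0_def fv_subst by blast
  qed
  \<comment> \<open>The equations x = x make the free variables exactly W, which matters because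
    mutual algebraicity is judged on the tuples listed by the free variables.\<close>
  let ?\<psi> = "Conjs (\<psi>0 # map (\<lambda>x. Eq (Var x) (Var x)) ws)"
  have "fv ?\<psi> = W" using fv ws by auto
  moreover have "fm_of (lang_expand L (univ M)) ?\<psi>" using fm by auto
  moreover have "sat ?MM v ?\<psi> \<longleftrightarrow> D v" if "v \<in> assignments M" for v
    using \<psi>0[OF that] neM by (simp add: sat_Conjs)
  ultimately show ?thesis by blast
qed

lemma mutually_algebraic_relI:
  assumes "\<And>m. m \<in> A \<Longrightarrow> finite {b \<in> R. m \<in> set b} \<and> card {b \<in> R. m \<in> set b} \<le> N"
  shows "mutually_algebraic_rel A R"
  unfolding mutually_algebraic_rel_def using assms by blast

section \<open>Incidence with cells\<close>

context cell_decomp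
begin

definition in_cell :: "nat set \<Rightarrow> 'b \<Rightarrow> (nat \<Rightarrow> nat) \<Rightarrow> (nat \<Rightarrow> 'a) \<Rightarrow> bool" where
  "in_cell W \<kappa> l v \<longleftrightarrow> (\<exists>c\<in>C. col c = \<kappa> \<and> (\<forall>x\<in>W. l x < length c \<and> v x = c ! l x))"

lemma length_bound: "\<exists>N. \<forall>c\<in>C. length c \<le> N"
proof -
  define r where "r \<kappa> = (SOME c. c \<in> C \<and> col c = \<kappa>)" for \<kappa>
  have "length c = length (r (col c))" if "c \<in> C" for c
  proof -
    have "r (col c) \<in> C \<and> col (r (col c)) = col c" unfolding r_def by (rule someI[of _ c]) (simp add: that)
    then show ?thesis using len[of c "r (col c)"] that by simp
  qed
  then have "length ` C \<subseteq> (\<lambda>\<kappa>. length (r \<kappa>)) ` col ` C" by force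
  then have "finite (length ` C)" by (rule finite_subset) (simp add: fincol)
  then show ?thesis by (auto intro!: exI[of _ "Max (length ` C)"])
qed

lemma inj_set_cells: "S \<subseteq> cells \<Longrightarrow> inj_on set S"
  using cells_set_inj by (intro inj_onI) blast

text \<open>Automorphisms fixing K preserve C and the colours, so the relation is invariant. A tuple
  in it that contains m lies inside the single cell around m, which bounds the number of such tuples
  by a power of the maximal cell size.\<close>

lemma in_cell_definable:
  assumes fin: "finite_types L M" and W: "finite W"
  shows "\<exists>\<psi>. fm_of (lang_expand L (univ M)) \<psi> \<and> mutually_algebraic_fm (struct_expand M) \<psi> \<and>
    (\<forall>v\<in>assignments M. sat (struct_expand M) v \<psi> \<longleftrightarrow> in_cell W \<kappa> l v)"
proof -
  have "\<exists>\<psi>. fm_of (lang_expand L (univ M)) \<psi> \<and> fv \<psi> = W \<and>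
    (\<forall>v\<in>assignments M. sat (struct_expand M) v \<psi> \<longleftrightarrow> in_cell W \<kappa> l v)"
  proof (rule invariant_definable[OF struct countable fin finK KX W])
    show "in_cell W \<kappa> l v \<longleftrightarrow> in_cell W \<kappa> l w" if "\<And>x. x \<in> W \<Longrightarrow> v x = w x" for v w
      using that by (auto simp: in_cell_def)
    show "in_cell W \<kappa> l (g \<circ> v)"
      if g: "g \<in> aut L M" "\<And>x. x \<in> K \<Longrightarrow> g x = x" and v: "in_cell W \<kappa> l v" for g v
    proof -
      obtain c where c: "c \<in> C" "col c = \<kappa>" "\<forall>x\<in>W. l x < length c \<and> v x = c ! l x"
        using v unfolding in_cell_def by blast
      then show ?thesis using inv[OF g c(1)] unfolding in_cell_def
        by (intro bexI[of _ "map g c"]) auto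
    qed
  qed
  then obtain \<psi> where \<psi>: "fm_of (lang_expand L (univ M)) \<psi>" "fv \<psi> = W"
    "\<forall>v\<in>assignments M. sat (struct_expand M) v \<psi> \<longleftrightarrow> in_cell W \<kappa> l v" by blast
  obtain N where N: "\<forall>c\<in>C. length c \<le> N" using length_bound by blast
  let ?R = "defined_rel (struct_expand M) \<psi>" and ?n = "card W"
  have "mutually_algebraic_rel (univ M) ?R"
  proof (rule mutually_algebraic_relI)
    fix m assume m: "m \<in> univ M"
    have sub: "\<exists>c\<in>C. m \<in> set c \<and> set b \<subseteq> set c \<and> length b = ?n" if b: "b \<in> ?R" "m \<in> set b" for b
    proof -
      obtain v where v: "b = map v (sorted_list_of_set W)" "v \<in> assignments M" "in_cell W \<kappa> l v"
        using b(1) \<psi> by (auto simp: defined_rel_def)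
      then obtain c where c: "c \<in> C" "\<forall>x\<in>W. l x < length c \<and> v x = c ! l x"
        unfolding in_cell_def by blast
      then have "set b \<subseteq> set c" using v(1) W by auto
      then show ?thesis using c(1) b(2) v(1) W by auto
    qed
    show "finite {b \<in> ?R. m \<in> set b} \<and> card {b \<in> ?R. m \<in> set b} \<le> N ^ ?n"
    proof (cases "\<exists>c\<in>C. m \<in> set c")
      case True
      then obtain c where c: "c \<in> C" "m \<in> set c" by blast
      have s: "{b \<in> ?R. m \<in> set b} \<subseteq> {b. set b \<subseteq> set c \<and> length b = ?n}"
        using sub same_set[OF c(1) _ c(2)] by blast
      have f: "finite {b. set b \<subseteq> set c \<and> length b = ?n}" by (rule finite_lists_length_eq) simp
      have "card {b. set b \<subseteq> set c \<and> length b = ?n} = card (set c) ^ ?n" by (rule card_lists_length_eq) simp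
      also have "\<dots> \<le> N ^ ?n" using N c(1) card_length[of c] by (intro power_mono) (auto intro: order_trans)
      finally show ?thesis using card_mono[OF f s] finite_subset[OF s f] by simp
    next
      case False
      then have "{b \<in> ?R. m \<in> set b} = {}" using sub by blast
      then show ?thesis by (simp only: finite.emptyI card.empty) simp
    qed
  qed
  then show ?thesis using \<psi>(1,3) unfolding mutually_algebraic_fm_def by auto
qed

lemma eq_const_mutually_algebraic:
  "mutually_algebraic_fm (struct_expand M) (Eq (Var x) (Cst (Inr b)))"
  unfolding mutually_algebraic_fm_def
proof (rule mutually_algebraic_relI)
  fix m
  let ?R = "defined_rel (struct_expand M) (Eq (Var x) (Cst (Inr b)))"
  have s: "{b \<in> ?R. m \<in> set b} \<subseteq> {[m]}" by (auto simp: defined_rel_def)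
  show "finite {b \<in> ?R. m \<in> set b} \<and> card {b \<in> ?R. m \<in> set b} \<le> 1"
    using finite_subset[OF s] card_mono[OF _ s] by simp
qed

text \<open>For each cell d met by v outside the base, the incidence of all variables with value in
  d yields a cell \<open>e d\<close> of the same colour holding their w-values at the same places.
  Amalgamation carries each d to \<open>e d\<close> while the cells bs are listed on both sides and
  so stay fixed.\<close>

lemma same_incidences_conj:
  assumes V: "finite V" and v: "v \<in> assignments M" and w: "w \<in> assignments M"
    and bs: "set bs \<subseteq> C" "distinct (map set bs)"
    and base: "\<And>x b. x \<in> V \<Longrightarrow> b \<in> K \<union> \<Union>(set ` set bs) \<Longrightarrow> v x = b \<longleftrightarrow> w x = b"
    and inc: "\<And>W \<kappa> l. W \<subseteq> V \<Longrightarrow> \<kappa> \<in> col ` C \<Longrightarrow> in_cell W \<kappa> l v \<longleftrightarrow> in_cell W \<kappa> l w"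
  shows "\<exists>g\<in>aut L M. (\<forall>x\<in>K \<union> \<Union>(set ` set bs). g x = x) \<and> (\<forall>x\<in>V. g (v x) = w x)"
proof -
  let ?B = "K \<union> \<Union>(set ` set bs)"
  define V' where "V' = {x \<in> V. v x \<notin> ?B}"
  have V'w: "w x \<notin> ?B" if "x \<in> V'" for x
  proof
    assume "w x \<in> ?B"
    moreover have "x \<in> V" "v x \<notin> ?B" using that by (auto simp: V'_def)
    ultimately show False using base[of x "w x"] by metis
  qed
  have vx: "v x \<in> univ M - K" "w x \<in> univ M - K" if "x \<in> V'" for x
    using that V'w[OF that] v w by (auto simp: V'_def assignments_def)
  define cl where "cl x = pick (set (SOME c. c \<in> C \<and> v x \<in> set c))" for x
  have cl: "cl x \<in> cells \<and> v x \<in> set (cl x)" if "x \<in> V'" for x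
  proof -
    have "(SOME c. c \<in> C \<and> v x \<in> set c) \<in> C \<and> v x \<in> set (SOME c. c \<in> C \<and> v x \<in> set c)"
      by (rule someI_ex) (use cover[OF vx(1)[OF that]] in blast)
    then show ?thesis using pick unfolding cl_def cells_def by auto
  qed
  have finV': "finite V'" using V by (simp add: V'_def)
  then obtain ds where ds: "set ds = cl ` V'" "distinct ds" using finite_distinct_list[of "cl ` V'"] by auto
  have dsc: "d \<in> cells" "d \<in> C" if "d \<in> set ds" for d using that ds(1) cl cells_C by auto
  define W where "W d = {x \<in> V'. v x \<in> set d}" for d
  define idx where "idx d a = (SOME l. l < length d \<and> d ! l = a)" for d :: "'a list" and a
  have idx: "idx d a < length d \<and> d ! idx d a = a" if "a \<in> set d" for d a
    unfolding idx_def by (rule someI_ex) (use that in \<open>simp add: in_set_conv_nth\<close>)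
  have "\<exists>c\<in>C. col c = col d \<and> (\<forall>x\<in>W d. idx d (v x) < length c \<and> w x = c ! idx d (v x))"
    if d: "d \<in> set ds" for d
  proof -
    have "in_cell (W d) (col d) (\<lambda>x. idx d (v x)) v"
      unfolding in_cell_def using dsc(2)[OF d] idx by (intro bexI[of _ d]) (auto simp: W_def)
    then show ?thesis using inc[of "W d" "col d"] dsc(2)[OF d] by (auto simp: W_def V'_def in_cell_def)
  qed
  then obtain e where e: "\<And>d. d \<in> set ds \<Longrightarrow> e d \<in> C" "\<And>d. d \<in> set ds \<Longrightarrow> col (e d) = col d"
    "\<And>d x. d \<in> set ds \<Longrightarrow> x \<in> W d \<Longrightarrow> idx d (v x) < length (e d) \<and> w x = e d ! idx d (v x)" by metis
  have wd: "\<exists>x\<in>W d. w x \<in> set (e d)" if d: "d \<in> set ds" for d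
  proof -
    obtain x where x: "x \<in> V'" "d = cl x" using d ds(1) by blast
    then have "x \<in> W d" using cl by (simp add: W_def)
    then show ?thesis using e(3)[OF d] nth_mem by metis
  qed
  \<comment> \<open>If d and d' were matched with one cell, w would put two variables, one for each
    of d and d', into that cell. The same incidence read back at v puts their values in a common
    cell, so d and d' coincide.\<close>
  have inj_e: "d = d'" if d: "d \<in> set ds" "d' \<in> set ds" and eq: "set (e d) = set (e d')" for d d'
  proof -
    obtain x y where x: "x \<in> W d" "w x \<in> set (e d)" and y: "y \<in> W d'" "w y \<in> set (e d)"
      using wd[OF d(1)] wd[OF d(2)] eq by blast
    let ?l = "\<lambda>z. idx (e d) (w z)"
    have "in_cell {x, y} (col (e d)) ?l w"
      unfolding in_cell_def using e(1)[OF d(1)] idx x y by (intro bexI[of _ "e d"]) auto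
    then have "in_cell {x, y} (col (e d)) ?l v"
      using inc[of "{x, y}" "col (e d)" ?l] x(1) y(1) e(1)[OF d(1)] by (auto simp: W_def V'_def)
    then obtain c where c: "c \<in> C" "v x \<in> set c" "v y \<in> set c"
      unfolding in_cell_def by (metis insertCI nth_mem)
    have "set c = set d" "set c = set d'"
      using same_set[OF c(1) dsc(2)[OF d(1)] c(2)] same_set[OF c(1) dsc(2)[OF d(2)] c(3)] x(1) y(1)
      by (auto simp: W_def)
    then show ?thesis using cells_set_inj dsc(1) d by blast
  qed
  have notbs: "set c \<notin> set ` set bs" if "c \<in> C" "a \<in> set c" "a \<notin> ?B" for c a
    using that by blast
  have "\<exists>g\<in>aut L M. (\<forall>x\<in>K. g x = x) \<and> map (map g) (bs @ ds) = bs @ map e ds"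
  proof (rule amalg)
    show "set (bs @ ds) \<subseteq> C" "set (bs @ map e ds) \<subseteq> C" using bs(1) dsc(2) e(1) by auto
    have "set d \<notin> set ` set bs" if "d \<in> set ds" for d
    proof -
      obtain x where "x \<in> W d" using wd[OF \<open>d \<in> set ds\<close>] by blast
      then show ?thesis using notbs[OF dsc(2)[OF \<open>d \<in> set ds\<close>]] by (auto simp: W_def V'_def)
    qed
    moreover have "distinct (map set ds)"
      using ds(2) inj_set_cells[of "set ds"] dsc(1) by (auto simp: distinct_map)
    ultimately show "distinct (map set (bs @ ds))" using bs(2) by auto
    have "set (e d) \<notin> set ` set bs" if "d \<in> set ds" for d
    proof -
      obtain x where "x \<in> W d" "w x \<in> set (e d)" using wd[OF \<open>d \<in> set ds\<close>] by blast
      then show ?thesis using notbs[OF e(1)[OF \<open>d \<in> set ds\<close>]] V'w by (auto simp: W_def)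
    qed
    moreover have "distinct (map set (map e ds))"
      using ds(2) inj_e by (auto simp: distinct_map comp_def intro!: inj_onI)
    ultimately show "distinct (map set (bs @ map e ds))" using bs(2) by auto
    show "map col (bs @ ds) = map col (bs @ map e ds)" using e(2) by simp
  qed
  then obtain g where g: "g \<in> aut L M" "\<forall>x\<in>K. g x = x" "map (map g) bs = bs" "map (map g) ds = map e ds"
    by auto
  have gbs: "g x = x" if xB: "x \<in> ?B" for x
  proof (cases "x \<in> K")
    case False
    then obtain b where b: "b \<in> set bs" "x \<in> set b" using xB by blast
    have "map g b = b" using g(3) b(1) by (metis map_eq_conv map_ident)
    then show ?thesis using b(2) by (metis map_eq_conv map_ident)
  qed (use g(2) in simp)
  moreover have "g (v x) = w x" if x: "x \<in> V" for x
  proof (cases "x \<in> V'")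
    case False
    then have "v x \<in> ?B" using x by (simp add: V'_def)
    then show ?thesis using base[OF x, of "v x"] gbs by simp
  next
    case True
    let ?d = "cl x"
    have d: "?d \<in> set ds" "v x \<in> set ?d" using True ds(1) cl by auto
    then have xW: "x \<in> W ?d" using True by (simp add: W_def)
    have "map g ?d = e ?d" using g(4) d(1) by (metis map_eq_conv map_map comp_apply)
    then have "g (v x) = e ?d ! idx ?d (v x)" using idx[OF d(2)] by (metis nth_map)
    then show ?thesis using e(3)[OF d(1) xW] by simp
  qed
  ultimately show ?thesis using g(1) by blast
qed

text \<open>The incidences of the variables with cells, together with the equations between
  variables and elements of a finite base containing the parameters of p, determine the assignment
  up to an automorphism fixing the base, hence the truth of p.\<close>

theorem mutually_algebraic:
  assumes fin: "finite_types L M"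
  shows "mutually_algebraic L M"
  unfolding mutually_algebraic_def Let_def
proof (intro allI impI)
  let ?MM = "struct_expand M" and ?LM = "lang_expand L (univ M)"
  let ?S = "{s. fm_of ?LM s \<and> mutually_algebraic_fm ?MM s}"
  fix p assume p: "fm_of ?LM p"
  obtain A where A: "A \<subseteq> univ M" "finite A" "fm_of (lang_expand L A) p" using finite_params[OF p] by blast
  define V where "V = fv p"
  have V: "finite V" by (simp add: V_def)
  define cl where "cl a = (SOME d. d \<in> cells \<and> a \<in> set d)" for a
  have cl: "cl a \<in> cells \<and> a \<in> set (cl a)" if "a \<in> A - K" for a
    unfolding cl_def by (rule someI_ex) (use cells_cover that A(1) in blast)
  obtain bs where bs: "set bs = cl ` (A - K)" "distinct bs"
    using finite_distinct_list[of "cl ` (A - K)"] A(2) by auto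
  have bsc: "set bs \<subseteq> cells" using bs(1) cl by auto
  have bsC: "set bs \<subseteq> C" using bsc cells_C by blast
  have bsd: "distinct (map set bs)"
    using bs(2) inj_set_cells[OF bsc] by (simp add: distinct_map)
  \<comment> \<open>Amalgamation moves whole cells, so a parameter is held fixed by holding its
    entire cell.\<close>
  define B where "B = K \<union> \<Union>(set ` set bs)"
  have finB: "finite B" using finK by (simp add: B_def)
  have AB: "A \<subseteq> B" using cl bs(1) by (auto simp: B_def)
  have BX: "B \<subseteq> univ M"
    using KX cell bsC by (auto simp: B_def)
  obtain N where N: "\<forall>c\<in>C. length c \<le> N" using length_bound by blast
  \<comment> \<open>Places range over extensional functions bounded by the maximal cell size N,
    which keeps the set of atoms finite.\<close>
  define \<Xi> where "\<Xi> = Pow V \<times> col ` C \<times> (V \<rightarrow>\<^sub>E {..N})"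
  have "finite \<Xi>" using V fincol by (auto simp: \<Xi>_def finite_PiE)
  define at where "at = (\<lambda>(W, \<kappa>, l). SOME \<psi>. \<psi> \<in> ?S \<and>
    (\<forall>v\<in>assignments M. sat ?MM v \<psi> \<longleftrightarrow> in_cell W \<kappa> l v))"
  have at: "at (W, \<kappa>, l) \<in> ?S \<and> (\<forall>v\<in>assignments M. sat ?MM v (at (W, \<kappa>, l)) \<longleftrightarrow> in_cell W \<kappa> l v)"
    if "W \<subseteq> V" for W \<kappa> l
    unfolding at_def prod.case
    by (rule someI_ex) (use in_cell_definable[OF fin finite_subset[OF that V]] in blast)
  define \<Theta> where "\<Theta> = (\<lambda>(x, b). Eq (Var x) (Cst (Inr b))) ` (V \<times> B) \<union> at ` \<Xi>"
  have "finite \<Theta>" using V finB \<open>finite \<Xi>\<close> by (simp add: \<Theta>_def)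
  moreover have "\<Theta> \<subseteq> ?S"
  proof -
    have "at \<xi> \<in> ?S" if "\<xi> \<in> \<Xi>" for \<xi> using that at by (cases \<xi>) (auto simp: \<Xi>_def)
    moreover have "Eq (Var x) (Cst (Inr b)) \<in> ?S" if "b \<in> B" for x b
      using that BX eq_const_mutually_algebraic by auto
    ultimately show ?thesis
      unfolding \<Theta>_def by (intro Un_least image_subsetI) (simp_all only: mem_Sigma_iff split_paired_all prod.case)
  qed
  moreover have "?S \<noteq> {}"
  proof -
    obtain a where "a \<in> univ M" using struct by (auto simp: is_struct_def)
    then have "Eq (Var 0) (Cst (Inr a)) \<in> ?S" using eq_const_mutually_algebraic by auto
    then show ?thesis by blast
  qed
  moreover have "sat ?MM v p \<longleftrightarrow> sat ?MM w p"
    if v: "v \<in> assignments M" and w: "w \<in> assignments M"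
      and eq: "\<And>\<theta>. \<theta> \<in> \<Theta> \<Longrightarrow> sat ?MM v \<theta> \<longleftrightarrow> sat ?MM w \<theta>" for v w
  proof -
    have "\<exists>g\<in>aut L M. (\<forall>x\<in>K \<union> \<Union>(set ` set bs). g x = x) \<and> (\<forall>x\<in>V. g (v x) = w x)"
    proof (rule same_incidences_conj[OF V v w bsC bsd])
      show "v x = b \<longleftrightarrow> w x = b" if "x \<in> V" "b \<in> K \<union> \<Union>(set ` set bs)" for x b
      proof -
        have "Eq (Var x) (Cst (Inr b)) \<in> \<Theta>" using that by (force simp: \<Theta>_def B_def)
        then show ?thesis using eq by fastforce
      qed
      show "in_cell W \<kappa> l v \<longleftrightarrow> in_cell W \<kappa> l w" if W: "W \<subseteq> V" and \<kappa>: "\<kappa> \<in> col ` C" for W \<kappa> l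
      \<comment> \<open>A place above N exists in no cell, so such an incidence is false at both
        assignments.\<close>
      proof (cases "\<forall>x\<in>W. l x \<le> N")
        case True
        \<comment> \<open>Only values on W matter; this normal form of l is an index in
          \<open>\<Xi>\<close>.\<close>
        let ?l = "\<lambda>x. if x \<in> V then (if x \<in> W then l x else 0) else undefined"
        have "in_cell W \<kappa> l u \<longleftrightarrow> in_cell W \<kappa> ?l u" for u
          using W by (auto simp: in_cell_def subset_iff)
        moreover have "(W, \<kappa>, ?l) \<in> \<Xi>" using W \<kappa> True by (auto simp: \<Xi>_def)
        then have "at (W, \<kappa>, ?l) \<in> \<Theta>" by (simp add: \<Theta>_def)
        then have "in_cell W \<kappa> ?l v \<longleftrightarrow> in_cell W \<kappa> ?l w" using eq at[OF W] v w by blast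
        ultimately show ?thesis by simp
      next
        case False
        then have "\<not> in_cell W \<kappa> l u" for u using N unfolding in_cell_def by fastforce
        then show ?thesis by simp
      qed
    qed
    then obtain g where g: "g \<in> aut L M" "\<forall>x\<in>B. g x = x" "\<forall>x\<in>V. g (v x) = w x"
      unfolding B_def by blast
    \<comment> \<open>The map g fixes the parameters of p but not all elements of M, so it is an
      automorphism of the expansion by names for A only.\<close>
    let ?LA = "lang_expand L A"
    have "is_struct ?LA ?MM" using struct A(1) by (auto simp: is_struct_def)
    moreover have "is_iso ?LA ?MM ?MM g"
      using g(1,2) AB by (auto simp: is_iso_def aut_def is_aut_def)
    ultimately have "sat ?MM (g \<circ> v) p \<longleftrightarrow> sat ?MM v p"
      by (rule iso_sat) (use A(3) v in simp_all)
    moreover have "sat ?MM (g \<circ> v) p \<longleftrightarrow> sat ?MM w p"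
      by (rule sat_cong) (use g(3) in \<open>simp add: V_def\<close>)
    ultimately show ?thesis by simp
  qed
  ultimately have "\<exists>q\<in>bool_combs ?S. \<forall>v\<in>assignments M. sat ?MM v q \<longleftrightarrow> sat ?MM v p"
    by (rule bool_comb_of_determined)
  then show "\<exists>q\<in>bool_combs ?S. equivalent_in ?MM p q" unfolding equivalent_in_def by auto
qed

end

section \<open>The equivalence\<close>

text \<open>Truth is constant on orbits, so finitely many representatives realise all n-types. A
  representative is isolated by the conjunction of formulas separating it from each representative
  of a different type.\<close>

lemma (in perm_group) finite_types_if_finite_orbits:
  fixes L :: "('r, 'c) lang" and M :: "('r, 'c, 'a) fostruct"
  assumes M: "is_struct L M" and XG: "X = univ M" "G = aut L M"
    and orbits: "\<And>n. \<exists>S. finite S \<and> (\<forall>xs\<in>tuples X n. \<exists>ys\<in>S. conj_over {} xs ys)"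
  shows "finite_types L M"
  unfolding finite_types_def
proof
  fix n
  have neM: "univ M \<noteq> {}" using M by (simp add: is_struct_def)
  define tup where "tup v = map v [0..<n]" for v :: "nat \<Rightarrow> 'a"
  have tupX: "tup v \<in> tuples X n" if "v \<in> assignments M" for v
    using that by (auto simp: tup_def tuples_def assignments_def XG)
  have sat_conj: "sat M v q \<longleftrightarrow> sat M w q"
    if v: "v \<in> assignments M" and q: "fm_of L q" "fv q \<subseteq> {..<n}" and c: "conj_over {} (tup v) (tup w)" for v w q
  proof -
    obtain g where g: "g \<in> G" "map g (tup v) = tup w" using c by (auto simp: conj_over_def)
    have "g (v i) = w i" if "i < n" for i
      using arg_cong[OF g(2), of "\<lambda>xs. xs ! i"] that by (simp add: tup_def)
    then have "sat M w q \<longleftrightarrow> sat M (g \<circ> v) q" using q(2) by (intro sat_cong) auto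
    also have "\<dots> \<longleftrightarrow> sat M v q"
      by (rule iso_sat[OF M _ q(1) v]) (use g(1) in \<open>simp add: XG aut_def is_aut_def\<close>)
    finally show ?thesis by simp
  qed
  obtain S where S: "finite S" "\<forall>xs\<in>tuples X n. \<exists>ys\<in>S. conj_over {} xs ys" using orbits by blast
  define rep where "rep s = (SOME v. v \<in> assignments M \<and> conj_over {} (tup v) s)" for s
  define R where "R = {s \<in> S. \<exists>v\<in>assignments M. conj_over {} (tup v) s}"
  have rep: "rep s \<in> assignments M \<and> conj_over {} (tup (rep s)) s" if "s \<in> R" for s
    unfolding rep_def
    by (rule someI_ex[of "\<lambda>v. v \<in> assignments M \<and> conj_over {} (tup v) s"])
      (use that in \<open>auto simp: R_def\<close>)
  \<comment> \<open>The chosen formula holds at the representative of s and fails at that of t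
    whenever any formula does so.\<close>
  have "\<exists>q. fm_of L q \<and> fv q \<subseteq> {..<n} \<and> sat M (rep s) q \<and>
      ((\<exists>q. fm_of L q \<and> fv q \<subseteq> {..<n} \<and> sat M (rep s) q \<and> \<not> sat M (rep t) q) \<longrightarrow> \<not> sat M (rep t) q)" for s t
  proof (cases "\<exists>q. fm_of L q \<and> fv q \<subseteq> {..<n} \<and> sat M (rep s) q \<and> \<not> sat M (rep t) q")
    case False
    then show ?thesis using neM by (intro exI[of _ "Conjs []"]) (auto simp: sat_Conjs)
  qed blast
  then obtain sep where sep: "\<And>s t. fm_of L (sep s t)" "\<And>s t. fv (sep s t) \<subseteq> {..<n}"
    "\<And>s t. sat M (rep s) (sep s t)"
    "\<And>s t q. fm_of L q \<Longrightarrow> fv q \<subseteq> {..<n} \<Longrightarrow> sat M (rep s) q \<Longrightarrow> \<not> sat M (rep t) q \<Longrightarrow> \<not> sat M (rep t) (sep s t)"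
    by metis
  have "finite R" using S(1) by (simp add: R_def)
  then obtain rs where rs: "set rs = R" using finite_list by blast
  define iso where "iso s = Conjs (map (sep s) rs)" for s
  have iso_sat_iff: "sat M v (iso s) \<longleftrightarrow> (\<forall>t\<in>R. sat M v (sep s t))" for v s
    by (simp add: iso_def sat_Conjs[OF neM] rs)
  have to_rep: "\<exists>t\<in>R. conj_over {} (tup v) (tup (rep t))" if v: "v \<in> assignments M" for v
  proof -
    obtain t where t: "t \<in> S" "conj_over {} (tup v) t" using S(2) tupX[OF v] by blast
    then have tR: "t \<in> R" using v by (auto simp: R_def)
    have "conj_over {} (tup v) (tup (rep t))"
      using t(2) rep[OF tR] conj_over_sym conj_over_trans by meson
    then show ?thesis using tR by blast
  qed
  have "complete_fm L M n (iso s)" if s: "s \<in> R" for s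
    unfolding complete_fm_def
  proof (intro conjI allI impI)
    show "fm_of L (iso s)" using sep(1) by (simp add: iso_def)
    show "fv (iso s) \<subseteq> {..<n}" unfolding iso_def fv_Conjs using sep(2) by (simp add: UN_subset_iff)
    fix q assume q: "fm_of L q" "fv q \<subseteq> {..<n}"
    have key: "sat M v r" if r: "fm_of L r" "fv r \<subseteq> {..<n}" "sat M (rep s) r"
      and v: "v \<in> assignments M" "sat M v (iso s)" for v r
    proof -
      obtain t where t: "t \<in> R" "conj_over {} (tup v) (tup (rep t))" using to_rep v(1) by blast
      have "sat M (rep t) (sep s t)"
        using sat_conj[OF v(1) sep(1,2) t(2)] v(2) t(1) by (simp add: iso_sat_iff)
      then have "sat M (rep t) r" using sep(4) r by blast
      then show ?thesis using sat_conj[OF v(1) r(1,2) t(2)] by simp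
    qed
    show "(\<forall>v\<in>assignments M. sat M v (iso s) \<longrightarrow> sat M v q) \<or> (\<forall>v\<in>assignments M. sat M v (iso s) \<longrightarrow> \<not> sat M v q)"
    proof (cases "sat M (rep s) q")
      case True
      then show ?thesis using key[OF q] by blast
    next
      case False
      then have "\<forall>v\<in>assignments M. sat M v (iso s) \<longrightarrow> sat M v (Neg q)" using key[of "Neg q"] q by simp
      then show ?thesis by simp
    qed
  qed
  moreover have "\<exists>p\<in>iso ` R. sat M v p" if v: "v \<in> assignments M" for v
  proof -
    obtain t where t: "t \<in> R" "conj_over {} (tup v) (tup (rep t))" using to_rep v by blast
    have "sat M v (sep t t')" for t' using sat_conj[OF v sep(1,2) t(2)] sep(3) by simp
    then show ?thesis using t(1) by (auto simp: iso_sat_iff)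
  qed
  ultimately show "\<exists>\<Phi>. finite \<Phi> \<and> (\<forall>p\<in>\<Phi>. complete_fm L M n p) \<and> (\<forall>v\<in>assignments M. \<exists>p\<in>\<Phi>. sat M v p)"
    using \<open>finite R\<close> by (intro exI[of _ "iso ` R"]) auto
qed

lemma tame_cell_decomp:
  fixes M :: "('r, 'c, 'a) fostruct"
  assumes "tame_group (univ M) (aut L M)" and M: "is_struct L M" "countable (univ M)"
  shows "\<exists>K C (col :: 'a list \<Rightarrow> 'a list set). cell_decomp L M K C col"
proof -
  interpret tame_group "univ M" "aut L M" by fact
  obtain K C and col :: "'a list \<Rightarrow> 'a list set" where
    d: "finite K" "K \<subseteq> univ M" "finite (col ` C)"
     "\<forall>c\<in>C. distinct c \<and> c \<noteq> [] \<and> set c \<subseteq> univ M - K"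
     "\<forall>x\<in>univ M - K. \<exists>c\<in>C. x \<in> set c"
     "\<forall>c\<in>C. \<forall>c'\<in>C. set c = set c' \<or> set c \<inter> set c' = {}"
     "\<forall>c\<in>C. \<forall>c'\<in>C. col c = col c' \<longrightarrow> length c = length c'"
     "\<forall>g\<in>stab K. \<forall>c\<in>C. map g c \<in> C \<and> col (map g c) = col c"
     "\<forall>cs cs'. set cs \<subseteq> C \<longrightarrow> set cs' \<subseteq> C \<longrightarrow> distinct (map set cs) \<longrightarrow> distinct (map set cs') \<longrightarrow>
        map col cs = map col cs' \<longrightarrow> (\<exists>g\<in>stab K. map (map g) cs = cs')"
    using cell_decomposition by (elim exE conjE) (rule that)
  have "cell_decomp L M K C col"
  proof
    show "distinct c \<and> c \<noteq> [] \<and> set c \<subseteq> univ M - K" if "c \<in> C" for c using d(4) that by (rule bspec)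
    show "\<exists>c\<in>C. x \<in> set c" if "x \<in> univ M - K" for x using d(5) that by (rule bspec)
    show "set c = set c' \<or> set c \<inter> set c' = {}" if "c \<in> C" "c' \<in> C" for c c'
      using bspec[OF bspec[OF d(6) that(1)] that(2)] .
    show "length c = length c'" if "c \<in> C" "c' \<in> C" "col c = col c'" for c c'
      using bspec[OF bspec[OF d(7) that(1)] that(2)] that(3) by (rule mp)
    show "map g c \<in> C \<and> col (map g c) = col c"
      if g: "g \<in> aut L M" "\<And>x. x \<in> K \<Longrightarrow> g x = x" and c: "c \<in> C" for g c
    proof -
      have "g \<in> stab K" using g by (simp add: stab_def)
      then show ?thesis using d(8) c by blast
    qed
    show "\<exists>g\<in>aut L M. (\<forall>x\<in>K. g x = x) \<and> map (map g) cs = cs'"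
      if cs: "set cs \<subseteq> C" "set cs' \<subseteq> C" "distinct (map set cs)" "distinct (map set cs')" "map col cs = map col cs'"
      for cs cs'
    proof -
      obtain g where "g \<in> stab K" "map (map g) cs = cs'" using d(9)[rule_format, OF cs] by blast
      then show ?thesis by (auto simp: stab_def)
    qed
  qed (fact M d(1-3))+
  then show ?thesis by blast
qed

theorem theorem6:
  fixes L :: "('r, 'c) lang" and M :: "('r, 'c, 'a) fostruct"
  assumes "countable (Rels L)" and "countable (Consts L)"
    and "is_struct L M" and "countable (univ M)"
  shows "cellular L M \<longleftrightarrow> mutually_algebraic L M \<and> omega_categorical L M"
proof
  assume "cellular L M"
  then obtain n k K c where "cellular_struct L M n k K c" using assms(3) by (rule_tac cellular_structE)
  then interpret cellular_struct L M n k K c .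
  have fin: "finite_types L M"
    by (rule finite_types_if_finite_orbits[OF assms(3) refl refl cellular_finite_orbits])
  have "tame_group (univ M) (aut L M)"
    by unfold_locales (rule cellular_finite_orbits, rule cellular_separated)
  \<comment> \<open>The given partition has served to verify tameness; mutual algebraicity is read
    off a decomposition rebuilt from the group, which comes with colours and amalgamation.\<close>
  then obtain K C and col :: "'a list \<Rightarrow> 'a list set" where "cell_decomp L M K C col"
    using tame_cell_decomp assms(3,4) by blast
  then have "mutually_algebraic L M" using fin by (rule cell_decomp.mutually_algebraic)
  then show "mutually_algebraic L M \<and> omega_categorical L M"
    using finite_types_omega_categorical[OF assms(3) fin] by blast
next
  assume *: "mutually_algebraic L M \<and> omega_categorical L M"
  then have fin: "finite_types L M" using omega_categorical_finite_types assms by blast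
  interpret perm_group "univ M" "aut L M" by (rule perm_group_aut[OF assms(3)])
  have "tame_group (univ M) (aut L M)"
    by unfold_locales
      (rule finite_types_finite_orbits[OF assms(3,4) fin],
       rule mutually_algebraic_separated[OF assms(3,4) fin conjunct1[OF *]])
  then obtain K C and col :: "'a list \<Rightarrow> 'a list set" where "cell_decomp L M K C col"
    using tame_cell_decomp assms(3,4) by blast
  then show "cellular L M" by (rule cell_decomp.cellular)
qed

end
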